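(* Let $\mathbf X=(X,\mathcal E)$ and $\mathbf Y=(Y,\mathcal F)$ be coarse spaces, equipped with modules $\mathcal H_{\mathbf X}$ and $\mathcal H_{\mathbf Y}$. Let $\mathcal R\in\{{\rm cp},{\rm ql}\}$ and let $\phi\colon\mathbb C_{\rm cp}[\mathcal H_{\mathbf X}]\to C^*_{\mathcal R}(\mathcal H_{\mathbf Y})$ be a $*$-homomorphism. Suppose that: (i) $\mathcal H_{\mathbf X}$ is discrete; (ii) $\mathcal H_{\mathbf Y}$ is admissible; (iii) $\mathcal F$ is countably generated; (iv) $\phi$ is strongly continuous. If $\mathcal R={\rm cp}$, then $\phi$ is approximately-controlled: for every $E\in\mathcal E$ and $\varepsilon>0$ there is $F\in\mathcal F$ such that for every $t\in\mathbb C_{\rm cp}[\mathcal H_{\mathbf X}]$ of $E$-controlled propagation the operator $\phi(t)$ is $(\varepsilon\|t\|)$-$F$-approximable. Likewise, if $\mathcal R={\rm ql}$, then $\phi$ is quasi-controlled: for every $E\in\mathcal E$ and $\varepsilon>0$ there is $F\in\mathcal F$ such that for every $t\in\mathbb C_{\rm cp}[\mathcal H_{\mathbf X}]$ of $E$-controlled propagation the operator $\phi(t)$ is $(\varepsilon\|t\|)$-$F$-quasi-local.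
   Context: A coarse structure on a set $X$ is a family $\mathcal E$ of subsets of $X\times X$ (entourages) closed under subsets, finite unions, transposition $E^{\rm T}=\{(x,y)\mid(y,x)\in E\}$ and composition $E\circ E'=\{(z,x)\mid\exists y,(z,y)\in E,(y,x)\in E'\}$, and containing the diagonal; $(X,\mathcal E)$ is a coarse space. It is countably generated if $\mathcal E$ is the smallest coarse structure containing some countable family of relations. For $E\subseteq X\times X$, $A\subseteq X$ let $E(A)=\{y\mid\exists x\in A,(y,x)\in E\}$; $A$ is $E$-bounded if $A\times A\subseteq E$, bounded if $E$-bounded for some $E\in\mathcal E$. A gauge is a symmetric entourage containing the diagonal. A module $\mathcal H_{\mathbf X}$ over $\mathbf X$ is a Hilbert space with a unital Boolean algebra $\mathfrak A$ of subsets of $X$ (measurable sets) and a map $A\mapsto1_A$ from $\mathfrak A$ to projections with $1_{A\cap A'}=1_A1_{A'}$, $1_{A\sqcup A'}=1_A+1_{A'}$ for disjoint sets, $1_X=\mathrm{id}$, and such that for some gauge $\widetilde E$ the subspaces $1_A(\mathcal H_{\mathbf X})$, $A$ measurable $\widetilde E$-bounded, span a dense subspace. It is admissible if for some gauge $\widetilde E$ every $A\subseteq X$ is contained in a measurable set $A'\subseteq\widetilde E(A)$. It is discrete if there are a gauge $\widetilde E$ and a partition $X=\bigsqcup_iA_i$ into $\widetilde E$-bounded measurable sets with $\sum_i1_{A_i}=1$ strongly and such that $C\subseteq X$ is measurable whenever all $C\cap A_i$ are. For $E\in\mathcal E$, $t\in\mathcal B(\mathcal H_{\mathbf X})$ has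 $E$-controlled propagation if $1_{A'}t1_A=0$ for all measurable $A,A'$ with $A'\cap E(A)=\emptyset$; $\mathbb C_{\rm cp}[\mathcal H_{\mathbf X}]$ is the $*$-algebra of operators of $E$-controlled propagation for some $E\in\mathcal E$, and $C^*_{\rm cp}$ its norm closure. $t$ is $\varepsilon$-$E$-approximable if it is within norm distance $\varepsilon$ of an operator of $E$-controlled propagation; it is $\varepsilon$-$E$-quasi-local if $\|1_{A'}t1_A\|\le\varepsilon$ for all measurable $A,A'$ with $A'\cap E(A)=\emptyset$; it is quasi-local if for every $\varepsilon>0$ it is $\varepsilon$-$E$-quasi-local for some $E\in\mathcal E$. $C^*_{\rm ql}$ is the set of quasi-local operators (a $C^*$-algebra for admissible modules). Strongly continuous means continuous for the strong operator topologies. *)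

theory Defs
  imports "HOL-Analysis.Analysis"
begin

section \<open>Complex Hilbert spaces and their bounded operators\<close>

text \<open>A complex Hilbert space is a complete real inner product space (with norm, distance and
  topology as in the library) whose inner product is the real part of a complex one. The
  complex inner product is linear in its second argument.\<close>

class complex_hilbert_space = real_inner + complete_space +
  fixes scaleC :: "complex \<Rightarrow> 'a \<Rightarrow> 'a" (infixr \<open>*\<^sub>C\<close> 75)
    and cinner :: "'a \<Rightarrow> 'a \<Rightarrow> complex"
  assumes scaleC_add_right: "c *\<^sub>C (x + y) = c *\<^sub>C x + c *\<^sub>C y"
    and scaleC_add_left: "(c + d) *\<^sub>C x = c *\<^sub>C x + d *\<^sub>C x"
    and scaleC_scaleC: "c *\<^sub>C (d *\<^sub>C x) = (c * d) *\<^sub>C x"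
    and scaleC_of_real: "of_real r *\<^sub>C x = r *\<^sub>R x"
    and cinner_commute: "cinner x y = cnj (cinner y x)"
    and cinner_add_right: "cinner x (y + z) = cinner x y + cinner x z"
    and cinner_scaleC_right: "cinner x (c *\<^sub>C y) = c * cinner x y"
    and Re_cinner: "Re (cinner x y) = inner x y"

lemma cinner_eq:
  fixes x y :: "'a::complex_hilbert_space"
  shows "cinner x y = Complex (inner x y) (- inner x (\<i> *\<^sub>C y))"
  using cinner_scaleC_right[of x \<i> y] Re_cinner[of x y] Re_cinner[of x "\<i> *\<^sub>C y"]
  by (simp add: complex_eq_iff)

lemma norm_scaleC:
  fixes x :: "'a::complex_hilbert_space"
  shows "norm (c *\<^sub>C x) = cmod c * norm x"
proof -
  have "cinner (c *\<^sub>C x) (c *\<^sub>C x) = c * (cnj c * cinner x x)"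
    by (metis cinner_scaleC_right cinner_commute complex_cnj_mult complex_cnj_cnj)
  also have "\<dots> = of_real ((cmod c)\<^sup>2) * cinner x x"
    by (metis complex_norm_square mult.assoc)
  finally have "Re (cinner (c *\<^sub>C x) (c *\<^sub>C x)) = (cmod c)\<^sup>2 * Re (cinner x x)"
    by simp
  then have "inner (c *\<^sub>C x) (c *\<^sub>C x) = (cmod c)\<^sup>2 * inner x x"
    by (simp add: Re_cinner)
  then show ?thesis
    by (simp add: norm_eq_sqrt_inner real_sqrt_mult)
qed

lemma bounded_linear_scaleC:
  "bounded_linear (\<lambda>x::'a::complex_hilbert_space. c *\<^sub>C x)"
proof (rule bounded_linear_intro[where K = "cmod c"])
  fix r and x :: 'a
  show "c *\<^sub>C (r *\<^sub>R x) = r *\<^sub>R (c *\<^sub>C x)"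
    by (metis scaleC_of_real scaleC_scaleC mult.commute)
qed (simp_all add: scaleC_add_right norm_scaleC)

text \<open>$\mathcal B(H)$ is the set of complex linear elements of the type of bounded real linear
  maps of the library, which supplies the operator norm, composition, and the strong operator
  topology.\<close>

definition bounded_ops :: "('a::complex_hilbert_space \<Rightarrow>\<^sub>L 'a) set" where
  "bounded_ops = {t. \<forall>c x. blinfun_apply t (c *\<^sub>C x) = c *\<^sub>C blinfun_apply t x}"

lift_definition scaleC_op ::
  "complex \<Rightarrow> ('a::real_normed_vector \<Rightarrow>\<^sub>L 'b::complex_hilbert_space) \<Rightarrow> ('a \<Rightarrow>\<^sub>L 'b)"
  is "\<lambda>c t x. c *\<^sub>C t x"
  by (rule bounded_linear_compose[OF bounded_linear_scaleC])

definition adj :: "('a::complex_hilbert_space \<Rightarrow>\<^sub>L 'a) \<Rightarrow> ('a \<Rightarrow>\<^sub>L 'a)" where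
  "adj t = (THE s. \<forall>x y. cinner (blinfun_apply s x) y = cinner x (blinfun_apply t y))"

text \<open>The description operator is well defined on \<open>bounded_ops\<close>, by the Riesz
  representation theorem.\<close>

lemma riesz_representation:
  fixes f :: "'a::{real_inner,complete_space} \<Rightarrow> real"
  assumes f: "bounded_linear f"
  shows "\<exists>z. \<forall>x. f x = inner z x"
proof -
  interpret f: bounded_linear f by fact
  define q where "q x = inner x x - 2 * f x" for x
  obtain K where K: "\<And>x. norm (f x) \<le> norm x * K"
    using f.bounded by blast
  have lower: "q x \<ge> - K\<^sup>2" for x
  proof -
    have "f x \<le> norm x * K" using K[of x] by simp
    moreover have "0 \<le> (norm x - K)\<^sup>2" by simp
    ultimately show ?thesis
      by (simp add: q_def power2_norm_eq_inner[symmetric] power2_diff)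
  qed
  then have bdd: "bdd_below (range q)" by (intro bdd_belowI2)
  define m where "m = Inf (range q)"
  have m_le: "m \<le> q x" for x
    unfolding m_def by (rule cInf_lower[OF _ bdd]) simp
  have "\<exists>x. q x < m + inverse (real (Suc n))" for n
  proof -
    have "\<exists>y\<in>range q. y < m + inverse (real (Suc n))"
      unfolding m_def by (rule cInf_lessD) auto
    then show ?thesis by blast
  qed
  then obtain u where u: "\<And>n. q (u n) < m + inverse (real (Suc n))" by metis
  have par: "(norm (x - y))\<^sup>2 \<le> 2 * (q x - m) + 2 * (q y - m)" for x y
  proof -
    have "4 * q ((1/2) *\<^sub>R (x + y)) = 2 * q x + 2 * q y - (norm (x - y))\<^sup>2"
      by (simp add: q_def power2_norm_eq_inner f.scaleR f.add inner_add_left inner_add_right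
          inner_diff_left inner_diff_right inner_commute algebra_simps)
    with m_le[of "(1/2) *\<^sub>R (x + y)"] show ?thesis by simp
  qed
  have "Cauchy u"
  proof (rule metric_CauchyI)
    fix e :: real assume e: "0 < e"
    then have "0 < e\<^sup>2 / 4" by simp
    then obtain N where N: "inverse (real (Suc N)) < e\<^sup>2 / 4"
      using reals_Archimedean by blast
    have *: "q (u n) - m < e\<^sup>2 / 4" if "n \<ge> N" for n
    proof -
      have "inverse (real (Suc n)) \<le> inverse (real (Suc N))"
        using that by (intro le_imp_inverse_le) auto
      with u[of n] N show ?thesis by linarith
    qed
    have "dist (u n) (u k) < e" if "n \<ge> N" "k \<ge> N" for n k
    proof -
      have "(norm (u n - u k))\<^sup>2 < e\<^sup>2"
        using par[of "u n" "u k"] *[OF that(1)] *[OF that(2)] by argo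
      then show ?thesis
        using e by (simp add: dist_norm power2_less_imp_less)
    qed
    then show "\<exists>M. \<forall>n\<ge>M. \<forall>k\<ge>M. dist (u n) (u k) < e" by blast
  qed
  then obtain z where z: "u \<longlonglongrightarrow> z"
    using Cauchy_convergent convergent_def by blast
  have "(\<lambda>n. q (u n)) \<longlonglongrightarrow> q z"
    unfolding q_def by (intro tendsto_intros f.tendsto z)
  moreover have "(\<lambda>n. m + inverse (real (Suc n))) \<longlonglongrightarrow> m"
    using LIMSEQ_inverse_real_of_nat_add by blast
  ultimately have qz: "q z \<le> m"
    by (rule LIMSEQ_le) (use u less_imp_le in blast)
  have "f v = inner z v" for v
  proof -
    define d where "d = inner z v - f v"
    define s where "s = - d / (inner v v + 1)"
    have "q (z + s *\<^sub>R v) = q z + 2 * s * d + s\<^sup>2 * inner v v"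
      by (simp add: q_def d_def f.scaleR f.add inner_add_left inner_add_right inner_commute
          power2_eq_square algebra_simps)
    with m_le[of "z + s *\<^sub>R v"] qz have 1: "0 \<le> 2 * s * d + s\<^sup>2 * inner v v" by linarith
    have pos: "inner v v + 1 > 0" using inner_ge_zero[of v] by linarith
    have d: "d = - s * (inner v v + 1)" using pos by (simp add: s_def)
    have "0 \<le> - s\<^sup>2 * (inner v v + 2)"
      using 1 unfolding d by (simp add: power2_eq_square algebra_simps)
    then have "s\<^sup>2 * (inner v v + 2) \<le> 0" by simp
    moreover have "inner v v + 2 > 0" using pos by linarith
    ultimately have "s\<^sup>2 \<le> 0" by (metis mult_pos_pos not_le)
    then have "s = 0" by simp
    then show ?thesis using d d_def by simp
  qed
  then show ?thesis by blast
qed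

lemma cinner_adj:
  fixes t :: "'a::complex_hilbert_space \<Rightarrow>\<^sub>L 'a"
  assumes t: "t \<in> bounded_ops"
  shows "cinner (blinfun_apply (adj t) x) y = cinner x (blinfun_apply t y)"
proof -
  have "\<exists>z. \<forall>y. inner x (blinfun_apply t y) = inner z y" for x
    by (rule riesz_representation)
      (intro bounded_linear_compose[OF bounded_linear_inner_right] blinfun.bounded_linear_right)
  then obtain s where s: "\<And>x y. inner x (blinfun_apply t y) = inner (s x) y" by metis
  have "bounded_linear s"
  proof (rule bounded_linear_intro[where K = "norm t"])
    show "s (x + y) = s x + s y" for x y
      by (rule vector_eq_rdot[THEN iffD1]) (simp add: inner_add_left s[symmetric])
    show "s (r *\<^sub>R x) = r *\<^sub>R s x" for r x
      by (rule vector_eq_rdot[THEN iffD1]) (simp add: s[symmetric])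
    show "norm (s x) \<le> norm x * norm t" for x
    proof (cases "s x = 0")
      case False
      have "norm (s x) * norm (s x) = inner x (blinfun_apply t (s x))"
        by (simp add: s power2_norm_eq_inner[symmetric] power2_eq_square)
      also have "\<dots> \<le> norm x * norm (blinfun_apply t (s x))"
        by (rule norm_cauchy_schwarz)
      also have "\<dots> \<le> norm x * (norm t * norm (s x))"
        by (intro mult_left_mono norm_blinfun) simp
      finally have "norm (s x) * norm (s x) \<le> (norm x * norm t) * norm (s x)"
        by (simp add: mult.assoc)
      with False show ?thesis by simp
    qed simp
  qed
  then have app: "blinfun_apply (Blinfun s) = s" by (rule bounded_linear_Blinfun_apply)
  have "\<forall>x y. cinner (blinfun_apply (Blinfun s) x) y = cinner x (blinfun_apply t y)"
    using t unfolding app cinner_eq by (simp add: s[symmetric] bounded_ops_def)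
  then have "\<forall>x y. cinner (blinfun_apply (adj t) x) y = cinner x (blinfun_apply t y)"
    unfolding adj_def
  proof (rule theI)
    fix s' assume s': "\<forall>x y. cinner (blinfun_apply s' x) y = cinner x (blinfun_apply t y)"
    show "s' = Blinfun s"
    proof (rule blinfun_eqI)
      fix x
      show "blinfun_apply s' x = blinfun_apply (Blinfun s) x"
        using s' by (intro vector_eq_rdot[THEN iffD1]) (metis Re_cinner app s)
    qed
  qed
  then show ?thesis by blast
qed

definition projection :: "('a::complex_hilbert_space \<Rightarrow>\<^sub>L 'a) \<Rightarrow> bool" where
  "projection p \<longleftrightarrow> p \<in> bounded_ops \<and> p o\<^sub>L p = p \<and> adj p = p"

section \<open>Coarse spaces\<close>

locale coarse_space =
  fixes X :: "'x set" and \<E> :: "('x \<times> 'x) set set"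
  assumes entourage_subset: "E \<in> \<E> \<Longrightarrow> E \<subseteq> X \<times> X"
    and entourage_mono: "\<lbrakk>E \<in> \<E>; E' \<subseteq> E\<rbrakk> \<Longrightarrow> E' \<in> \<E>"
    and entourage_Un: "\<lbrakk>E \<in> \<E>; E' \<in> \<E>\<rbrakk> \<Longrightarrow> E \<union> E' \<in> \<E>"
    and entourage_converse: "E \<in> \<E> \<Longrightarrow> E\<inverse> \<in> \<E>"
    and entourage_comp: "\<lbrakk>E \<in> \<E>; E' \<in> \<E>\<rbrakk> \<Longrightarrow> E O E' \<in> \<E>"
    and entourage_diag: "Id_on X \<in> \<E>"

definition countably_generated :: "'x set \<Rightarrow> ('x \<times> 'x) set set \<Rightarrow> bool" where
  "countably_generated X \<E> \<longleftrightarrow>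
     (\<exists>\<G>. countable \<G> \<and> coarse_space X \<E> \<and> \<G> \<subseteq> \<E> \<and>
          (\<forall>\<E>'. coarse_space X \<E>' \<and> \<G> \<subseteq> \<E>' \<longrightarrow> \<E> \<subseteq> \<E>'))"

text \<open>$E(A)$; note that the argument is in the second coordinate.\<close>

definition nbhd :: "('x \<times> 'x) set \<Rightarrow> 'x set \<Rightarrow> 'x set" where
  "nbhd E A = {y. \<exists>x\<in>A. (y, x) \<in> E}"

definition rel_bounded :: "('x \<times> 'x) set \<Rightarrow> 'x set \<Rightarrow> bool" where
  "rel_bounded E A \<longleftrightarrow> A \<times> A \<subseteq> E"

definition gauge_of :: "'x set \<Rightarrow> ('x \<times> 'x) set set \<Rightarrow> ('x \<times> 'x) set \<Rightarrow> bool" where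
  "gauge_of X \<E> E \<longleftrightarrow> E \<in> \<E> \<and> sym E \<and> Id_on X \<subseteq> E"

section \<open>Modules\<close>

text \<open>The projection $1_A$ is \<open>P A\<close>; its values on sets outside \<open>\<AA>\<close> are irrelevant.
  The type \<open>'h\<close> plays the role of the Hilbert space. The term \<open>module.span scaleC\<close> is the
  complex linear span.\<close>

locale coarse_module = coarse_space X \<E> + algebra X \<AA>
  for X :: "'x set" and \<E> :: "('x \<times> 'x) set set" and \<AA> :: "'x set set" +
  fixes P :: "'x set \<Rightarrow> ('h::complex_hilbert_space \<Rightarrow>\<^sub>L 'h)"
  assumes proj: "A \<in> \<AA> \<Longrightarrow> projection (P A)"
    and proj_Int: "\<lbrakk>A \<in> \<AA>; A' \<in> \<AA>\<rbrakk> \<Longrightarrow> P (A \<inter> A') = P A o\<^sub>L P A'"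
    and proj_Un: "\<lbrakk>A \<in> \<AA>; A' \<in> \<AA>; A \<inter> A' = {}\<rbrakk> \<Longrightarrow> P (A \<union> A') = P A + P A'"
    and proj_space: "P X = id_blinfun"
    and dense: "\<exists>E. gauge_of X \<E> E \<and>
      closure (module.span scaleC
        (\<Union>A\<in>{A \<in> \<AA>. rel_bounded E A}. range (blinfun_apply (P A)))) = UNIV"

definition admissible_module ::
  "'x set \<Rightarrow> ('x \<times> 'x) set set \<Rightarrow> 'x set set \<Rightarrow>
    ('x set \<Rightarrow> ('h::complex_hilbert_space \<Rightarrow>\<^sub>L 'h)) \<Rightarrow> bool" where
  "admissible_module X \<E> \<AA> P \<longleftrightarrow> coarse_module X \<E> \<AA> P \<and>
     (\<exists>E. gauge_of X \<E> E \<and> (\<forall>A\<subseteq>X. \<exists>A'\<in>\<AA>. A \<subseteq> A' \<and> A' \<subseteq> nbhd E A))"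

text \<open>The partition is a set of nonempty sets rather than an indexed family; empty members
  of a family contribute nothing to any of the conditions. The predicate \<open>has_sum\<close> on vectors
  expresses strong convergence of the sum.\<close>

definition discrete_module ::
  "'x set \<Rightarrow> ('x \<times> 'x) set set \<Rightarrow> 'x set set \<Rightarrow>
    ('x set \<Rightarrow> ('h::complex_hilbert_space \<Rightarrow>\<^sub>L 'h)) \<Rightarrow> bool" where
  "discrete_module X \<E> \<AA> P \<longleftrightarrow> coarse_module X \<E> \<AA> P \<and>
     (\<exists>E \<P>. gauge_of X \<E> E \<and> partition_on X \<P> \<and>
        (\<forall>A\<in>\<P>. A \<in> \<AA> \<and> rel_bounded E A) \<and>
        (\<forall>v. ((\<lambda>A. blinfun_apply (P A) v) has_sum v) \<P>) \<and>
        (\<forall>C\<subseteq>X. (\<forall>A\<in>\<P>. C \<inter> A \<in> \<AA>) \<longrightarrow> C \<in> \<AA>))"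

section \<open>Roe-like algebras\<close>

definition controlled_propagation ::
  "'x set set \<Rightarrow> ('x set \<Rightarrow> ('h::complex_hilbert_space \<Rightarrow>\<^sub>L 'h)) \<Rightarrow> ('x \<times> 'x) set \<Rightarrow>
    ('h \<Rightarrow>\<^sub>L 'h) \<Rightarrow> bool" where
  "controlled_propagation \<AA> P E t \<longleftrightarrow> t \<in> bounded_ops \<and>
     (\<forall>A\<in>\<AA>. \<forall>A'\<in>\<AA>. A' \<inter> nbhd E A = {} \<longrightarrow> P A' o\<^sub>L t o\<^sub>L P A = 0)"

definition quasi_local ::
  "'x set set \<Rightarrow> ('x set \<Rightarrow> ('h::complex_hilbert_space \<Rightarrow>\<^sub>L 'h)) \<Rightarrow> real \<Rightarrow>
    ('x \<times> 'x) set \<Rightarrow> ('h \<Rightarrow>\<^sub>L 'h) \<Rightarrow> bool" where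
  "quasi_local \<AA> P \<epsilon> E t \<longleftrightarrow> t \<in> bounded_ops \<and>
     (\<forall>A\<in>\<AA>. \<forall>A'\<in>\<AA>. A' \<inter> nbhd E A = {} \<longrightarrow> norm (P A' o\<^sub>L t o\<^sub>L P A) \<le> \<epsilon>)"

definition approximable ::
  "'x set set \<Rightarrow> ('x set \<Rightarrow> ('h::complex_hilbert_space \<Rightarrow>\<^sub>L 'h)) \<Rightarrow> real \<Rightarrow>
    ('x \<times> 'x) set \<Rightarrow> ('h \<Rightarrow>\<^sub>L 'h) \<Rightarrow> bool" where
  "approximable \<AA> P \<epsilon> E t \<longleftrightarrow> t \<in> bounded_ops \<and>
     (\<exists>s. controlled_propagation \<AA> P E s \<and> norm (t - s) \<le> \<epsilon>)"

definition cp_ops ::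
  "('x \<times> 'x) set set \<Rightarrow> 'x set set \<Rightarrow> ('x set \<Rightarrow> ('h::complex_hilbert_space \<Rightarrow>\<^sub>L 'h)) \<Rightarrow>
    ('h \<Rightarrow>\<^sub>L 'h) set" where
  "cp_ops \<E> \<AA> P = {t. \<exists>E\<in>\<E>. controlled_propagation \<AA> P E t}"

definition ql_ops ::
  "('x \<times> 'x) set set \<Rightarrow> 'x set set \<Rightarrow> ('x set \<Rightarrow> ('h::complex_hilbert_space \<Rightarrow>\<^sub>L 'h)) \<Rightarrow>
    ('h \<Rightarrow>\<^sub>L 'h) set" where
  "ql_ops \<E> \<AA> P = {t. \<forall>\<epsilon>>0. \<exists>E\<in>\<E>. quasi_local \<AA> P \<epsilon> E t}"

datatype roe_kind = CP | QL

fun roe_algebra ::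
  "roe_kind \<Rightarrow> ('x \<times> 'x) set set \<Rightarrow> 'x set set \<Rightarrow>
    ('x set \<Rightarrow> ('h::complex_hilbert_space \<Rightarrow>\<^sub>L 'h)) \<Rightarrow> ('h \<Rightarrow>\<^sub>L 'h) set" where
  "roe_algebra CP \<E> \<AA> P = closure (cp_ops \<E> \<AA> P)"
| "roe_algebra QL \<E> \<AA> P = ql_ops \<E> \<AA> P"

section \<open>Homomorphisms\<close>

text \<open>A $*$-homomorphism between sets \<open>S\<close>, \<open>T\<close> of operators; it is not required to be unital.\<close>

definition star_hom ::
  "('h::complex_hilbert_space \<Rightarrow>\<^sub>L 'h) set \<Rightarrow> ('k::complex_hilbert_space \<Rightarrow>\<^sub>L 'k) set \<Rightarrow>
    (('h \<Rightarrow>\<^sub>L 'h) \<Rightarrow> ('k \<Rightarrow>\<^sub>L 'k)) \<Rightarrow> bool" where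
  "star_hom S T \<phi> \<longleftrightarrow> (\<forall>s\<in>S. \<phi> s \<in> T) \<and>
     (\<forall>s\<in>S. \<forall>t\<in>S. \<phi> (s + t) = \<phi> s + \<phi> t) \<and>
     (\<forall>c. \<forall>s\<in>S. \<phi> (scaleC_op c s) = scaleC_op c (\<phi> s)) \<and>
     (\<forall>s\<in>S. \<forall>t\<in>S. \<phi> (s o\<^sub>L t) = \<phi> s o\<^sub>L \<phi> t) \<and>
     (\<forall>s\<in>S. \<phi> (adj s) = adj (\<phi> s))"

definition strongly_continuous ::
  "('h::complex_hilbert_space \<Rightarrow>\<^sub>L 'h) set \<Rightarrow> ('k::complex_hilbert_space \<Rightarrow>\<^sub>L 'k) set \<Rightarrow>
    (('h \<Rightarrow>\<^sub>L 'h) \<Rightarrow> ('k \<Rightarrow>\<^sub>L 'k)) \<Rightarrow> bool" where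
  "strongly_continuous S T \<phi> \<longleftrightarrow>
     continuous_map (subtopology strong_operator_topology S)
       (subtopology strong_operator_topology T) \<phi>"

definition approximately_controlled ::
  "('x \<times> 'x) set set \<Rightarrow> 'x set set \<Rightarrow> ('x set \<Rightarrow> ('h::complex_hilbert_space \<Rightarrow>\<^sub>L 'h)) \<Rightarrow>
   ('y \<times> 'y) set set \<Rightarrow> 'y set set \<Rightarrow> ('y set \<Rightarrow> ('k::complex_hilbert_space \<Rightarrow>\<^sub>L 'k)) \<Rightarrow>
    (('h \<Rightarrow>\<^sub>L 'h) \<Rightarrow> ('k \<Rightarrow>\<^sub>L 'k)) \<Rightarrow> bool" where
  "approximately_controlled \<E> \<AA> P \<F> \<BB> Q \<phi> \<longleftrightarrow>
     (\<forall>E\<in>\<E>. \<forall>\<epsilon>>0. \<exists>F\<in>\<F>. \<forall>t\<in>cp_ops \<E> \<AA> P.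
        controlled_propagation \<AA> P E t \<longrightarrow> approximable \<BB> Q (\<epsilon> * norm t) F (\<phi> t))"

definition quasi_controlled ::
  "('x \<times> 'x) set set \<Rightarrow> 'x set set \<Rightarrow> ('x set \<Rightarrow> ('h::complex_hilbert_space \<Rightarrow>\<^sub>L 'h)) \<Rightarrow>
   ('y \<times> 'y) set set \<Rightarrow> 'y set set \<Rightarrow> ('y set \<Rightarrow> ('k::complex_hilbert_space \<Rightarrow>\<^sub>L 'k)) \<Rightarrow>
    (('h \<Rightarrow>\<^sub>L 'h) \<Rightarrow> ('k \<Rightarrow>\<^sub>L 'k)) \<Rightarrow> bool" where
  "quasi_controlled \<E> \<AA> P \<F> \<BB> Q \<phi> \<longleftrightarrow>
     (\<forall>E\<in>\<E>. \<forall>\<epsilon>>0. \<exists>F\<in>\<F>. \<forall>t\<in>cp_ops \<E> \<AA> P.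
        controlled_propagation \<AA> P E t \<longrightarrow> quasi_local \<BB> Q (\<epsilon> * norm t) F (\<phi> t))"

end

theory Submission
  imports Defs
begin

text \<open>Fix a cofinal increasing sequence of symmetric entourages $F_n$ of $Y$. Suppose that
  orthogonal blocks $t_n$ of norm at most 1 are such that $\phi(t_n)$ is not $\delta$-good for
  $F_n$. Every partial sum $t_D = \sum_{n \in D} t_n$ exists strongly and has controlled
  propagation, and $D \mapsto \phi(t_D)$ is strongly continuous on the Cantor space. The
  operators that are $\delta/2$-good for $F_n$ form a strongly closed set (for approximability
  by weak compactness of balls), so a Baire category argument gives a contradiction.

  It remains to produce orthogonal blocks from a failure of uniformity. By strong closedness,
  bad operators may be compressed to finite rank projections compatible with the partition.
  To move them away from a given finite rank projection one needs uniformity on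
  $|\xi\rangle\langle\eta|$ for fixed $\xi$ and $\eta$ supported near $\xi$, which follows
  from the same category argument applied to matrix units $|a_n\rangle\langle b_n|$.\<close>

section \<open>Complex Hilbert space preliminaries\<close>

text \<open>The homomorphism is not assumed bounded: only strong continuity, the algebraic
  identities and the goodness of each single image are available. The one norm bound on images
  concerns matrix units, whose images are partial isometries; it makes the factorisation of rank one
  operators quantitative. Two constraints shape the construction. All blocks must be controlled by
  one entourage, as otherwise their infinite sums could leave the domain of \<phi>. Therefore finite
  rank projections are spanned by vectors that each live in a single cell of the partition, so that
  they commute with the cell projections, and propagation is tested on pairs of cells. Secondly, let
  q be a finite rank projection already used up and q' its complement. By t - q' t q' = q t + q' t
  q, passing to the corner q' t q' loses only finitely many rows |b><adj t b| and columns |q' t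
  b><b|. In each of them one vector is fixed and the other is confined to a neighbourhood of the
  cell of b, which is why uniformity on rank one operators suffices.\<close>

instance complex_hilbert_space \<subseteq> banach ..

lemma cinner_add_left: "cinner (x + y) (z::'a::complex_hilbert_space) = cinner x z + cinner y z"
  by (metis cinner_add_right cinner_commute complex_cnj_add)

lemma cinner_scaleC_left: "cinner (c *\<^sub>C x) (y::'a::complex_hilbert_space) = cnj c * cinner x y"
  by (metis cinner_scaleC_right cinner_commute complex_cnj_mult)

lemma scaleC_one [simp]: "1 *\<^sub>C (x::'a::complex_hilbert_space) = x"
  by (metis of_real_1 scaleC_of_real scaleR_one)

lemma scaleC_zero [simp]: "0 *\<^sub>C (x::'a::complex_hilbert_space) = 0"
  by (metis of_real_0 scaleC_of_real scaleR_zero_left)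

lemma scaleC_minus_one: "(-1) *\<^sub>C (x::'a::complex_hilbert_space) = - x"
  by (metis of_real_1 of_real_minus scaleC_of_real scaleR_minus1_left)

lemma scaleC_zero_right [simp]: "c *\<^sub>C (0::'a::complex_hilbert_space) = 0"
  using bounded_linear.linear[OF bounded_linear_scaleC[of c]] by (rule linear_0)

lemma scaleC_diff_right: "c *\<^sub>C (x - y) = c *\<^sub>C x - c *\<^sub>C (y::'a::complex_hilbert_space)"
  using bounded_linear.linear[OF bounded_linear_scaleC[of c]] by (rule linear_diff)

lemma cinner_minus_right: "cinner x (- y) = - cinner x (y::'a::complex_hilbert_space)"
  by (metis cinner_scaleC_right scaleC_minus_one mult_minus1)

lemma cinner_diff_right: "cinner x (y - z) = cinner x y - cinner x (z::'a::complex_hilbert_space)"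
  by (metis cinner_add_right cinner_minus_right uminus_add_conv_diff add.commute)

lemma cinner_diff_left: "cinner (x - y) z = cinner x z - cinner y (z::'a::complex_hilbert_space)"
  by (metis cinner_diff_right cinner_commute complex_cnj_diff)

lemma cinner_zero_right [simp]: "cinner x (0::'a::complex_hilbert_space) = 0"
  by (metis cinner_diff_right diff_self)

lemma cinner_zero_left [simp]: "cinner (0::'a::complex_hilbert_space) x = 0"
  by (metis cinner_diff_left diff_self)

lemma cinner_sum_right:
  "cinner x (\<Sum>i\<in>S. f i) = (\<Sum>i\<in>S. cinner x (f i::'a::complex_hilbert_space))"
  by (induction S rule: infinite_finite_induct) (auto simp: cinner_add_right)

lemma cinner_self: "cinner x (x::'a::complex_hilbert_space) = of_real ((norm x)\<^sup>2)"
proof -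
  have "Im (cinner x x) = 0" using arg_cong[OF cinner_commute[of x x], of Im] by simp
  then show ?thesis
    by (simp add: complex_eq_iff Re_cinner power2_norm_eq_inner)
qed

lemma cinner_eq_zero_commute: "cinner x y = 0 \<longleftrightarrow> cinner y (x::'a::complex_hilbert_space) = 0"
  by (metis cinner_commute complex_cnj_zero)

lemma norm_cinner_le: "cmod (cinner x y) \<le> norm x * norm (y::'a::complex_hilbert_space)"
proof (cases "cinner x y = 0")
  case False
  let ?c = "cinner x y"
  have "cmod ?c * cmod ?c = Re (cnj ?c * ?c)"
    by (metis Re_complex_of_real complex_norm_square mult.commute power2_eq_square)
  also have "\<dots> = inner x (cnj ?c *\<^sub>C y)"
    by (simp add: Re_cinner[symmetric] cinner_scaleC_right)
  also have "\<dots> \<le> norm x * norm (cnj ?c *\<^sub>C y)" by (rule norm_cauchy_schwarz)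
  also have "\<dots> = cmod ?c * (norm x * norm y)" by (simp add: norm_scaleC)
  finally show ?thesis using False by simp
qed simp

lemma cinner_eqI:
  assumes "\<And>y. cinner x y = cinner z (y::'a::complex_hilbert_space)" shows "x = z"
proof -
  have "cinner (x - z) (x - z) = 0" using assms[of "x - z"] by (simp only: cinner_diff_left diff_self)
  then show ?thesis by (simp add: cinner_self)
qed

section \<open>The algebra of bounded operators\<close>

lemma bounded_opsD: "t \<in> bounded_ops \<Longrightarrow> blinfun_apply t (c *\<^sub>C x) = c *\<^sub>C blinfun_apply t x"
  by (simp add: bounded_ops_def)

lemma scaleC_op_apply [simp]: "blinfun_apply (scaleC_op c t) x = c *\<^sub>C blinfun_apply t x"
  by (simp add: scaleC_op.rep_eq)

lemma scaleC_op_minus_one: "scaleC_op (-1) t = - t"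
  by (rule blinfun_eqI) (simp add: scaleC_minus_one blinfun.minus_left)

lemma scaleC_op_of_real: "scaleC_op (of_real r) t = r *\<^sub>R t"
  by (rule blinfun_eqI) (simp add: scaleC_of_real blinfun.scaleR_left)

lemma scaleC_op_one [simp]: "scaleC_op 1 t = t"
  by (rule blinfun_eqI) simp

lemma scaleC_op_zero [simp]: "scaleC_op 0 t = 0"
  by (rule blinfun_eqI) simp

lemma scaleC_op_zero_right: "scaleC_op c 0 = 0"
  by (rule blinfun_eqI) simp

lemma norm_scaleC_op_le: "norm (scaleC_op c t) \<le> cmod c * norm t"
proof (rule norm_blinfun_bound)
  fix x
  have "cmod c * norm (t x) \<le> cmod c * (norm t * norm x)"
    by (intro mult_left_mono norm_blinfun) simp
  then show "norm (blinfun_apply (scaleC_op c t) x) \<le> cmod c * norm t * norm x"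
    by (simp add: norm_scaleC mult.assoc)
qed simp

lemma bounded_ops_add: "s \<in> bounded_ops \<Longrightarrow> t \<in> bounded_ops \<Longrightarrow> s + t \<in> bounded_ops"
  by (simp add: bounded_ops_def blinfun.add_left scaleC_add_right)

lemma bounded_ops_diff: "s \<in> bounded_ops \<Longrightarrow> t \<in> bounded_ops \<Longrightarrow> s - t \<in> bounded_ops"
  by (simp add: bounded_ops_def blinfun.diff_left scaleC_diff_right)

lemma bounded_ops_zero: "0 \<in> bounded_ops"
  by (simp add: bounded_ops_def)

lemma bounded_ops_id: "id_blinfun \<in> bounded_ops"
  by (simp add: bounded_ops_def)

lemma bounded_ops_sum: "(\<And>i. i \<in> S \<Longrightarrow> f i \<in> bounded_ops) \<Longrightarrow> sum f S \<in> bounded_ops"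
  by (induction S rule: infinite_finite_induct) (auto simp: bounded_ops_zero bounded_ops_add)

lemma bounded_ops_scaleC: "t \<in> bounded_ops \<Longrightarrow> scaleC_op c t \<in> bounded_ops"
  by (simp add: bounded_ops_def scaleC_scaleC mult.commute)

lemma bounded_ops_compose: "s \<in> bounded_ops \<Longrightarrow> t \<in> bounded_ops \<Longrightarrow> s o\<^sub>L t \<in> bounded_ops"
  by (simp add: bounded_ops_def)

lemma compose_assoc: "(r o\<^sub>L s) o\<^sub>L t = r o\<^sub>L (s o\<^sub>L t)"
  by (rule blinfun_eqI) simp

lemma compose_add_left: "(r + s) o\<^sub>L t = (r o\<^sub>L t) + (s o\<^sub>L t)"
  by (rule blinfun_eqI) (simp add: blinfun.add_left)

lemma compose_add_right: "t o\<^sub>L (r + s) = (t o\<^sub>L r) + (t o\<^sub>L s)"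
  by (rule blinfun_eqI) (simp add: blinfun.add_left blinfun.add_right)

lemma compose_diff_left: "(r - s) o\<^sub>L t = (r o\<^sub>L t) - (s o\<^sub>L t)"
  by (rule blinfun_eqI) (simp add: blinfun.diff_left)

lemma compose_diff_right: "t o\<^sub>L (r - s) = (t o\<^sub>L r) - (t o\<^sub>L s)"
  by (rule blinfun_eqI) (simp add: blinfun.diff_left blinfun.diff_right)

lemma compose_scaleC_left: "scaleC_op c r o\<^sub>L t = scaleC_op c (r o\<^sub>L t)"
  by (rule blinfun_eqI) simp

lemma compose_scaleC_right: "t \<in> bounded_ops \<Longrightarrow> t o\<^sub>L scaleC_op c r = scaleC_op c (t o\<^sub>L r)"
  by (rule blinfun_eqI) (simp add: bounded_opsD)

lemma compose_id [simp]: "t o\<^sub>L id_blinfun = t" "id_blinfun o\<^sub>L t = t"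
  by (auto intro: blinfun_eqI)

lemma compose_zero [simp]: "0 o\<^sub>L t = 0" "t o\<^sub>L 0 = 0"
  by (auto intro: blinfun_eqI)

lemma norm_compose_le1:
  assumes "norm s \<le> 1" "norm t \<le> 1" shows "norm (s o\<^sub>L t) \<le> 1"
  by (rule order_trans[OF norm_blinfun_compose]) (use assms in \<open>simp add: mult_le_one\<close>)

lemma bounded_ops_tendsto:
  assumes "Fl \<noteq> bot" "\<And>x. ((\<lambda>\<alpha>. blinfun_apply (s \<alpha>) x) \<longlongrightarrow> blinfun_apply t x) Fl"
    and "\<forall>\<^sub>F \<alpha> in Fl. s \<alpha> \<in> bounded_ops"
  shows "t \<in> bounded_ops"
  unfolding bounded_ops_def
proof (intro CollectI allI)
  fix c x
  have "((\<lambda>\<alpha>. c *\<^sub>C blinfun_apply (s \<alpha>) x) \<longlongrightarrow> c *\<^sub>C blinfun_apply t x) Fl"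
    by (intro bounded_linear.tendsto[OF bounded_linear_scaleC] assms)
  moreover have "((\<lambda>\<alpha>. c *\<^sub>C blinfun_apply (s \<alpha>) x) \<longlongrightarrow> blinfun_apply t (c *\<^sub>C x)) Fl"
    by (rule Lim_transform_eventually[OF assms(2)])
      (use assms(3) in \<open>auto elim!: eventually_mono simp: bounded_opsD\<close>)
  ultimately show "blinfun_apply t (c *\<^sub>C x) = c *\<^sub>C blinfun_apply t x"
    using tendsto_unique[OF assms(1)] by blast
qed

lemma bounded_ops_closed: "closed bounded_ops"
proof (subst closed_sequential_limits, intro allI impI)
  fix s :: "nat \<Rightarrow> 'a \<Rightarrow>\<^sub>L 'a" and t
  assume st: "(\<forall>n. s n \<in> bounded_ops) \<and> s \<longlonglongrightarrow> t"
  show "t \<in> bounded_ops"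
    by (rule bounded_ops_tendsto[of sequentially s])
      (use st in \<open>auto intro: blinfun.tendsto\<close>)
qed

lemma adj_eqI:
  assumes "t \<in> bounded_ops"
    and "\<And>x y. cinner (blinfun_apply s x) y = cinner x (blinfun_apply t y)"
  shows "adj t = s"
  by (rule blinfun_eqI, rule cinner_eqI) (simp add: cinner_adj assms)

lemma adj_bounded_ops:
  assumes "t \<in> bounded_ops" shows "adj t \<in> bounded_ops"
  unfolding bounded_ops_def
proof (intro CollectI allI)
  fix c x show "blinfun_apply (adj t) (c *\<^sub>C x) = c *\<^sub>C blinfun_apply (adj t) x"
    by (rule cinner_eqI) (simp add: cinner_adj[OF assms] cinner_scaleC_left)
qed

lemma cinner_adj_right:
  "t \<in> bounded_ops \<Longrightarrow> cinner x (blinfun_apply (adj t) y) = cinner (blinfun_apply t x) y"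
  by (metis cinner_adj cinner_commute)

lemma adj_adj: "t \<in> bounded_ops \<Longrightarrow> adj (adj t) = t"
  by (rule adj_eqI) (auto simp: adj_bounded_ops cinner_adj_right)

lemma adj_add: "s \<in> bounded_ops \<Longrightarrow> t \<in> bounded_ops \<Longrightarrow> adj (s + t) = adj s + adj t"
  by (rule adj_eqI)
    (auto simp: bounded_ops_add blinfun.add_left cinner_add_left cinner_add_right cinner_adj)

lemma adj_diff: "s \<in> bounded_ops \<Longrightarrow> t \<in> bounded_ops \<Longrightarrow> adj (s - t) = adj s - adj t"
  by (rule adj_eqI)
    (auto simp: bounded_ops_diff blinfun.diff_left cinner_diff_left cinner_diff_right cinner_adj)

lemma adj_compose:
  "s \<in> bounded_ops \<Longrightarrow> t \<in> bounded_ops \<Longrightarrow> adj (s o\<^sub>L t) = adj t o\<^sub>L adj s"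
  by (rule adj_eqI) (auto simp: bounded_ops_compose cinner_adj)

lemma adj_zero [simp]: "adj 0 = 0"
  by (rule adj_eqI) (auto simp: bounded_ops_zero)

lemma norm_adj_le:
  assumes "t \<in> bounded_ops" shows "norm (adj t) \<le> norm t"
proof (rule norm_blinfun_bound)
  fix x
  let ?y = "blinfun_apply (adj t) x"
  show "norm ?y \<le> norm t * norm x"
  proof (cases "?y = 0")
    case False
    have "norm ?y * norm ?y = Re (cinner ?y ?y)" by (simp add: cinner_self power2_eq_square)
    also have "\<dots> = inner x (t ?y)" by (simp add: cinner_adj[OF assms] Re_cinner)
    also have "\<dots> \<le> norm x * norm (t ?y)" by (rule norm_cauchy_schwarz)
    also have "\<dots> \<le> norm x * (norm t * norm ?y)" by (intro mult_left_mono norm_blinfun) simp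
    finally have "norm ?y * norm ?y \<le> (norm t * norm x) * norm ?y" by (simp add: ac_simps)
    with False show ?thesis by simp
  qed simp
qed simp

lemma norm_adj: "t \<in> bounded_ops \<Longrightarrow> norm (adj t) = norm t"
  by (metis norm_adj_le adj_adj adj_bounded_ops order_antisym)

lemma projectionD:
  assumes "projection p"
  shows "p \<in> bounded_ops" "p o\<^sub>L p = p" "adj p = p"
    "blinfun_apply p (blinfun_apply p x) = blinfun_apply p x"
    "cinner (blinfun_apply p x) y = cinner x (blinfun_apply p y)"
proof -
  show 1: "p \<in> bounded_ops" "p o\<^sub>L p = p" "adj p = p" using assms by (auto simp: projection_def)
  show "blinfun_apply p (blinfun_apply p x) = blinfun_apply p x"
    using 1(2) by (metis blinfun_apply_blinfun_compose)
  show "cinner (blinfun_apply p x) y = cinner x (blinfun_apply p y)"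
    using cinner_adj[OF 1(1)] 1(3) by simp
qed

lemma norm_projection_apply_le:
  assumes "projection p" shows "norm (blinfun_apply p x) \<le> norm x"
proof (cases "blinfun_apply p x = 0")
  case False
  have "norm (p x) * norm (p x) = Re (cinner (p x) (p x))" by (simp add: cinner_self power2_eq_square)
  also have "\<dots> = inner x (p x)" by (simp add: projectionD[OF assms] Re_cinner)
  also have "\<dots> \<le> norm x * norm (p x)" by (rule norm_cauchy_schwarz)
  finally show ?thesis using False by simp
qed simp

lemma norm_projection_le: "projection p \<Longrightarrow> norm p \<le> 1"
  by (rule norm_blinfun_bound) (auto simp: norm_projection_apply_le)

lemma projection_compl:
  assumes "projection p" shows "projection (id_blinfun - p)"
proof -
  note p = projectionD[OF assms]
  have "adj id_blinfun = (id_blinfun :: 'a \<Rightarrow>\<^sub>L 'a)" by (rule adj_eqI) (auto simp: bounded_ops_id)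
  then show ?thesis
    by (simp add: projection_def bounded_ops_diff bounded_ops_id p adj_diff compose_diff_left
        compose_diff_right)
qed

text \<open>The identity |adj s x|^2 = <x, s (adj s) x> bounds the adjoint. This serves for images
  of matrix units under a homomorphism that is not assumed bounded.\<close>

lemma norm_le_one_if_compose_adj_projection:
  assumes "s \<in> bounded_ops" "projection (s o\<^sub>L adj s)"
  shows "norm s \<le> 1"
proof -
  have "norm (adj s) \<le> 1"
  proof (rule norm_blinfun_bound)
    fix x
    have "(norm (adj s x))\<^sup>2 = Re (cinner (adj s x) (adj s x))" by (simp add: cinner_self)
    also have "\<dots> = inner x ((s o\<^sub>L adj s) x)" by (simp add: cinner_adj[OF assms(1)] Re_cinner)
    also have "\<dots> \<le> norm x * norm ((s o\<^sub>L adj s) x)" by (rule norm_cauchy_schwarz)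
    also have "\<dots> \<le> norm x * norm x"
      by (intro mult_left_mono norm_projection_apply_le assms) simp
    finally have "(norm (adj s x))\<^sup>2 \<le> (norm x)\<^sup>2" by (simp add: power2_eq_square)
    then show "norm (adj s x) \<le> 1 * norm x"
      unfolding mult_1 by (rule power2_le_imp_le) simp
  qed simp
  then show ?thesis by (simp add: norm_adj assms)
qed

section \<open>Rank one operators and finite orthonormal sets\<close>

lift_definition rank_one :: "'a::complex_hilbert_space \<Rightarrow> 'a \<Rightarrow> ('a \<Rightarrow>\<^sub>L 'a)"
  is "\<lambda>a b x. cinner b x *\<^sub>C a"
proof (rule bounded_linear_intro)
  fix a b x y :: 'a and r :: real
  show "cinner b (x + y) *\<^sub>C a = cinner b x *\<^sub>C a + cinner b y *\<^sub>C a"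
    by (simp add: cinner_add_right scaleC_add_left)
  show "cinner b (r *\<^sub>R x) *\<^sub>C a = r *\<^sub>R cinner b x *\<^sub>C a"
    by (metis cinner_scaleC_right scaleC_of_real scaleC_scaleC)
  show "norm (cinner b x *\<^sub>C a) \<le> norm x * (norm b * norm a)"
    using mult_right_mono[OF norm_cinner_le[of b x], of "norm a"] by (simp add: norm_scaleC ac_simps)
qed

lemma rank_one_apply [simp]: "blinfun_apply (rank_one a b) x = cinner b x *\<^sub>C a"
  by (simp add: rank_one.rep_eq)

lemma rank_one_bounded_ops: "rank_one a b \<in> bounded_ops"
  by (simp add: bounded_ops_def cinner_scaleC_right scaleC_scaleC)

lemma norm_rank_one_le: "norm (rank_one a b) \<le> norm a * norm b"
proof (rule norm_blinfun_bound)
  fix x show "norm (blinfun_apply (rank_one a b) x) \<le> norm a * norm b * norm x"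
    using mult_right_mono[OF norm_cinner_le[of b x], of "norm a"] by (simp add: norm_scaleC ac_simps)
qed simp

lemma adj_rank_one: "adj (rank_one a b) = rank_one b a"
proof (rule adj_eqI[OF rank_one_bounded_ops])
  fix x y
  have "cnj (cinner a x) = cinner x a" by (metis cinner_commute)
  then show "cinner (blinfun_apply (rank_one b a) x) y = cinner x (blinfun_apply (rank_one a b) y)"
    by (simp add: cinner_scaleC_left cinner_scaleC_right)
qed

lemma rank_one_compose:
  "rank_one a b o\<^sub>L rank_one c d = scaleC_op (cinner b c) (rank_one a d)"
  by (rule blinfun_eqI) (simp add: cinner_scaleC_right scaleC_scaleC mult.commute)

lemma compose_rank_one:
  "t \<in> bounded_ops \<Longrightarrow> t o\<^sub>L rank_one a b = rank_one (blinfun_apply t a) b"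
  by (rule blinfun_eqI) (simp add: bounded_opsD)

lemma rank_one_compose_op:
  "t \<in> bounded_ops \<Longrightarrow> rank_one a b o\<^sub>L t = rank_one a (blinfun_apply (adj t) b)"
  by (rule blinfun_eqI) (simp add: cinner_adj)

lemma rank_one_add_right: "rank_one a (b + c) = rank_one a b + rank_one a c"
  by (rule blinfun_eqI) (simp add: cinner_add_left scaleC_add_left blinfun.add_left)

lemma rank_one_sum_right: "rank_one a (\<Sum>i\<in>S. f i) = (\<Sum>i\<in>S. rank_one a (f i))"
proof (induction S rule: infinite_finite_induct)
  case empty show ?case by (rule blinfun_eqI) simp
next
  case (infinite A) then show ?case by (auto intro: blinfun_eqI)
qed (simp add: rank_one_add_right)

lemma rank_one_scaleC_right: "rank_one a (c *\<^sub>C b) = scaleC_op (cnj c) (rank_one a b)"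
  by (rule blinfun_eqI) (simp add: cinner_scaleC_left scaleC_scaleC)

definition orthonormal :: "'a::complex_hilbert_space set \<Rightarrow> bool" where
  "orthonormal B \<longleftrightarrow> finite B \<and> (\<forall>b\<in>B. norm b = 1) \<and> (\<forall>b\<in>B. \<forall>c\<in>B. b \<noteq> c \<longrightarrow> cinner b c = 0)"

definition span_proj :: "'a::complex_hilbert_space set \<Rightarrow> ('a \<Rightarrow>\<^sub>L 'a)" where
  "span_proj B = (\<Sum>b\<in>B. rank_one b b)"

lemma orthonormal_empty [simp]: "orthonormal {}"
  by (simp add: orthonormal_def)

lemma orthonormal_subset: "orthonormal B \<Longrightarrow> C \<subseteq> B \<Longrightarrow> orthonormal C"
  by (auto simp: orthonormal_def intro: finite_subset)

lemma blinfun_sum_apply: "blinfun_apply (\<Sum>i\<in>S. f i) x = (\<Sum>i\<in>S. blinfun_apply (f i) x)"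
  by (induction S rule: infinite_finite_induct) (auto simp: blinfun.add_left)

lemma span_proj_apply: "blinfun_apply (span_proj B) x = (\<Sum>b\<in>B. cinner b x *\<^sub>C b)"
  by (simp add: span_proj_def blinfun_sum_apply)

lemma span_proj_bounded_ops: "span_proj B \<in> bounded_ops"
  unfolding span_proj_def by (intro bounded_ops_sum rank_one_bounded_ops)

lemma cinner_span_proj:
  assumes "orthonormal B" "b \<in> B"
  shows "cinner b (blinfun_apply (span_proj B) x) = cinner b x"
proof -
  have B: "finite B" and *: "\<And>c. c \<in> B \<Longrightarrow> cinner b c = (if c = b then 1 else 0)"
    using assms by (auto simp: orthonormal_def cinner_self)
  have "cinner b (blinfun_apply (span_proj B) x) = (\<Sum>c\<in>B. cinner c x * cinner b c)"
    by (simp add: span_proj_apply cinner_sum_right cinner_scaleC_right)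
  also have "\<dots> = (\<Sum>c\<in>B. if c = b then cinner b x else 0)"
    by (rule sum.cong) (auto simp: *)
  finally show ?thesis using B assms(2) by simp
qed

lemma span_proj_compose:
  assumes "orthonormal B" "C \<subseteq> B"
  shows "span_proj C o\<^sub>L span_proj B = span_proj C"
proof (rule blinfun_eqI)
  fix x
  have "blinfun_apply (span_proj C) (blinfun_apply (span_proj B) x)
      = (\<Sum>b\<in>C. cinner b (blinfun_apply (span_proj B) x) *\<^sub>C b)" by (rule span_proj_apply)
  also have "\<dots> = (\<Sum>b\<in>C. cinner b x *\<^sub>C b)"
    by (rule sum.cong[OF refl])
      (simp only: cinner_span_proj[OF assms(1) subsetD[OF assms(2)]])
  finally show "blinfun_apply (span_proj C o\<^sub>L span_proj B) x = blinfun_apply (span_proj C) x"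
    by (simp add: span_proj_apply)
qed

lemma adj_span_proj: "adj (span_proj B) = span_proj B"
proof (cases "finite B")
  case True
  then show ?thesis unfolding span_proj_def
  proof induction
    case (insert b B)
    then show ?case
      by (simp add: adj_add rank_one_bounded_ops bounded_ops_sum adj_rank_one)
  qed simp
qed (simp add: span_proj_def)

lemma projection_span_proj: "orthonormal B \<Longrightarrow> projection (span_proj B)"
  by (simp add: projection_def span_proj_bounded_ops span_proj_compose adj_span_proj)

lemma span_proj_compose':
  assumes "orthonormal B" "C \<subseteq> B"
  shows "span_proj B o\<^sub>L span_proj C = span_proj C"
proof -
  have "adj (span_proj C o\<^sub>L span_proj B) = span_proj B o\<^sub>L span_proj C"
    by (simp add: adj_compose span_proj_bounded_ops adj_span_proj)
  then show ?thesis by (simp add: span_proj_compose[OF assms] adj_span_proj)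
qed

lemma span_proj_Diff:
  assumes "orthonormal B" "C \<subseteq> B"
  shows "span_proj (B - C) = span_proj B - span_proj C"
  using assms by (simp add: span_proj_def sum_diff orthonormal_def)

lemma span_proj_mem: "orthonormal B \<Longrightarrow> b \<in> B \<Longrightarrow> blinfun_apply (span_proj B) b = b"
  using span_proj_compose'[of B "{b}"]
proof -
  assume a: "orthonormal B" "b \<in> B"
  then have *: "blinfun_apply (span_proj {b}) b = b"
    by (simp add: span_proj_apply orthonormal_def cinner_self)
  have "blinfun_apply (span_proj B) (blinfun_apply (span_proj {b}) b) = blinfun_apply (span_proj {b}) b"
    using span_proj_compose'[of B "{b}"] a by (metis blinfun_apply_blinfun_compose bot.extremum insert_subset)
  then show ?thesis by (simp add: *)
qed

lemma orthonormal_insert: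
  assumes "orthonormal B" "norm b = 1" "blinfun_apply (span_proj B) b = 0"
  shows "orthonormal (insert b B)" "b \<notin> B"
proof -
  have 0: "cinner c b = 0" if "c \<in> B" for c
    using cinner_span_proj[OF assms(1) that, of b] assms(3) by simp
  then have "cinner b c = 0" if "c \<in> B" for c
    using that by (metis cinner_eq_zero_commute)
  with 0 show "orthonormal (insert b B)" using assms by (auto simp: orthonormal_def)
  show "b \<notin> B" using span_proj_mem[OF assms(1)] assms(2,3) by fastforce
qed

lemma span_proj_disjoint:
  assumes "orthonormal (B \<union> C)" "B \<inter> C = {}"
  shows "span_proj B o\<^sub>L span_proj C = 0"
proof -
  have "C = (B \<union> C) - B" using assms by auto
  then have "span_proj C = span_proj (B \<union> C) - span_proj B"
    using span_proj_Diff[OF assms(1), of B] by auto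
  moreover have "orthonormal B" using assms(1) by (rule orthonormal_subset) auto
  ultimately show ?thesis
    by (simp add: compose_diff_right span_proj_compose assms)
qed

section \<open>Strong limits of approximable and quasi-local operators\<close>

text \<open>The topology on functions is the product topology. Both Tychonoff's theorem for matrix
  coefficients and the strong operator topology are accessed through this.\<close>

lemma tendsto_fun_iff:
  fixes f :: "'i \<Rightarrow> 'a \<Rightarrow> 'b::topological_space"
  shows "(f \<longlongrightarrow> l) Fl \<longleftrightarrow> (\<forall>x. ((\<lambda>\<alpha>. f \<alpha> x) \<longlongrightarrow> l x) Fl)"
  using limitin_componentwise[of "\<lambda>_. euclidean" UNIV f l Fl]
  by (simp add: euclidean_product_topology)

text \<open>The net of matrix coefficients \<open>(x, y) \<mapsto> \<langle>y, d \<alpha> x\<rangle>\<close> has a cluster point by Tychonoff's theorem, and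
  the Riesz representation theorem turns it into an operator.\<close>

lemma weak_operator_cluster_point:
  fixes d :: "'i \<Rightarrow> 'k::complex_hilbert_space \<Rightarrow>\<^sub>L 'k"
  assumes Fl: "Fl \<noteq> bot"
    and d: "\<forall>\<^sub>F \<alpha> in Fl. d \<alpha> \<in> bounded_ops \<and> norm (d \<alpha>) \<le> \<epsilon>"
  obtains Fl' e where "Fl' \<noteq> bot" "Fl' \<le> Fl" "e \<in> bounded_ops" "norm e \<le> \<epsilon>"
    "\<And>x y. ((\<lambda>\<alpha>. inner y (blinfun_apply (d \<alpha>) x)) \<longlongrightarrow> inner y (blinfun_apply e x)) Fl'"
proof -
  define g where "g \<alpha> = (\<lambda>(x, y). inner y (blinfun_apply (d \<alpha>) x))" for \<alpha>
  define C where "C = (\<lambda>(x::'k, y::'k). {- (\<epsilon> * norm x * norm y) .. \<epsilon> * norm x * norm y})"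
  have "compactin (product_topology (\<lambda>_. euclidean) UNIV) (Pi\<^sub>E UNIV C)"
    by (subst compactin_PiE) (auto simp: C_def)
  then have cpt: "compact (Pi\<^sub>E UNIV C)"
    by (simp add: euclidean_product_topology)
  have "\<forall>\<^sub>F \<alpha> in Fl. g \<alpha> \<in> Pi\<^sub>E UNIV C"
    using d
  proof (rule eventually_mono, elim conjE)
    fix \<alpha> assume *: "norm (d \<alpha>) \<le> \<epsilon>"
    have "\<bar>inner y (blinfun_apply (d \<alpha>) x)\<bar> \<le> \<epsilon> * norm x * norm y" for x y
    proof -
      have "norm (blinfun_apply (d \<alpha>) x) \<le> \<epsilon> * norm x"
        using norm_blinfun[of "d \<alpha>" x] mult_right_mono[OF *, of "norm x"] by simp
      from mult_right_mono[OF this, of "norm y"] Cauchy_Schwarz_ineq2[of y "blinfun_apply (d \<alpha>) x"]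
      show ?thesis by (simp add: mult.commute)
    qed
    then show "g \<alpha> \<in> Pi\<^sub>E UNIV C" by (auto simp: g_def C_def abs_le_iff minus_le_iff)
  qed
  then have "eventually (\<lambda>h. h \<in> Pi\<^sub>E UNIV C) (filtermap g Fl)" by (simp add: eventually_filtermap)
  moreover have "filtermap g Fl \<noteq> bot" using Fl by (simp add: filtermap_bot_iff)
  ultimately obtain f where f: "inf (nhds f) (filtermap g Fl) \<noteq> bot"
    using cpt unfolding compact_filter by blast
  \<comment> \<open>The filter form of a subnet: refining \<open>Fl\<close> by the preimages of
    neighbourhoods of the cluster point \<open>f\<close> makes \<open>g\<close> converge to
    it.\<close>
  define Fl' where "Fl' = inf Fl (filtercomap g (nhds f))"
  have bot: "Fl' \<noteq> bot"
  proof
    assume "Fl' = bot"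
    then obtain A B where A: "eventually A Fl" and B: "eventually B (nhds f)"
      and AB: "\<And>\<alpha>. A \<alpha> \<Longrightarrow> B (g \<alpha>) \<Longrightarrow> False"
      unfolding Fl'_def trivial_limit_def eventually_inf eventually_filtercomap by blast
    have "eventually (\<lambda>h. \<not> B h) (filtermap g Fl)"
      unfolding eventually_filtermap using A by (rule eventually_mono) (use AB in blast)
    with B have "eventually (\<lambda>_. False) (inf (nhds f) (filtermap g Fl))"
      unfolding eventually_inf by blast
    with f show False by (simp add: trivial_limit_def)
  qed
  have le: "Fl' \<le> Fl" by (simp add: Fl'_def)
  have "filterlim g (nhds f) Fl'"
    unfolding Fl'_def filterlim_def by (rule order_trans[OF filtermap_mono[OF inf_le2] filtermap_filtercomap])
  then have lim: "((\<lambda>\<alpha>. inner y (blinfun_apply (d \<alpha>) x)) \<longlongrightarrow> f (x, y)) Fl'" for x y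
    unfolding tendsto_fun_iff by (auto simp: g_def dest: spec[of _ "(x, y)"])
  have d': "\<forall>\<^sub>F \<alpha> in Fl'. d \<alpha> \<in> bounded_ops \<and> norm (d \<alpha>) \<le> \<epsilon>"
    using d le by (simp add: le_filter_def)
  have bound: "\<bar>f (x, y)\<bar> \<le> \<epsilon> * norm x * norm y" for x y
  proof (rule tendsto_upperbound[OF tendsto_rabs[OF lim] _ bot])
    show "\<forall>\<^sub>F \<alpha> in Fl'. \<bar>inner y (blinfun_apply (d \<alpha>) x)\<bar> \<le> \<epsilon> * norm x * norm y"
      using d'
    proof (rule eventually_mono, elim conjE)
      fix \<alpha> assume *: "norm (d \<alpha>) \<le> \<epsilon>"
      have "norm (blinfun_apply (d \<alpha>) x) \<le> \<epsilon> * norm x"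
        using norm_blinfun[of "d \<alpha>" x] mult_right_mono[OF *, of "norm x"] by simp
      from mult_right_mono[OF this, of "norm y"] Cauchy_Schwarz_ineq2[of y "blinfun_apply (d \<alpha>) x"]
      show "\<bar>inner y (blinfun_apply (d \<alpha>) x)\<bar> \<le> \<epsilon> * norm x * norm y" by (simp add: mult.commute)
    qed
  qed
  \<comment> \<open>Nonnegativity is not assumed; it follows because \<open>Fl\<close> is proper, so
    the norm bound holds for at least one index.\<close>
  have eps: "0 \<le> \<epsilon>"
  proof -
    obtain \<alpha> where "norm (d \<alpha>) \<le> \<epsilon>" using eventually_happens'[OF Fl d] by blast
    then show ?thesis using norm_ge_zero order_trans by blast
  qed
  have f_add: "f (x, y + z) = f (x, y) + f (x, z)" for x y z
    using tendsto_unique[OF bot lim[of "y + z" x]] tendsto_add[OF lim[of y x] lim[of z x]]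
    by (simp add: inner_add_left)
  have f_scale: "f (x, r *\<^sub>R y) = r * f (x, y)" for x y r
    using tendsto_unique[OF bot lim[of "r *\<^sub>R y" x]] tendsto_mult_left[OF lim[of y x], of r]
    by simp
  have "bounded_linear (\<lambda>y. f (x, y))" for x
    by (rule bounded_linear_intro[where K = "\<epsilon> * norm x"])
      (use bound[of x] in \<open>auto simp: f_add f_scale mult.commute\<close>)
  then have "\<exists>z. \<forall>y. f (x, y) = inner z y" for x by (rule riesz_representation)
  then obtain e0 where e0: "\<And>x y. f (x, y) = inner (e0 x) y" by metis
  have lim0: "((\<lambda>\<alpha>. inner y (blinfun_apply (d \<alpha>) x)) \<longlongrightarrow> inner y (e0 x)) Fl'" for x y
    using lim[of y x] by (simp add: e0 inner_commute)
  have eqI: "u = v" if "\<And>y. inner y u = inner y v" for u v :: 'k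
    using that vector_eq_ldot[of u v] by blast
  have e0_add: "e0 (x + z) = e0 x + e0 z" for x z
  proof (rule eqI)
    fix y
    show "inner y (e0 (x + z)) = inner y (e0 x + e0 z)"
      using tendsto_unique[OF bot lim0[of y "x + z"]] tendsto_add[OF lim0[of y x] lim0[of y z]]
      by (simp add: inner_add_right blinfun.add_right)
  qed
  have e0_scale: "e0 (r *\<^sub>R x) = r *\<^sub>R e0 x" for x r
  proof (rule eqI)
    fix y
    show "inner y (e0 (r *\<^sub>R x)) = inner y (r *\<^sub>R e0 x)"
      using tendsto_unique[OF bot lim0[of y "r *\<^sub>R x"]] tendsto_mult_left[OF lim0[of y x], of r]
      by (simp add: blinfun.scaleR_right)
  qed
  have e0_norm: "norm (e0 x) \<le> norm x * \<epsilon>" for x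
  proof (cases "e0 x = 0")
    case False
    have "norm (e0 x) * norm (e0 x) \<le> (norm x * \<epsilon>) * norm (e0 x)"
      using bound[of x "e0 x"] by (simp add: e0 dot_square_norm power2_eq_square ac_simps)
    with False show ?thesis by simp
  qed (simp add: eps)
  have "bounded_linear e0"
    by (rule bounded_linear_intro[OF e0_add e0_scale e0_norm])
  then have app: "blinfun_apply (Blinfun e0) = e0" by (rule bounded_linear_Blinfun_apply)
  show thesis
  proof (rule that[OF bot le])
    show "norm (Blinfun e0) \<le> \<epsilon>"
      by (rule norm_blinfun_bound[OF eps]) (use e0_norm in \<open>simp add: app mult.commute\<close>)
    show "((\<lambda>\<alpha>. inner y (blinfun_apply (d \<alpha>) x)) \<longlongrightarrow> inner y (blinfun_apply (Blinfun e0) x)) Fl'" for x y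
      by (simp add: app lim0)
    have "e0 (c *\<^sub>C x) = c *\<^sub>C e0 x" for c x
    proof (rule eqI)
      fix y :: 'k
      \<comment> \<open>Weak limits are at hand for the real inner product only, so the complex
        scalar is moved onto the fixed vector.\<close>
      have *: "inner y (c *\<^sub>C v) = inner (cnj c *\<^sub>C y) v" for v
        by (metis Re_cinner cinner_scaleC_left cinner_scaleC_right complex_cnj_cnj)
      have "((\<lambda>\<alpha>. inner y (blinfun_apply (d \<alpha>) (c *\<^sub>C x))) \<longlongrightarrow> inner y (c *\<^sub>C e0 x)) Fl'"
        unfolding * by (rule Lim_transform_eventually[OF lim0])
          (use d' in \<open>auto elim!: eventually_mono simp: bounded_opsD *\<close>)
      then show "inner y (e0 (c *\<^sub>C x)) = inner y (c *\<^sub>C e0 x)"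
        using tendsto_unique[OF bot lim0[of y "c *\<^sub>C x"]] by blast
    qed
    then show "Blinfun e0 \<in> bounded_ops" by (simp add: bounded_ops_def app)
  qed
qed

context coarse_module
begin

lemma norm_proj_le: "A \<in> \<AA> \<Longrightarrow> norm (P A) \<le> 1"
  using proj norm_projection_le by blast

lemma inner_proj: "A \<in> \<AA> \<Longrightarrow> inner (blinfun_apply (P A) x) y = inner x (blinfun_apply (P A) y)"
  by (metis Re_cinner projectionD(5)[OF proj])

lemma proj_empty: "P {} = 0"
  using proj_Un[of "{}" "{}"] by simp

lemma proj_bounded_ops: "A \<in> \<AA> \<Longrightarrow> P A \<in> bounded_ops"
  using proj projectionD(1) by blast

lemma proj_compl: "A \<in> \<AA> \<Longrightarrow> P A + P (X - A) = id_blinfun"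
  using proj_Un[of A "X - A"] proj_space sets_into_space[of A] compl_sets[of A] by (simp add: Un_absorb1)

lemma adj_compress:
  assumes "A \<in> \<AA>" "A' \<in> \<AA>" "t \<in> bounded_ops"
  shows "P A' o\<^sub>L adj t o\<^sub>L P A = adj (P A o\<^sub>L t o\<^sub>L P A')"
  using assms
  by (simp add: adj_compose bounded_ops_compose proj_bounded_ops projectionD(3)[OF proj] compose_assoc)

lemma nbhd_sym_disjoint: "sym E \<Longrightarrow> A' \<inter> nbhd E A = {} \<Longrightarrow> A \<inter> nbhd E A' = {}"
  by (auto simp: nbhd_def dest: symD)

text \<open>The approximants \<open>u \<alpha>\<close> need not converge, but the errors
  \<open>s \<alpha> - u \<alpha>\<close> stay in a ball and have a weak cluster point
  \<open>e\<close>. Along the finer filter \<open>u \<alpha>\<close> tends weakly to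
  \<open>t - e\<close>, and the vanishing of compressions that defines controlled propagation
  survives weak limits.\<close>

lemma approximable_tendsto:
  assumes Fl: "Fl \<noteq> bot" and s: "\<And>x. ((\<lambda>\<alpha>. blinfun_apply (s \<alpha>) x) \<longlongrightarrow> blinfun_apply t x) Fl"
    and ev: "\<forall>\<^sub>F \<alpha> in Fl. approximable \<AA> P \<epsilon> E (s \<alpha>)"
  shows "approximable \<AA> P \<epsilon> E t"
proof -
  have t: "t \<in> bounded_ops"
    by (rule bounded_ops_tendsto[OF Fl s]) (use ev in \<open>auto elim: eventually_mono simp: approximable_def\<close>)
  define u where "u \<alpha> = (SOME v. controlled_propagation \<AA> P E v \<and> norm (s \<alpha> - v) \<le> \<epsilon>)" for \<alpha>
  define d where "d \<alpha> = s \<alpha> - u \<alpha>" for \<alpha>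
  have u: "\<forall>\<^sub>F \<alpha> in Fl. s \<alpha> \<in> bounded_ops \<and> controlled_propagation \<AA> P E (u \<alpha>) \<and> norm (s \<alpha> - u \<alpha>) \<le> \<epsilon>"
    using ev
  proof (rule eventually_mono)
    fix \<alpha> assume "approximable \<AA> P \<epsilon> E (s \<alpha>)"
    then show "s \<alpha> \<in> bounded_ops \<and> controlled_propagation \<AA> P E (u \<alpha>) \<and> norm (s \<alpha> - u \<alpha>) \<le> \<epsilon>"
      unfolding approximable_def u_def using someI_ex by (metis (mono_tags, lifting))
  qed
  have "\<forall>\<^sub>F \<alpha> in Fl. d \<alpha> \<in> bounded_ops \<and> norm (d \<alpha>) \<le> \<epsilon>"
    using u by (rule eventually_mono) (auto simp: d_def controlled_propagation_def bounded_ops_diff)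
  then obtain Fl' e where Fl': "Fl' \<noteq> bot" "Fl' \<le> Fl" and e: "e \<in> bounded_ops" "norm e \<le> \<epsilon>"
    and lim: "\<And>x y. ((\<lambda>\<alpha>. inner y (blinfun_apply (d \<alpha>) x)) \<longlongrightarrow> inner y (blinfun_apply e x)) Fl'"
    by (rule weak_operator_cluster_point[OF Fl]) blast
  have "controlled_propagation \<AA> P E (t - e)"
    unfolding controlled_propagation_def
  proof (intro conjI ballI impI)
    show "t - e \<in> bounded_ops" using t e by (rule_tac bounded_ops_diff)
    fix A A' assume A: "A \<in> \<AA>" "A' \<in> \<AA>" "A' \<inter> nbhd E A = {}"
    have "inner y (blinfun_apply (P A' o\<^sub>L (t - e) o\<^sub>L P A) x) = 0" for x y
    proof -
      let ?x = "blinfun_apply (P A) x" and ?y = "blinfun_apply (P A') y"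
      have "((\<lambda>\<alpha>. inner ?y (blinfun_apply (s \<alpha>) ?x) - inner ?y (blinfun_apply (d \<alpha>) ?x))
          \<longlongrightarrow> inner ?y (blinfun_apply t ?x) - inner ?y (blinfun_apply e ?x)) Fl'"
        by (intro tendsto_intros lim tendsto_mono[OF Fl'(2) s])
      moreover have "\<forall>\<^sub>F \<alpha> in Fl'. inner ?y (blinfun_apply (s \<alpha>) ?x) - inner ?y (blinfun_apply (d \<alpha>) ?x) = 0"
        using filter_leD[OF Fl'(2) u]
      proof (rule eventually_mono)
        fix \<alpha> assume "s \<alpha> \<in> bounded_ops \<and> controlled_propagation \<AA> P E (u \<alpha>) \<and> norm (s \<alpha> - u \<alpha>) \<le> \<epsilon>"
        then have "blinfun_apply (P A' o\<^sub>L u \<alpha> o\<^sub>L P A) x = 0"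
          using A by (simp add: controlled_propagation_def)
        then show "inner ?y (blinfun_apply (s \<alpha>) ?x) - inner ?y (blinfun_apply (d \<alpha>) ?x) = 0"
          using A by (simp add: d_def blinfun.diff_left inner_diff_right inner_proj)
      qed
      ultimately have "((\<lambda>_. 0) \<longlongrightarrow> inner ?y (blinfun_apply t ?x) - inner ?y (blinfun_apply e ?x)) Fl'"
        by (rule Lim_transform_eventually)
      then have "inner ?y (blinfun_apply t ?x) - inner ?y (blinfun_apply e ?x) = 0"
        using tendsto_unique[OF Fl'(1)] tendsto_const by blast
      then show ?thesis using A by (simp add: blinfun.diff_left inner_diff_right inner_proj blinfun.diff_right)
    qed
    then have "blinfun_apply (P A' o\<^sub>L (t - e) o\<^sub>L P A) x = 0" for x
      by (rule iffD1[OF inner_eq_zero_iff])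
    then show "P A' o\<^sub>L (t - e) o\<^sub>L P A = 0"
      by (intro blinfun_eqI) simp
  qed
  moreover have "norm (t - (t - e)) \<le> \<epsilon>" using e by simp
  ultimately show ?thesis using t by (auto simp: approximable_def)
qed

text \<open>No compactness is involved: the norm of a compression, a supremum of pointwise norms, is
  lower semicontinuous for strong convergence.\<close>

lemma quasi_local_tendsto:
  assumes Fl: "Fl \<noteq> bot" and s: "\<And>x. ((\<lambda>\<alpha>. blinfun_apply (s \<alpha>) x) \<longlongrightarrow> blinfun_apply t x) Fl"
    and ev: "\<forall>\<^sub>F \<alpha> in Fl. quasi_local \<AA> P \<epsilon> E (s \<alpha>)"
  shows "quasi_local \<AA> P \<epsilon> E t"
  unfolding quasi_local_def
proof (intro conjI ballI impI)
  show "t \<in> bounded_ops"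
    by (rule bounded_ops_tendsto[OF Fl s]) (use ev in \<open>auto elim: eventually_mono simp: quasi_local_def\<close>)
  fix A A' assume A: "A \<in> \<AA>" "A' \<in> \<AA>" "A' \<inter> nbhd E A = {}"
  have ev': "\<forall>\<^sub>F \<alpha> in Fl. norm (P A' o\<^sub>L s \<alpha> o\<^sub>L P A) \<le> \<epsilon>"
    using ev by (rule eventually_mono) (use A in \<open>auto simp: quasi_local_def\<close>)
  obtain \<alpha> where "norm (P A' o\<^sub>L s \<alpha> o\<^sub>L P A) \<le> \<epsilon>" using eventually_happens'[OF Fl ev'] by blast
  then have "0 \<le> \<epsilon>" using norm_ge_zero order_trans by blast
  then show "norm (P A' o\<^sub>L t o\<^sub>L P A) \<le> \<epsilon>"
  proof (rule norm_blinfun_bound)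
    fix x
    have "((\<lambda>\<alpha>. norm (blinfun_apply (P A' o\<^sub>L s \<alpha> o\<^sub>L P A) x)) \<longlongrightarrow> norm (blinfun_apply (P A' o\<^sub>L t o\<^sub>L P A) x)) Fl"
      by (simp, intro tendsto_norm bounded_linear.tendsto[OF blinfun.bounded_linear_right] s)
    then show "norm (blinfun_apply (P A' o\<^sub>L t o\<^sub>L P A) x) \<le> \<epsilon> * norm x"
    proof (rule tendsto_upperbound[OF _ _ Fl])
      show "\<forall>\<^sub>F \<alpha> in Fl. norm (blinfun_apply (P A' o\<^sub>L s \<alpha> o\<^sub>L P A) x) \<le> \<epsilon> * norm x"
        using ev'
        by (rule eventually_mono) (meson norm_blinfun mult_right_mono norm_ge_zero order_trans)
    qed
  qed
qed

section \<open>Algebraic closure properties\<close>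

lemma nbhd_mono: "E \<subseteq> E' \<Longrightarrow> nbhd E A \<subseteq> nbhd E' A"
  by (auto simp: nbhd_def)

lemma controlled_propagation_mono:
  "controlled_propagation \<AA> P E t \<Longrightarrow> E \<subseteq> E' \<Longrightarrow> controlled_propagation \<AA> P E' t"
  unfolding controlled_propagation_def using nbhd_mono by blast

lemma controlled_propagation_add:
  "controlled_propagation \<AA> P E s \<Longrightarrow> controlled_propagation \<AA> P E t \<Longrightarrow>
    controlled_propagation \<AA> P E (s + t)"
  by (simp add: controlled_propagation_def bounded_ops_add compose_add_left compose_add_right)

lemma controlled_propagation_scaleC:
  "controlled_propagation \<AA> P E t \<Longrightarrow> controlled_propagation \<AA> P E (scaleC_op c t)"
  by (simp add: controlled_propagation_def bounded_ops_scaleC compose_scaleC_right proj_bounded_ops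
      compose_scaleC_left scaleC_op_zero_right)

lemma controlled_propagation_adj:
  assumes "controlled_propagation \<AA> P E t" "sym E"
  shows "controlled_propagation \<AA> P E (adj t)"
  using assms nbhd_sym_disjoint[OF assms(2)]
  by (auto simp: controlled_propagation_def adj_bounded_ops adj_compress)

text \<open>For a measurable \<open>C\<close> between \<open>nbhd E A\<close> and a slightly larger set, which exists by
  admissibility, each of the two summands contains a small factor.\<close>

lemma compress_compose:
  assumes "C \<in> \<AA>"
  shows "P A' o\<^sub>L (s o\<^sub>L t) o\<^sub>L P A
    = ((P A' o\<^sub>L s o\<^sub>L P C) o\<^sub>L (t o\<^sub>L P A))
      + ((P A' o\<^sub>L s) o\<^sub>L (P (X - C) o\<^sub>L t o\<^sub>L P A))"
proof -
  have "P A' o\<^sub>L (s o\<^sub>L t) o\<^sub>L P A = (P A' o\<^sub>L s) o\<^sub>L (P C + P (X - C)) o\<^sub>L (t o\<^sub>L P A)"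
    by (simp add: proj_compl[OF assms] compose_assoc)
  then show ?thesis by (simp only: compose_add_left compose_add_right compose_assoc)
qed

text \<open>The set \<open>nbhd E A\<close> itself may fail to be measurable; the factor
  \<open>W\<close> in the middle of the composite pays for its measurable enlargement
  \<open>C\<close>.\<close>

lemma separating_set:
  assumes W: "\<And>A. A \<subseteq> X \<Longrightarrow> \<exists>A'\<in>\<AA>. A \<subseteq> A' \<and> A' \<subseteq> nbhd W A"
    and E: "E \<subseteq> X \<times> X" and A: "A' \<inter> nbhd (E' O W O E) A = {}"
  obtains C where "C \<in> \<AA>" "A' \<inter> nbhd E' C = {}" "(X - C) \<inter> nbhd E A = {}"
proof -
  have "nbhd E A \<subseteq> X" using E by (auto simp: nbhd_def)
  from W[OF this] obtain C where C: "C \<in> \<AA>" "nbhd E A \<subseteq> C" "C \<subseteq> nbhd W (nbhd E A)" by blast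
  have "nbhd E' C \<subseteq> nbhd (E' O W O E) A" using C(3) by (fastforce simp: nbhd_def)
  with A C show thesis by (intro that[of C]) auto
qed

lemma controlled_propagation_compose:
  assumes W: "\<And>A. A \<subseteq> X \<Longrightarrow> \<exists>A'\<in>\<AA>. A \<subseteq> A' \<and> A' \<subseteq> nbhd W A"
    and E: "E \<subseteq> X \<times> X"
    and s: "controlled_propagation \<AA> P E' s" and t: "controlled_propagation \<AA> P E t"
  shows "controlled_propagation \<AA> P (E' O W O E) (s o\<^sub>L t)"
  unfolding controlled_propagation_def
proof (intro conjI ballI impI)
  show "s o\<^sub>L t \<in> bounded_ops" using s t by (simp add: controlled_propagation_def bounded_ops_compose)
  fix A A' assume A: "A \<in> \<AA>" "A' \<in> \<AA>" "A' \<inter> nbhd (E' O W O E) A = {}"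
  obtain C where C: "C \<in> \<AA>" "A' \<inter> nbhd E' C = {}" "(X - C) \<inter> nbhd E A = {}"
    using separating_set[OF W E A(3)] by blast
  then have "P A' o\<^sub>L s o\<^sub>L P C = 0" "P (X - C) o\<^sub>L t o\<^sub>L P A = 0"
    using s t A compl_sets[of C] by (auto simp: controlled_propagation_def)
  then show "P A' o\<^sub>L (s o\<^sub>L t) o\<^sub>L P A = 0"
    unfolding compress_compose[OF C(1)] by simp
qed

text \<open>In s t - s' t' = (s - s') t + s' (t - t'), the factor 2 in front of \<delta> bounds the
  norm of s', which is at most that of s plus \<epsilon>; this is where
  \<open>\<epsilon> \<le> 1\<close> enters.\<close>

lemma approximable_compose:
  assumes W: "\<And>A. A \<subseteq> X \<Longrightarrow> \<exists>A'\<in>\<AA>. A \<subseteq> A' \<and> A' \<subseteq> nbhd W A"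
    and E: "E \<subseteq> X \<times> X" and sub: "E' O W O E \<subseteq> E''"
    and s: "approximable \<AA> P \<epsilon> E' s" and t: "approximable \<AA> P \<delta> E t"
    and norms: "norm s \<le> 1" "norm t \<le> 1" "\<epsilon> \<le> 1"
  shows "approximable \<AA> P (\<epsilon> + 2 * \<delta>) E'' (s o\<^sub>L t)"
proof -
  obtain s' t' where s': "controlled_propagation \<AA> P E' s'" "norm (s - s') \<le> \<epsilon>"
    and t': "controlled_propagation \<AA> P E t'" "norm (t - t') \<le> \<delta>"
    using s t by (auto simp: approximable_def)
  have "norm s' \<le> norm s + norm (s - s')" by (metis norm_minus_commute norm_triangle_sub)
  then have ns': "norm s' \<le> 2" using norms s' by linarith
  have "(s o\<^sub>L t) - (s' o\<^sub>L t') = ((s - s') o\<^sub>L t) + (s' o\<^sub>L (t - t'))"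
    by (simp add: compose_diff_left compose_diff_right)
  moreover have "norm ((s - s') o\<^sub>L t) \<le> \<epsilon> * 1"
    by (rule order_trans[OF norm_blinfun_compose mult_mono[OF s'(2) norms(2)]])
      (use order_trans[OF norm_ge_zero s'(2)] in auto)
  moreover have "norm (s' o\<^sub>L (t - t')) \<le> 2 * \<delta>"
    by (rule order_trans[OF norm_blinfun_compose mult_mono[OF ns' t'(2)]]) auto
  ultimately have "norm ((s o\<^sub>L t) - (s' o\<^sub>L t')) \<le> \<epsilon> + 2 * \<delta>"
    using norm_triangle_ineq[of "(s - s') o\<^sub>L t" "s' o\<^sub>L (t - t')"] by simp
  moreover have "controlled_propagation \<AA> P E'' (s' o\<^sub>L t')"
    using controlled_propagation_mono[OF controlled_propagation_compose[OF W E s'(1) t'(1)] sub] .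
  ultimately show ?thesis using s t by (auto simp: approximable_def bounded_ops_compose)
qed

text \<open>Each summand of \<open>compress_compose\<close> has one small factor, the others being
  contractions, so the errors simply add.\<close>

lemma quasi_local_compose:
  assumes W: "\<And>A. A \<subseteq> X \<Longrightarrow> \<exists>A'\<in>\<AA>. A \<subseteq> A' \<and> A' \<subseteq> nbhd W A"
    and E: "E \<subseteq> X \<times> X" and sub: "E' O W O E \<subseteq> E''"
    and s: "quasi_local \<AA> P \<epsilon> E' s" and t: "quasi_local \<AA> P \<delta> E t"
    and norms: "norm s \<le> 1" "norm t \<le> 1"
  shows "quasi_local \<AA> P (\<epsilon> + \<delta>) E'' (s o\<^sub>L t)"
  unfolding quasi_local_def
proof (intro conjI ballI impI)
  show "s o\<^sub>L t \<in> bounded_ops" using s t by (simp add: quasi_local_def bounded_ops_compose)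
  fix A A' assume A: "A \<in> \<AA>" "A' \<in> \<AA>" "A' \<inter> nbhd E'' A = {}"
  then have "A' \<inter> nbhd (E' O W O E) A = {}" using nbhd_mono[OF sub] by blast
  then obtain C where C: "C \<in> \<AA>" "A' \<inter> nbhd E' C = {}" "(X - C) \<inter> nbhd E A = {}"
    using separating_set[OF W E] by blast
  then have 1: "norm (P A' o\<^sub>L s o\<^sub>L P C) \<le> \<epsilon>" and 2: "norm (P (X - C) o\<^sub>L t o\<^sub>L P A) \<le> \<delta>"
    using s t A compl_sets[of C] by (auto simp: quasi_local_def)
  have "norm ((P A' o\<^sub>L s o\<^sub>L P C) o\<^sub>L (t o\<^sub>L P A)) \<le> \<epsilon> * 1"
    by (rule order_trans[OF norm_blinfun_compose mult_mono[OF 1]])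
      (use order_trans[OF norm_ge_zero 1] A norms norm_proj_le norm_compose_le1 in auto)
  moreover have "norm ((P A' o\<^sub>L s) o\<^sub>L (P (X - C) o\<^sub>L t o\<^sub>L P A)) \<le> 1 * \<delta>"
    by (rule order_trans[OF norm_blinfun_compose mult_mono[OF _ 2]])
      (use A norms norm_proj_le norm_compose_le1 in auto)
  ultimately show "norm (P A' o\<^sub>L (s o\<^sub>L t) o\<^sub>L P A) \<le> \<epsilon> + \<delta>"
    unfolding compress_compose[OF C(1)] by (intro norm_triangle_le) linarith
qed

section \<open>Monotonicity, sums, scalar multiples and adjoints\<close>

lemma approximable_mono:
  "approximable \<AA> P \<epsilon> E t \<Longrightarrow> E \<subseteq> E' \<Longrightarrow> \<epsilon> \<le> \<delta> \<Longrightarrow> approximable \<AA> P \<delta> E' t"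
  unfolding approximable_def by (meson controlled_propagation_mono order_trans)

lemma quasi_local_mono:
  "quasi_local \<AA> P \<epsilon> E t \<Longrightarrow> E \<subseteq> E' \<Longrightarrow> \<epsilon> \<le> \<delta> \<Longrightarrow> quasi_local \<AA> P \<delta> E' t"
  unfolding quasi_local_def using nbhd_mono[of E E'] by (meson disjoint_iff order_trans subsetD)

lemma approximable_add:
  assumes "approximable \<AA> P \<epsilon> E s" "approximable \<AA> P \<delta> E t"
  shows "approximable \<AA> P (\<epsilon> + \<delta>) E (s + t)"
proof -
  obtain s' t' where "controlled_propagation \<AA> P E s'" "norm (s - s') \<le> \<epsilon>"
    "controlled_propagation \<AA> P E t'" "norm (t - t') \<le> \<delta>"
    using assms by (auto simp: approximable_def)
  moreover have "norm (s + t - (s' + t')) \<le> norm (s - s') + norm (t - t')"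
    by (rule norm_diff_triangle_ineq)
  ultimately show ?thesis using assms controlled_propagation_add[of E s' t']
    by (auto simp: approximable_def bounded_ops_add intro!: exI[of _ "s' + t'"])
qed

lemma quasi_local_add:
  assumes "quasi_local \<AA> P \<epsilon> E s" "quasi_local \<AA> P \<delta> E t"
  shows "quasi_local \<AA> P (\<epsilon> + \<delta>) E (s + t)"
  using assms unfolding quasi_local_def
  by (auto simp: bounded_ops_add compose_add_left compose_add_right intro: norm_add_rule_thm)

lemma approximable_scaleC:
  assumes "approximable \<AA> P \<epsilon> E t"
  shows "approximable \<AA> P (cmod c * \<epsilon>) E (scaleC_op c t)"
proof -
  obtain t' where t': "controlled_propagation \<AA> P E t'" "norm (t - t') \<le> \<epsilon>"
    using assms by (auto simp: approximable_def)
  have "scaleC_op c t - scaleC_op c t' = scaleC_op c (t - t')"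
    by (rule blinfun_eqI) (simp add: blinfun.diff_left scaleC_diff_right)
  then have "norm (scaleC_op c t - scaleC_op c t') \<le> cmod c * \<epsilon>"
    using norm_scaleC_op_le[of c "t - t'"] mult_left_mono[OF t'(2), of "cmod c"] by simp
  then show ?thesis using assms controlled_propagation_scaleC[OF t'(1)]
    by (auto simp: approximable_def bounded_ops_scaleC)
qed

lemma quasi_local_scaleC:
  assumes "quasi_local \<AA> P \<epsilon> E t"
  shows "quasi_local \<AA> P (cmod c * \<epsilon>) E (scaleC_op c t)"
  using assms unfolding quasi_local_def
  by (auto simp: bounded_ops_scaleC compose_scaleC_right proj_bounded_ops compose_scaleC_left
      intro!: order_trans[OF norm_scaleC_op_le] mult_left_mono)

lemma approximable_adj:
  assumes "approximable \<AA> P \<epsilon> E t" "sym E"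
  shows "approximable \<AA> P \<epsilon> E (adj t)"
proof -
  obtain t' where t': "controlled_propagation \<AA> P E t'" "norm (t - t') \<le> \<epsilon>" and t: "t \<in> bounded_ops"
    using assms by (auto simp: approximable_def)
  then have "norm (adj t - adj t') \<le> \<epsilon>"
    by (simp add: controlled_propagation_def norm_adj bounded_ops_diff flip: adj_diff)
  then show ?thesis using t controlled_propagation_adj[OF t'(1) assms(2)]
    by (auto simp: approximable_def adj_bounded_ops)
qed

lemma quasi_local_adj:
  assumes "quasi_local \<AA> P \<epsilon> E t" "sym E"
  shows "quasi_local \<AA> P \<epsilon> E (adj t)"
  using assms nbhd_sym_disjoint[OF assms(2)] unfolding quasi_local_def
  by (auto simp: adj_bounded_ops adj_compress norm_adj bounded_ops_compose proj_bounded_ops)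

end

section \<open>Countably generated coarse structures\<close>

text \<open>The \<open>F n\<close> absorb the generators one after the other, so that their subsets
  form a coarse structure containing all generators. Minimality of \<open>\<F>\<close> then gives
  cofinality.\<close>

lemma countably_generated_cofinal:
  assumes "countably_generated Y \<F>"
  obtains F :: "nat \<Rightarrow> ('y \<times> 'y) set"
  where "\<And>n. F n \<in> \<F>" "\<And>n. sym (F n)" "mono F" "\<And>E. E \<in> \<F> \<Longrightarrow> \<exists>n. E \<subseteq> F n"
proof -
  from assms obtain \<G> where "countable \<G> \<and> coarse_space Y \<F> \<and> \<G> \<subseteq> \<F> \<and>
      (\<forall>\<E>'. coarse_space Y \<E>' \<and> \<G> \<subseteq> \<E>' \<longrightarrow> \<F> \<subseteq> \<E>')"
    unfolding countably_generated_def by (elim exE)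
  then have \<G>: "countable \<G>" "coarse_space Y \<F>" "\<G> \<subseteq> \<F>"
    and min: "\<And>\<E>'. coarse_space Y \<E>' \<Longrightarrow> \<G> \<subseteq> \<E>' \<Longrightarrow> \<F> \<subseteq> \<E>'"
    by simp_all
  interpret coarse_space Y \<F> by (rule \<G>(2))
  \<comment> \<open>Adding the diagonal makes the enumerated set nonempty, as
    \<open>from_nat_into\<close> requires; the diagonal is an entourage anyway.\<close>
  define g where "g = from_nat_into (insert (Id_on Y) \<G>)"
  have g_range: "range g = insert (Id_on Y) \<G>"
    unfolding g_def by (rule range_from_nat_into) (use \<G> in auto)
  have "g n \<in> insert (Id_on Y) \<G>" for n unfolding g_range[symmetric] by (rule rangeI)
  then have g: "g n \<in> \<F>" for n using \<G>(3) entourage_diag by (metis insertE subsetD)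
  \<comment> \<open>The converse keeps \<open>F n\<close> symmetric, and the square makes the
    composite of two subsets of \<open>F n\<close> a subset of \<open>F (Suc n)\<close>.\<close>
  define F where "F = rec_nat (Id_on Y) (\<lambda>n E. (E \<union> g n \<union> (g n)\<inverse>) O (E \<union> g n \<union> (g n)\<inverse>))"
  have F0: "F 0 = Id_on Y"
    and FS: "F (Suc n) = (F n \<union> g n \<union> (g n)\<inverse>) O (F n \<union> g n \<union> (g n)\<inverse>)" for n
    by (simp_all add: F_def)
  have in_F: "F n \<in> \<F>" for n
    by (induction n)
      (auto simp: F0 FS entourage_diag intro!: entourage_comp entourage_Un entourage_converse g)
  have sym: "sym (F n)" for n
  proof (induction n)
    case (Suc n)
    then have "sym (F n \<union> g n \<union> (g n)\<inverse>)" by (auto simp: sym_def)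
    then show ?case unfolding FS sym_conv_converse_eq converse_relcomp by (simp only:)
  qed (auto simp: F0 sym_def)
  have Id: "Id_on Y \<subseteq> F n" for n
    by (induction n) (force simp: F0 FS)+
  \<comment> \<open>Composing \<open>E\<close> with the diagonal, which is contained in
    \<open>F n\<close>, places it inside the square.\<close>
  have step: "E \<subseteq> F (Suc n)" if sub: "E \<subseteq> F n \<union> g n \<union> (g n)\<inverse>" and mem: "E \<in> \<F>" for E n
  proof
    fix p assume p: "p \<in> E"
    then obtain x y where xy: "p = (x, y)" "y \<in> Y" using entourage_subset[OF mem] by auto
    then have "(y, y) \<in> F n" using Id by blast
    moreover have "(x, y) \<in> F n \<union> g n \<union> (g n)\<inverse>" using p xy sub by blast
    ultimately have "(x, y) \<in> F (Suc n)" unfolding FS by (intro relcompI[where b = y]) auto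
    then show "p \<in> F (Suc n)" by (simp add: xy)
  qed
  have "F n \<subseteq> F (Suc n)" for n by (rule step[OF _ in_F]) auto
  then have mono: "mono F" by (simp add: mono_iff_le_Suc)
  define \<E>' where "\<E>' = {E. \<exists>n. E \<subseteq> F n}"
  have "coarse_space Y \<E>'"
  proof
    fix E E' assume E: "E \<in> \<E>'" and "E' \<in> \<E>'"
    then obtain m n where "E \<subseteq> F m" "E' \<subseteq> F n" by (auto simp: \<E>'_def)
    then have mn: "E \<subseteq> F (max m n)" "E' \<subseteq> F (max m n)"
      using monoD[OF mono, of m "max m n"] monoD[OF mono, of n "max m n"] by auto
    then show "E \<union> E' \<in> \<E>'" by (auto simp: \<E>'_def)
    have "E O E' \<subseteq> F (Suc (max m n))" using mn by (auto simp: FS)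
    then show "E O E' \<in> \<E>'" unfolding \<E>'_def by blast
  next
    fix E assume "E \<in> \<E>'"
    then obtain n where n: "E \<subseteq> F n" by (auto simp: \<E>'_def)
    with entourage_subset[OF in_F] show "E \<subseteq> Y \<times> Y" by blast
    from n sym[of n] have "E\<inverse> \<subseteq> F n" by (auto dest: symD)
    then show "E\<inverse> \<in> \<E>'" by (auto simp: \<E>'_def)
  next
    show "E' \<in> \<E>'" if "E \<in> \<E>'" "E' \<subseteq> E" for E E'
      using that unfolding \<E>'_def by (blast intro: subset_trans)
    show "Id_on Y \<in> \<E>'" using Id by (auto simp: \<E>'_def)
  qed
  moreover have "\<G> \<subseteq> \<E>'"
  proof
    fix E assume "E \<in> \<G>"
    then have "E \<in> range g" unfolding g_range by (rule insertI2)
    then obtain n where "E = g n" by (elim rangeE)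
    then have "E \<subseteq> F (Suc n)" by (intro step) (auto simp: g)
    then show "E \<in> \<E>'" by (auto simp: \<E>'_def)
  qed
  ultimately have "\<F> \<subseteq> \<E>'" by (rule min)
  then have "\<exists>n. E \<subseteq> F n" if "E \<in> \<F>" for E using that unfolding \<E>'_def by blast
  with in_F sym mono show thesis by (rule that)
qed

section \<open>Strong sums of orthogonal blocks\<close>

text \<open>By Pythagoras and Bessel, the part of the sum over \<open>D\<close> beyond index m,
  applied to x, has squared norm at most the tail of the convergent series of the |r n x|^2. This
  bound does not depend on \<open>D\<close>. It therefore yields convergence and also the last
  conclusion, which is continuity of \<open>T\<close> on the Cantor space of index sets.\<close>

lemma orthogonal_blocks_strong_sums:
  fixes r t :: "nat \<Rightarrow> 'h::complex_hilbert_space \<Rightarrow>\<^sub>L 'h"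
  assumes r: "\<And>n. projection (r n)" and orth: "\<And>m n. m \<noteq> n \<Longrightarrow> r m o\<^sub>L r n = 0"
    and t_ops: "\<And>n. t n \<in> bounded_ops" and t: "\<And>n. r n o\<^sub>L t n o\<^sub>L r n = t n"
    and norm_t: "\<And>n. norm (t n) \<le> 1"
  obtains T :: "nat set \<Rightarrow> 'h \<Rightarrow>\<^sub>L 'h"
  where "\<And>D. T D \<in> bounded_ops"
    and "\<And>D x. (\<lambda>m. \<Sum>n\<in>D \<inter> {..<m}. blinfun_apply (t n) x) \<longlonglongrightarrow> blinfun_apply (T D) x"
    and "\<And>D k. k \<notin> D \<Longrightarrow> T (insert k D) = T D + t k"
    and "\<And>D D' x. (\<And>N. D' N \<inter> {..<N} = D \<inter> {..<N}) \<Longrightarrow>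
      (\<lambda>N. blinfun_apply (T (D' N)) x) \<longlonglongrightarrow> blinfun_apply (T D) x"
proof -
  have orth': "inner (blinfun_apply (r m) u) (blinfun_apply (r n) v) = 0" if "m \<noteq> n" for m n u v
  proof -
    have "cinner (blinfun_apply (r m) u) (blinfun_apply (r n) v)
        = cinner u (blinfun_apply (r m o\<^sub>L r n) v)"
      by (simp add: projectionD(5)[OF r])
    then show ?thesis by (simp add: orth that flip: Re_cinner)
  qed
  have t_range: "blinfun_apply (t n) x = blinfun_apply (r n) (blinfun_apply (t n) (blinfun_apply (r n) x))" for n x
    by (metis t blinfun_apply_blinfun_compose)
  have t_r: "blinfun_apply (t n) (blinfun_apply (r n) x) = blinfun_apply (t n) x" for n x
    by (metis t_range projectionD(4)[OF r])
  have norm_t_le: "norm (blinfun_apply (t n) x) \<le> norm (blinfun_apply (r n) x)" for n x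
    using norm_blinfun[of "t n" "blinfun_apply (r n) x"] mult_right_mono[OF norm_t, of "norm (blinfun_apply (r n) x)" n]
    by (simp add: t_r)
  have pyth_t: "(norm (\<Sum>n\<in>A. blinfun_apply (t n) x))\<^sup>2 \<le> (\<Sum>n\<in>A. (norm (blinfun_apply (r n) x))\<^sup>2)"
    if "finite A" for A x
  proof -
    have "pairwise (\<lambda>i j. orthogonal (blinfun_apply (t i) x) (blinfun_apply (t j) x)) A"
      unfolding pairwise_def orthogonal_def using t_range orth' by metis
    then have "(norm (\<Sum>n\<in>A. blinfun_apply (t n) x))\<^sup>2 = (\<Sum>n\<in>A. (norm (blinfun_apply (t n) x))\<^sup>2)"
      using that by (simp add: norm_sum_Pythagorean)
    also have "\<dots> \<le> (\<Sum>n\<in>A. (norm (blinfun_apply (r n) x))\<^sup>2)"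
      by (intro sum_mono power_mono norm_t_le) simp
    finally show ?thesis .
  qed
  have bessel: "(\<Sum>n\<in>A. (norm (blinfun_apply (r n) x))\<^sup>2) \<le> (norm x)\<^sup>2" if "finite A" for A x
  proof -
    let ?u = "\<Sum>n\<in>A. blinfun_apply (r n) x"
    have "pairwise (\<lambda>i j. orthogonal (blinfun_apply (r i) x) (blinfun_apply (r j) x)) A"
      unfolding pairwise_def orthogonal_def using orth' by blast
    then have 1: "(norm ?u)\<^sup>2 = (\<Sum>n\<in>A. (norm (blinfun_apply (r n) x))\<^sup>2)"
      using that by (simp add: norm_sum_Pythagorean)
    have "(norm (blinfun_apply (r n) x))\<^sup>2 = inner (blinfun_apply (r n) x) x" for n
    proof -
      have "cinner (blinfun_apply (r n) x) (blinfun_apply (r n) x) = cinner (blinfun_apply (r n) x) x"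
        by (metis projectionD(4,5)[OF r])
      then show ?thesis by (metis Re_cinner power2_norm_eq_inner)
    qed
    then have "(norm ?u)\<^sup>2 = inner ?u x" unfolding 1 by (simp add: inner_sum_left)
    also have "\<dots> \<le> norm ?u * norm x" by (rule norm_cauchy_schwarz)
    finally have "norm ?u \<le> norm x"
      by (cases "norm ?u = 0") (auto simp: power2_eq_square)
    then show ?thesis unfolding 1[symmetric] by (intro power_mono) auto
  qed
  define f where "f x m = (\<Sum>n<m. (norm (blinfun_apply (r n) x))\<^sup>2)" for x m
  have summ: "summable (\<lambda>n. (norm (blinfun_apply (r n) x))\<^sup>2)" for x
    by (rule summableI_nonneg_bounded[of _ "(norm x)\<^sup>2"]) (auto intro: bessel)
  define L where "L x = (\<Sum>n. (norm (blinfun_apply (r n) x))\<^sup>2)" for x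
  have L: "f x \<longlonglongrightarrow> L x" for x
    unfolding f_def[abs_def] L_def by (rule summable_LIMSEQ[OF summ])
  have f_le: "f x m \<le> L x" for x m
    unfolding f_def L_def by (rule sum_le_suminf[OF summ]) auto
  define \<tau> where "\<tau> x m = sqrt (L x - f x m)" for x m
  have \<tau>: "\<tau> x \<longlonglongrightarrow> 0" for x
    unfolding \<tau>_def using tendsto_real_sqrt[OF tendsto_diff[OF tendsto_const[of "L x"] L[of x]]] by simp
  define s where "s D x m = (\<Sum>n\<in>D \<inter> {..<m}. blinfun_apply (t n) x)" for D x m
  have tail: "norm (s D x m' - s D x m) \<le> \<tau> x m" if "m \<le> m'" for D x m m'
  proof -
    have "{..<m'} = {..<m} \<union> {m..<m'}" using ivl_disj_un_one(2)[OF that] by (rule sym)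
    then have "D \<inter> {..<m'} = (D \<inter> {..<m}) \<union> (D \<inter> {m..<m'})" by (metis Int_Un_distrib)
    moreover have "sum (\<lambda>n. blinfun_apply (t n) x) ((D \<inter> {..<m}) \<union> (D \<inter> {m..<m'}))
        = s D x m + (\<Sum>n\<in>D \<inter> {m..<m'}. blinfun_apply (t n) x)"
      unfolding s_def by (rule sum.union_disjoint) auto
    ultimately have "s D x m' = s D x m + (\<Sum>n\<in>D \<inter> {m..<m'}. blinfun_apply (t n) x)"
      unfolding s_def by (simp only:)
    then have "(norm (s D x m' - s D x m))\<^sup>2 \<le> (\<Sum>n\<in>D \<inter> {m..<m'}. (norm (blinfun_apply (r n) x))\<^sup>2)"
      by (simp add: pyth_t)
    also have "\<dots> \<le> (\<Sum>n\<in>{m..<m'}. (norm (blinfun_apply (r n) x))\<^sup>2)"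
      by (rule sum_mono2) auto
    also have "\<dots> = f x m' - f x m"
      using sum.atLeastLessThan_concat[of 0 m m' "\<lambda>n. (norm (blinfun_apply (r n) x))\<^sup>2"] that
      by (simp add: f_def lessThan_atLeast0)
    also have "\<dots> \<le> L x - f x m" using f_le[of x m'] by simp
    finally show ?thesis unfolding \<tau>_def by (rule real_le_rsqrt)
  qed
  have "Cauchy (s D x)" for D x
  proof (rule CauchyI)
    fix e :: real assume "e > 0"
    then obtain M where M: "\<And>m. m \<ge> M \<Longrightarrow> \<tau> x m < e / 2"
      using order_tendstoD(2)[OF \<tau>, of "e / 2" x] unfolding eventually_sequentially by auto
    have "norm (s D x m - s D x n) < e" if "m \<ge> M" "n \<ge> M" for m n
    proof (cases "m \<le> n")
      case True
      then show ?thesis using tail[of m n D x] M[OF that(1)] \<open>e > 0\<close> by (simp add: norm_minus_commute)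
    next
      case False
      then show ?thesis using tail[of n m D x] M[OF that(2)] \<open>e > 0\<close> by simp
    qed
    then show "\<exists>M. \<forall>m\<ge>M. \<forall>n\<ge>M. norm (s D x m - s D x n) < e" by blast
  qed
  then have "\<exists>l. s D x \<longlonglongrightarrow> l" for D x
    using Cauchy_convergent convergent_def by blast
  then obtain S where S: "\<And>D x. s D x \<longlonglongrightarrow> S D x" by metis
  have S_tail: "norm (S D x - s D x m) \<le> \<tau> x m" for D x m
  proof (rule Lim_bounded[of "\<lambda>m'. norm (s D x m' - s D x m)"])
    show "(\<lambda>m'. norm (s D x m' - s D x m)) \<longlonglongrightarrow> norm (S D x - s D x m)"
      by (intro tendsto_intros S)
  qed (use tail in blast)
  have s_add: "s D (x + y) m = s D x m + s D y m" for D x y m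
    by (simp add: s_def blinfun.add_right sum.distrib)
  have s_scale: "s D (c *\<^sub>R x) m = c *\<^sub>R s D x m" for D c x m
    by (simp add: s_def blinfun.scaleR_right scaleR_sum_right)
  have S_bl: "bounded_linear (S D)" for D
  proof (rule bounded_linear_intro[where K = 1])
    show "S D (x + y) = S D x + S D y" for x y
    proof (rule LIMSEQ_unique[OF S])
      show "s D (x + y) \<longlonglongrightarrow> S D x + S D y"
        unfolding s_add[abs_def] by (intro tendsto_add S)
    qed
    show "S D (c *\<^sub>R x) = c *\<^sub>R S D x" for c x
    proof (rule LIMSEQ_unique[OF S])
      show "s D (c *\<^sub>R x) \<longlonglongrightarrow> c *\<^sub>R S D x"
        unfolding s_scale[abs_def] by (intro tendsto_scaleR tendsto_const S)
    qed
    show "norm (S D x) \<le> norm x * 1" for x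
    proof (rule Lim_bounded[OF tendsto_norm[OF S]], intro allI impI)
      fix m
      have "(norm (s D x m))\<^sup>2 \<le> (norm x)\<^sup>2"
        unfolding s_def by (rule order_trans[OF pyth_t bessel]) auto
      then have "norm (s D x m) \<le> norm x" by (rule power2_le_imp_le) simp
      then show "norm (s D x m) \<le> norm x * 1" by simp
    qed
  qed
  define T where "T D = Blinfun (S D)" for D
  have T_app: "blinfun_apply (T D) = S D" for D
    unfolding T_def by (rule bounded_linear_Blinfun_apply[OF S_bl])
  show thesis
  proof (rule that[of T])
    show lim: "(\<lambda>m. \<Sum>n\<in>D \<inter> {..<m}. blinfun_apply (t n) x) \<longlonglongrightarrow> blinfun_apply (T D) x" for D x
      using S[of D x] unfolding T_app s_def .
    show "T D \<in> bounded_ops" for D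
    proof (rule bounded_ops_tendsto[of sequentially "\<lambda>m. \<Sum>n\<in>D \<inter> {..<m}. t n"])
      show "(\<lambda>m. blinfun_apply (\<Sum>n\<in>D \<inter> {..<m}. t n) x) \<longlonglongrightarrow> blinfun_apply (T D) x" for x
        using lim by (simp add: blinfun_sum_apply)
    qed (simp_all add: bounded_ops_sum t_ops)
    show "T (insert k D) = T D + t k" if "k \<notin> D" for k D
    proof (rule blinfun_eqI)
      fix x
      have "s (insert k D) x m = s D x m + blinfun_apply (t k) x" if "m \<ge> Suc k" for m
      proof -
        have "k < m" using that by simp
        then have "insert k D \<inter> {..<m} = insert k (D \<inter> {..<m})" by (simp add: Int_insert_left)
        then have "s (insert k D) x m = (\<Sum>n\<in>insert k (D \<inter> {..<m}). blinfun_apply (t n) x)"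
          by (simp only: s_def)
        then show ?thesis using \<open>k \<notin> D\<close> by (simp add: s_def add.commute)
      qed
      then have "\<forall>\<^sub>F m in sequentially. s D x m + blinfun_apply (t k) x = s (insert k D) x m"
        unfolding eventually_sequentially by metis
      then have "s (insert k D) x \<longlonglongrightarrow> S D x + blinfun_apply (t k) x"
        by (rule Lim_transform_eventually[OF tendsto_add[OF S tendsto_const]])
      then show "blinfun_apply (T (insert k D)) x = blinfun_apply (T D + t k) x"
        using LIMSEQ_unique[OF S] by (simp add: T_app blinfun.add_left)
    qed
    show "(\<lambda>N. blinfun_apply (T (D' N)) x) \<longlonglongrightarrow> blinfun_apply (T D) x"
      if "\<And>N. D' N \<inter> {..<N} = D \<inter> {..<N}" for D D' x
    proof (rule LIM_zero_cancel, rule Lim_null_comparison[of _ "\<lambda>N. 2 * \<tau> x N"])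
      have "norm (blinfun_apply (T (D' N)) x - blinfun_apply (T D) x) \<le> 2 * \<tau> x N" for N
      proof -
        \<comment> \<open>The partial sums up to \<open>N\<close> coincide, so only the two tails
          remain; hence the factor 2.\<close>
        have "s (D' N) x N = s D x N" by (simp add: s_def that)
        then have "blinfun_apply (T (D' N)) x - blinfun_apply (T D) x
            = (S (D' N) x - s (D' N) x N) - (S D x - s D x N)" by (simp add: T_app)
        then show ?thesis
          using norm_triangle_ineq4[of "S (D' N) x - s (D' N) x N" "S D x - s D x N"]
            S_tail[of "D' N" x N] S_tail[of D x N] by simp
      qed
      then show "\<forall>\<^sub>F N in sequentially. norm (blinfun_apply (T (D' N)) x - blinfun_apply (T D) x) \<le> 2 * \<tau> x N"
        by simp
      show "(\<lambda>N. 2 * \<tau> x N) \<longlonglongrightarrow> 0" using tendsto_mult_right_zero[OF \<tau>] by blast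
    qed
  qed
qed

section \<open>The gliding hump\<close>

text \<open>\<open>G n \<epsilon> s\<close> abstracts that \<open>s\<close> is \<open>\<epsilon>\<close>-approximable, respectively \<open>\<epsilon>\<close>-quasi-local, for the \<open>n\<close>-th
  member of a cofinal sequence of entourages. Locale assumptions are not polymorphic in the index
  type of a net, so continuity is assumed separately for sequences and for nets over finite sets
  of vectors.\<close>

locale approximation_hom =
  fixes S :: "('h::complex_hilbert_space \<Rightarrow>\<^sub>L 'h) set"
    and \<phi> :: "('h \<Rightarrow>\<^sub>L 'h) \<Rightarrow> ('k::complex_hilbert_space \<Rightarrow>\<^sub>L 'k)"
    and G :: "nat \<Rightarrow> real \<Rightarrow> ('k \<Rightarrow>\<^sub>L 'k) \<Rightarrow> bool"
  assumes S_add: "\<lbrakk>s \<in> S; t \<in> S\<rbrakk> \<Longrightarrow> s + t \<in> S"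
    and S_scaleC: "s \<in> S \<Longrightarrow> scaleC_op c s \<in> S"
    and \<phi>_bounded_ops: "s \<in> S \<Longrightarrow> \<phi> s \<in> bounded_ops"
    and \<phi>_add: "\<lbrakk>s \<in> S; t \<in> S\<rbrakk> \<Longrightarrow> \<phi> (s + t) = \<phi> s + \<phi> t"
    and \<phi>_scaleC: "s \<in> S \<Longrightarrow> \<phi> (scaleC_op c s) = scaleC_op c (\<phi> s)"
    and \<phi>_compose: "\<lbrakk>s \<in> S; t \<in> S\<rbrakk> \<Longrightarrow> \<phi> (s o\<^sub>L t) = \<phi> s o\<^sub>L \<phi> t"
    and \<phi>_adj: "s \<in> S \<Longrightarrow> \<phi> (adj s) = adj (\<phi> s)"
    and \<phi>_tendsto: "\<And>(Fl :: 'h set filter) u s y. \<lbrakk>\<And>\<alpha>. u \<alpha> \<in> S; s \<in> S;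
        \<And>x. ((\<lambda>\<alpha>. blinfun_apply (u \<alpha>) x) \<longlongrightarrow> blinfun_apply s x) Fl\<rbrakk> \<Longrightarrow>
        ((\<lambda>\<alpha>. blinfun_apply (\<phi> (u \<alpha>)) y) \<longlongrightarrow> blinfun_apply (\<phi> s) y) Fl"
    and \<phi>_LIMSEQ: "\<And>u s y. \<lbrakk>\<And>n. u n \<in> S; s \<in> S;
        \<And>x. (\<lambda>n. blinfun_apply (u n) x) \<longlonglongrightarrow> blinfun_apply s x\<rbrakk> \<Longrightarrow>
        (\<lambda>n. blinfun_apply (\<phi> (u n)) y) \<longlonglongrightarrow> blinfun_apply (\<phi> s) y"
    and G_mono: "\<lbrakk>G m \<epsilon> a; m \<le> n; \<epsilon> \<le> \<delta>\<rbrakk> \<Longrightarrow> G n \<delta> a"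
    and G_add: "\<lbrakk>G n \<epsilon> a; G n \<delta> b\<rbrakk> \<Longrightarrow> G n (\<epsilon> + \<delta>) (a + b)"
    and G_scaleC: "G n \<epsilon> a \<Longrightarrow> G n (cmod c * \<epsilon>) (scaleC_op c a)"
    and G_adj: "G n \<epsilon> a \<Longrightarrow> G n \<epsilon> (adj a)"
    and G_tendsto: "\<And>(Fl :: 'h set filter) n \<epsilon> u s. \<lbrakk>Fl \<noteq> bot;
        \<And>x. ((\<lambda>\<alpha>. blinfun_apply (u \<alpha>) x) \<longlongrightarrow> blinfun_apply s x) Fl; \<And>\<alpha>. G n \<epsilon> (u \<alpha>)\<rbrakk> \<Longrightarrow> G n \<epsilon> s"
    and G_LIMSEQ: "\<And>n \<epsilon> u s. \<lbrakk>\<And>x. (\<lambda>k. blinfun_apply (u k) x) \<longlonglongrightarrow> blinfun_apply s x;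
        \<And>k. G n \<epsilon> (u k)\<rbrakk> \<Longrightarrow> G n \<epsilon> s"
    and G_compose: "\<exists>k. \<forall>s t \<epsilon> \<delta>. G m \<epsilon> s \<longrightarrow> G n \<delta> t \<longrightarrow> norm s \<le> 1 \<longrightarrow> norm t \<le> 1 \<longrightarrow>
        \<epsilon> \<le> 1 \<longrightarrow> 0 \<le> \<delta> \<longrightarrow> G k (\<epsilon> + 2 * \<delta>) (s o\<^sub>L t)"
    and G_\<phi>: "\<lbrakk>s \<in> S; 0 < \<epsilon>\<rbrakk> \<Longrightarrow> \<exists>n. G n \<epsilon> (\<phi> s)"
begin

lemma G_diff: "\<lbrakk>G n \<epsilon> a; G n \<delta> b\<rbrakk> \<Longrightarrow> G n (\<epsilon> + \<delta>) (a - b)"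
  using G_add[of n \<epsilon> a \<delta> "- b"] G_scaleC[of n \<delta> b "-1"] by (simp add: scaleC_op_minus_one)

text \<open>The proof of the Baire category theorem on the Cantor space of all \<open>D\<close>: for
  every \<open>j\<close>, avoiding \<open>G j (\<delta> / 2)\<close> is a dense open condition on \<open>D\<close>.\<close>

lemma gliding_hump:
  assumes T: "\<And>D. T D \<in> S" and t: "\<And>k. t k \<in> S"
    and T_insert: "\<And>D k. k \<notin> D \<Longrightarrow> T (insert k D) = T D + t k"
    and T_cont: "\<And>D D' x. (\<And>N. D' N \<inter> {..<N} = D \<inter> {..<N}) \<Longrightarrow>
      (\<lambda>N. blinfun_apply (T (D' N)) x) \<longlonglongrightarrow> blinfun_apply (T D) x"
    and \<delta>: "\<delta> > 0"
  shows "\<exists>n. G n \<delta> (\<phi> (t n))"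
proof (rule ccontr)
  assume "\<nexists>n. G n \<delta> (\<phi> (t n))"
  then have bad: "\<not> G n \<delta> (\<phi> (t n))" for n by blast
  \<comment> \<open>The sets with prescribed trace \<open>C\<close> below \<open>N\<close> form a
    basic open subset of the Cantor space; \<open>step\<close> shrinks any of these to one that is
    bad throughout.\<close>
  define bad_ext where "bad_ext j C N \<longleftrightarrow> (\<forall>D. D \<inter> {..<N} = C \<longrightarrow> \<not> G j (\<delta> / 2) (\<phi> (T D)))" for j C N
  have step: "\<exists>C' N'. C' \<subseteq> {..<N'} \<and> N \<le> N' \<and> C' \<inter> {..<N} = C \<and> bad_ext j C' N'"
    if C: "C \<subseteq> {..<N}" for j C N
  proof -
    \<comment> \<open>Adding \<open>k\<close> must not disturb the trace below \<open>N\<close>, and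
      badness of \<open>t k\<close> at index \<open>k\<close> must give badness at index
      \<open>j\<close>; hence the maximum.\<close>
    define k where "k = max j N"
    have "\<exists>C'. C' \<subseteq> {..k} \<and> C' \<inter> {..<N} = C \<and> \<not> G j (\<delta> / 2) (\<phi> (T C'))"
    proof (cases "G j (\<delta> / 2) (\<phi> (T C))")
      case True
      have "k \<notin> C" using C by (auto simp: k_def)
      then have "\<phi> (T (insert k C)) - \<phi> (T C) = \<phi> (t k)" by (simp add: T_insert \<phi>_add T t)
      \<comment> \<open>If \<open>C\<close> and \<open>insert k C\<close> were both good at level
        \<open>\<delta> / 2\<close>, the difference of their images would be good at level
        \<delta>.\<close>
      then have "\<not> G j (\<delta> / 2) (\<phi> (T (insert k C)))"
        using G_diff[of j "\<delta> / 2" "\<phi> (T (insert k C))" "\<delta> / 2" "\<phi> (T C)"] True bad[of k]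
          G_mono[of j \<delta> "\<phi> (t k)" k \<delta>] by (auto simp: k_def)
      moreover have "insert k C \<subseteq> {..k}" "insert k C \<inter> {..<N} = C" using C by (auto simp: k_def)
      ultimately show ?thesis by blast
    next
      case False
      moreover have "C \<subseteq> {..k}" "C \<inter> {..<N} = C" using C by (auto simp: k_def)
      ultimately show ?thesis by blast
    qed
    then obtain C' where C': "C' \<subseteq> {..k}" "C' \<inter> {..<N} = C" "\<not> G j (\<delta> / 2) (\<phi> (T C'))" by blast
    \<comment> \<open>Openness: otherwise good sets would converge to \<open>C'\<close>, and
      continuity together with closedness of \<open>G\<close> would make \<open>C'\<close>
      good.\<close>
    have "\<exists>N'\<ge>Suc k. bad_ext j C' N'"
    proof (rule ccontr)
      assume "\<not> (\<exists>N'\<ge>Suc k. bad_ext j C' N')"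
      \<comment> \<open>The maximum with \<open>Suc k\<close> turns the negated statement, which
        concerns large indices only, into one for every \<open>N\<close>.\<close>
      then have "\<forall>N. \<exists>D. D \<inter> {..<max N (Suc k)} = C' \<and> G j (\<delta> / 2) (\<phi> (T D))"
        unfolding bad_ext_def by (metis max.cobounded2)
      then obtain D' where D': "\<And>N. D' N \<inter> {..<max N (Suc k)} = C'"
        and good: "\<And>N. G j (\<delta> / 2) (\<phi> (T (D' N)))" by metis
      have "D' N \<inter> {..<N} = C' \<inter> {..<N}" for N using D'[of N] by auto
      then have "(\<lambda>N. blinfun_apply (T (D' N)) x) \<longlonglongrightarrow> blinfun_apply (T C') x" for x
        by (rule T_cont)
      then have "(\<lambda>N. blinfun_apply (\<phi> (T (D' N))) y) \<longlonglongrightarrow> blinfun_apply (\<phi> (T C')) y" for y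
        by (intro \<phi>_LIMSEQ T)
      then have "G j (\<delta> / 2) (\<phi> (T C'))" using good by (rule G_LIMSEQ)
      with C' show False by blast
    qed
    then obtain N' where N': "N' \<ge> Suc k" "bad_ext j C' N'" by blast
    have "C' \<subseteq> {..<N'}" "N \<le> N'" using C'(1) N'(1) by (auto simp: k_def)
    with C' N' show ?thesis by blast
  qed
  define P where "P p \<longleftrightarrow> fst p \<subseteq> {..<snd p}" for p :: "nat set \<times> nat"
  have "\<exists>f. \<forall>n. P (f n) \<and> (snd (f n) \<le> snd (f (Suc n)) \<and>
      fst (f (Suc n)) \<inter> {..<snd (f n)} = fst (f n) \<and> bad_ext n (fst (f (Suc n))) (snd (f (Suc n))))"
  proof (rule dependent_nat_choice)
    show "\<exists>p. P p" by (rule exI[of _ "({}, 0)"]) (simp add: P_def)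
    show "\<exists>q. P q \<and> snd p \<le> snd q \<and> fst q \<inter> {..<snd p} = fst p \<and> bad_ext n (fst q) (snd q)"
      if "P p" for p n
    proof -
      from step[OF that[unfolded P_def], of n]
      obtain C' N' where "C' \<subseteq> {..<N'}" "snd p \<le> N'" "C' \<inter> {..<snd p} = fst p" "bad_ext n C' N'"
        by (elim exE conjE)
      then show ?thesis unfolding P_def by (intro exI[of _ "(C', N')"] conjI) simp_all
    qed
  qed
  then obtain f where F: "\<forall>n. P (f n) \<and> (snd (f n) \<le> snd (f (Suc n)) \<and>
      fst (f (Suc n)) \<inter> {..<snd (f n)} = fst (f n) \<and> bad_ext n (fst (f (Suc n))) (snd (f (Suc n))))"
    by (elim exE)
  then have f: "\<And>n. P (f n)" "\<And>n. snd (f n) \<le> snd (f (Suc n))"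
    "\<And>n. fst (f (Suc n)) \<inter> {..<snd (f n)} = fst (f n)"
    "\<And>n. bad_ext n (fst (f (Suc n))) (snd (f (Suc n)))"
    by simp_all
  have agree: "fst (f m) \<inter> {..<snd (f n)} = fst (f n)" and le: "snd (f n) \<le> snd (f m)" if "n \<le> m" for m n
  proof -
    have "fst (f m) \<inter> {..<snd (f n)} = fst (f n) \<and> snd (f n) \<le> snd (f m)"
      using that
    proof (induction m rule: dec_induct)
      case base
      then show ?case using f(1)[of n] by (auto simp: P_def)
    next
      case (step m)
      have "snd (f n) \<le> snd (f m)" using step.IH by (rule conjunct2)
      then have "{..<snd (f n)} = {..<snd (f m)} \<inter> {..<snd (f n)}" by auto
      then have "fst (f (Suc m)) \<inter> {..<snd (f n)} = fst (f m) \<inter> {..<snd (f n)}"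
        using f(3)[of m] by (metis inf_assoc)
      with step f(2)[of m] show ?case by auto
    qed
    then show "fst (f m) \<inter> {..<snd (f n)} = fst (f n)" "snd (f n) \<le> snd (f m)" by auto
  qed
  \<comment> \<open>The traces stabilise, so \<open>D\<close> lies in all the chosen open sets and
    is bad for every index, whereas \<open>\<phi> (T D)\<close> must be good for some index.\<close>
  define D where "D = (\<Union>n. fst (f n))"
  have "D \<inter> {..<snd (f n)} = fst (f n)" for n
  proof
    show "D \<inter> {..<snd (f n)} \<subseteq> fst (f n)"
    proof
      fix x assume "x \<in> D \<inter> {..<snd (f n)}"
      then obtain m where m: "x \<in> fst (f m)" "x < snd (f n)" by (auto simp: D_def)
      show "x \<in> fst (f n)"
      proof (cases "n \<le> m")
        case True then show ?thesis using m agree[of n m] by auto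
      next
        case False then show ?thesis using m agree[of m n] by auto
      qed
    qed
    show "fst (f n) \<subseteq> D \<inter> {..<snd (f n)}" using f(1)[of n] by (auto simp: D_def P_def)
  qed
  then have no: "\<not> G n (\<delta> / 2) (\<phi> (T D))" for n using f(4)[of n] by (auto simp: bad_ext_def)
  obtain n where "G n (\<delta> / 2) (\<phi> (T D))" using G_\<phi>[OF T, of "\<delta> / 2" D] \<delta> by auto
  with no show False by blast
qed

end

section \<open>Families of operators that are good with a common index\<close>

context approximation_hom
begin

text \<open>Families are maps on a parameter set rather than sets of operators, so that families
  driven by the same parameter, such as the rows and columns of one operator, can be added.\<close>

definition uniformly_good :: "'c set \<Rightarrow> ('c \<Rightarrow> ('h \<Rightarrow>\<^sub>L 'h)) \<Rightarrow> bool" where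
  "uniformly_good K f \<longleftrightarrow> (\<forall>\<epsilon>>0. \<exists>n. \<forall>x\<in>K. G n \<epsilon> (\<phi> (f x)))"

lemma uniformly_goodD:
  assumes "uniformly_good K f" "\<epsilon> > 0"
  obtains n where "\<And>x. x \<in> K \<Longrightarrow> G n \<epsilon> (\<phi> (f x))"
  using assms unfolding uniformly_good_def by blast

lemma uniformly_good_cong:
  "(\<And>x. x \<in> K \<Longrightarrow> f x = g x) \<Longrightarrow> uniformly_good K g \<Longrightarrow> uniformly_good K f"
  unfolding uniformly_good_def by simp

lemma uniformly_good_comp:
  assumes "uniformly_good K' g" "\<And>x. x \<in> K \<Longrightarrow> h x \<in> K'" "\<And>x. x \<in> K \<Longrightarrow> f x = g (h x)"
  shows "uniformly_good K f"
  using assms unfolding uniformly_good_def by metis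

lemma uniformly_good_const: "s \<in> S \<Longrightarrow> uniformly_good K (\<lambda>_. s)"
  unfolding uniformly_good_def using G_\<phi> by blast

lemma uniformly_good_add:
  assumes f: "uniformly_good K f" "\<And>x. x \<in> K \<Longrightarrow> f x \<in> S"
    and g: "uniformly_good K g" "\<And>x. x \<in> K \<Longrightarrow> g x \<in> S"
  shows "uniformly_good K (\<lambda>x. f x + g x)"
  unfolding uniformly_good_def
proof (intro allI impI)
  fix \<epsilon> :: real assume "\<epsilon> > 0"
  then have "\<epsilon> / 2 > 0" by simp
  then obtain m n where mn: "\<And>x. x \<in> K \<Longrightarrow> G m (\<epsilon> / 2) (\<phi> (f x))"
    "\<And>x. x \<in> K \<Longrightarrow> G n (\<epsilon> / 2) (\<phi> (g x))"
    using uniformly_goodD[OF f(1)] uniformly_goodD[OF g(1)] by metis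
  have "G (max m n) (\<epsilon> / 2) (\<phi> (f x))" "G (max m n) (\<epsilon> / 2) (\<phi> (g x))" if "x \<in> K" for x
    by (rule G_mono[OF mn(1)[OF that]], simp_all) (rule G_mono[OF mn(2)[OF that]], simp_all)
  then have "G (max m n) \<epsilon> (\<phi> (f x + g x))" if "x \<in> K" for x
    using G_add[of "max m n" "\<epsilon> / 2" "\<phi> (f x)" "\<epsilon> / 2" "\<phi> (g x)"] that
    by (simp add: \<phi>_add f g)
  then show "\<exists>n. \<forall>x\<in>K. G n \<epsilon> (\<phi> (f x + g x))" by auto
qed

text \<open>The locale does not postulate that \<open>S\<close> is nonempty; a member
  \<open>s\<close> is therefore passed along, here and in the statements on sums.\<close>

lemma zero_in_S: "s \<in> S \<Longrightarrow> 0 \<in> S"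
  using S_scaleC[of s 0] by simp

lemma S_sum: "s \<in> S \<Longrightarrow> (\<And>i. i \<in> I \<Longrightarrow> f i \<in> S) \<Longrightarrow> sum f I \<in> S"
  by (induction I rule: infinite_finite_induct) (auto simp: zero_in_S S_add)

lemma uniformly_good_sum:
  assumes "s \<in> S" "finite I"
    and "\<And>i. i \<in> I \<Longrightarrow> uniformly_good K (f i)" "\<And>i x. i \<in> I \<Longrightarrow> x \<in> K \<Longrightarrow> f i x \<in> S"
  shows "uniformly_good K (\<lambda>x. \<Sum>i\<in>I. f i x)"
  using assms(2-4)
proof (induction I)
  case empty
  then show ?case using uniformly_good_const[OF zero_in_S[OF assms(1)]] by simp
next
  case (insert i I)
  then have "uniformly_good K (\<lambda>x. f i x + (\<Sum>i\<in>I. f i x))"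
    by (intro uniformly_good_add S_sum[OF assms(1)]) auto
  with insert show ?case by simp
qed

lemma uniformly_good_scaleC:
  assumes s: "s \<in> S" and c: "\<And>x. x \<in> K \<Longrightarrow> cmod (c x) \<le> 1"
  shows "uniformly_good K (\<lambda>x. scaleC_op (c x) s)"
  unfolding uniformly_good_def
proof (intro allI impI)
  fix \<epsilon> :: real assume e: "\<epsilon> > 0"
  then obtain n where n: "G n \<epsilon> (\<phi> s)" using G_\<phi>[OF s] by blast
  have "G n \<epsilon> (\<phi> (scaleC_op (c x) s))" if "x \<in> K" for x
  proof -
    have "cmod (c x) * \<epsilon> \<le> \<epsilon>" using c[OF that] e by simp
    then show ?thesis unfolding \<phi>_scaleC[OF s] using G_mono[OF G_scaleC[OF n]] by blast
  qed
  then show "\<exists>n. \<forall>x\<in>K. G n \<epsilon> (\<phi> (scaleC_op (c x) s))" by blast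
qed

lemma uniformly_good_adj:
  assumes f: "uniformly_good K f" "\<And>x. x \<in> K \<Longrightarrow> f x \<in> S"
  shows "uniformly_good K (\<lambda>x. adj (f x))"
  using assms unfolding uniformly_good_def by (simp add: \<phi>_adj) (meson G_adj)

text \<open>The matrix unit |a><b| is a partial isometry with range projection |a><a|, and a
  homomorphism of involutive algebras preserves this. The bound supplies the norm hypotheses of
  \<open>G_compose\<close>.\<close>

lemma norm_rank_one_image_le:
  assumes S: "rank_one a b \<in> S" "rank_one a a \<in> S" "rank_one b a \<in> S"
    and "norm a = 1" "norm b = 1"
  shows "norm (\<phi> (rank_one a b)) \<le> 1"
proof (rule norm_le_one_if_compose_adj_projection[OF \<phi>_bounded_ops[OF S(1)]])
  have unit: "cinner a a = 1" "cinner b b = 1" using assms by (auto simp: cinner_self)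
  have "\<phi> (rank_one a b) o\<^sub>L adj (\<phi> (rank_one a b)) = \<phi> (rank_one a a)"
    using \<phi>_compose[OF S(1,3)] \<phi>_adj[OF S(1)]
    by (simp add: adj_rank_one rank_one_compose unit)
  moreover have "projection (\<phi> (rank_one a a))"
    using \<phi>_compose[OF S(2,2)] \<phi>_adj[OF S(2)] \<phi>_bounded_ops[OF S(2)]
    by (simp add: projection_def adj_rank_one rank_one_compose unit)
  ultimately show "projection (\<phi> (rank_one a b) o\<^sub>L adj (\<phi> (rank_one a b)))" by simp
qed

end

section \<open>Discrete modules\<close>

locale block_module = coarse_module X \<E> \<AA> P
  for X :: "'x set" and \<E> \<AA> and P :: "'x set \<Rightarrow> ('h::complex_hilbert_space \<Rightarrow>\<^sub>L 'h)" +
  fixes E\<^sub>0 :: "('x \<times> 'x) set" and \<P> :: "'x set set"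
  assumes E0: "E\<^sub>0 \<in> \<E>"
    and partition: "partition_on X \<P>"
    and block_measurable: "A \<in> \<P> \<Longrightarrow> A \<in> \<AA>"
    and block_bounded: "A \<in> \<P> \<Longrightarrow> A \<times> A \<subseteq> E\<^sub>0"
    and block_sum: "((\<lambda>A. blinfun_apply (P A) v) has_sum v) \<P>"
begin

text \<open>Testing pairs of cells, instead of all pairs of measurable sets, makes the condition
  stable under compression by projections that commute only with the cell projections. For a fixed
  entourage it follows from \<open>controlled_propagation\<close>, and it implies it after composing
  with \<open>E\<^sub>0\<close> on both sides.\<close>

definition block_controlled :: "('x \<times> 'x) set \<Rightarrow> ('h \<Rightarrow>\<^sub>L 'h) \<Rightarrow> bool" where
  "block_controlled E t \<longleftrightarrow> t \<in> bounded_ops \<and>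
     (\<forall>A\<in>\<P>. \<forall>A'\<in>\<P>. A' \<inter> nbhd E A = {} \<longrightarrow> P A' o\<^sub>L t o\<^sub>L P A = 0)"

definition homogeneous :: "'h set" where
  "homogeneous = {b. \<exists>A\<in>\<P>. blinfun_apply (P A) b = b}"

lemma block_disjoint: "A \<in> \<P> \<Longrightarrow> B \<in> \<P> \<Longrightarrow> A \<noteq> B \<Longrightarrow> A \<inter> B = {}"
  using partition by (auto simp: partition_on_def disjoint_def)

lemma block_orthogonal:
  "A \<in> \<P> \<Longrightarrow> B \<in> \<P> \<Longrightarrow> A \<noteq> B \<Longrightarrow> blinfun_apply (P A) (blinfun_apply (P B) x) = 0"
  using proj_Int[of A B] by (simp add: block_measurable block_disjoint proj_empty
      flip: blinfun_apply_blinfun_compose)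

lemma controlled_imp_block_controlled:
  "controlled_propagation \<AA> P E t \<Longrightarrow> block_controlled E t"
  by (simp add: controlled_propagation_def block_controlled_def block_measurable)

text \<open>A bounded linear map can be applied termwise to the strongly convergent sum of the cell
  projections. This reduces identities of operators to their matrix entries.\<close>

lemma vanish_if_blocks_vanish:
  assumes "bounded_linear f" "\<And>A. A \<in> \<P> \<Longrightarrow> f (blinfun_apply (P A) v) = 0"
  shows "f v = 0"
proof -
  have "((\<lambda>A. f (blinfun_apply (P A) v)) has_sum f v) \<P>"
    by (rule has_sum_bounded_linear[OF assms(1) block_sum])
  moreover have "((\<lambda>A. f (blinfun_apply (P A) v)) has_sum 0) \<P>"
    by (rule has_sum_0) (simp add: assms)
  ultimately show ?thesis by (rule has_sum_unique)
qed

text \<open>Insert the cell decomposition on both sides of \<open>t\<close>. Contributing source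
  cells meet \<open>A\<close> and target cells meet \<open>A'\<close>; all cells are
  \<open>E\<^sub>0\<close>-bounded, so each side costs one factor \<open>E\<^sub>0\<close>.\<close>

lemma block_controlled_imp_controlled:
  assumes t: "block_controlled E t"
  shows "controlled_propagation \<AA> P (E\<^sub>0 O E O E\<^sub>0) t"
  unfolding controlled_propagation_def
proof (intro conjI ballI impI)
  show "t \<in> bounded_ops" using t by (simp add: block_controlled_def)
  fix A A' assume A: "A \<in> \<AA>" "A' \<in> \<AA>" "A' \<inter> nbhd (E\<^sub>0 O E O E\<^sub>0) A = {}"
  have entry: "blinfun_apply (P A') (blinfun_apply (P C') (blinfun_apply t (blinfun_apply (P C) (blinfun_apply (P A) x)))) = 0"
    if C: "C \<in> \<P>" "C' \<in> \<P>" for C C' x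
  proof (cases "C \<inter> A = {} \<or> A' \<inter> C' = {}")
    case True
    then have "P C o\<^sub>L P A = 0 \<or> P A' o\<^sub>L P C' = 0"
      using proj_Int[of C A] proj_Int[of A' C'] A C by (auto simp: block_measurable proj_empty)
    then have "blinfun_apply (P C o\<^sub>L P A) x = 0
        \<or> blinfun_apply (P A' o\<^sub>L P C') (blinfun_apply t (blinfun_apply (P C) (blinfun_apply (P A) x))) = 0"
      by (elim disjE) (simp_all only: zero_blinfun.rep_eq simp_thms)
    then show ?thesis by auto
  next
    case False
    then obtain a a' where a: "a \<in> C" "a \<in> A" "a' \<in> C'" "a' \<in> A'" by blast
    have "C' \<inter> nbhd E C = {}"
    proof (rule ccontr)
      assume "C' \<inter> nbhd E C \<noteq> {}"
      then obtain y x where yx: "y \<in> C'" "x \<in> C" "(y, x) \<in> E" by (auto simp: nbhd_def)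
      then have "(a', y) \<in> E\<^sub>0" "(x, a) \<in> E\<^sub>0" using a block_bounded C by blast+
      with yx have "(a', a) \<in> E\<^sub>0 O E O E\<^sub>0" by blast
      with a A(3) show False by (auto simp: nbhd_def)
    qed
    then have "P C' o\<^sub>L t o\<^sub>L P C = 0" using t C by (simp add: block_controlled_def)
    then have "blinfun_apply (P C' o\<^sub>L t o\<^sub>L P C) (blinfun_apply (P A) x) = 0" by simp
    then show ?thesis by simp
  qed
  have comm: "blinfun_apply (P C') (blinfun_apply (P A') z) = blinfun_apply (P A') (blinfun_apply (P C') z)"
    if "C' \<in> \<P>" for C' z
    using proj_Int[of A' C'] proj_Int[of C' A'] A that
    by (metis Int_commute block_measurable blinfun_apply_blinfun_compose)
  show "P A' o\<^sub>L t o\<^sub>L P A = 0"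
  proof (rule blinfun_eqI)
    fix x
    have "blinfun_apply (P A' o\<^sub>L t) (blinfun_apply (P A) x) = 0"
    proof (rule vanish_if_blocks_vanish[OF blinfun.bounded_linear_right])
      fix C assume C: "C \<in> \<P>"
      \<comment> \<open>Here the vector itself is decomposed, with the identity as linear map;
        \<open>comm\<close> brings the target cell projection next to \<open>t\<close>.\<close>
      have "(\<lambda>z. z) (blinfun_apply (P A') (blinfun_apply t (blinfun_apply (P C) (blinfun_apply (P A) x)))) = 0"
        by (rule vanish_if_blocks_vanish[OF bounded_linear_ident]) (simp add: comm entry[OF C])
      then show "blinfun_apply (P A' o\<^sub>L t) (blinfun_apply (P C) (blinfun_apply (P A) x)) = 0" by simp
    qed
    then show "blinfun_apply (P A' o\<^sub>L t o\<^sub>L P A) x = blinfun_apply 0 x" by simp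
  qed
qed

lemma block_controlled_cp_ops: "E \<in> \<E> \<Longrightarrow> block_controlled E t \<Longrightarrow> t \<in> cp_ops \<E> \<AA> P"
  unfolding cp_ops_def using block_controlled_imp_controlled E0 entourage_comp by blast

lemma block_controlled_sum:
  "(\<And>i. i \<in> I \<Longrightarrow> block_controlled E (f i)) \<Longrightarrow> block_controlled E (sum f I)"
  by (induction I rule: infinite_finite_induct)
    (auto simp: block_controlled_def bounded_ops_zero bounded_ops_add compose_add_left compose_add_right)

lemma block_controlled_LIMSEQ:
  assumes s: "\<And>n. block_controlled E (s n)"
    and lim: "\<And>x. (\<lambda>n. blinfun_apply (s n) x) \<longlonglongrightarrow> blinfun_apply t x"
  shows "block_controlled E t"
  unfolding block_controlled_def
proof (intro conjI ballI impI)
  show "t \<in> bounded_ops"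
    by (rule bounded_ops_tendsto[OF sequentially_bot lim]) (use s in \<open>simp add: block_controlled_def\<close>)
  fix A A' assume A: "A \<in> \<P>" "A' \<in> \<P>" "A' \<inter> nbhd E A = {}"
  show "P A' o\<^sub>L t o\<^sub>L P A = 0"
  proof (rule blinfun_eqI)
    fix x
    have "blinfun_apply (P A' o\<^sub>L s n o\<^sub>L P A) x = 0" for n
      using s[of n] A by (simp add: block_controlled_def)
    moreover have "(\<lambda>n. blinfun_apply (P A' o\<^sub>L s n o\<^sub>L P A) x) \<longlonglongrightarrow> blinfun_apply (P A' o\<^sub>L t o\<^sub>L P A) x"
      by (simp, intro bounded_linear.tendsto[OF blinfun.bounded_linear_right] lim)
    ultimately have "blinfun_apply (P A' o\<^sub>L t o\<^sub>L P A) x = 0"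
      using LIMSEQ_unique[OF _ tendsto_const[of 0]] by simp
    then show "blinfun_apply (P A' o\<^sub>L t o\<^sub>L P A) x = blinfun_apply 0 x" by simp
  qed
qed

text \<open>As \<open>q\<close> commutes with the cell projections it can be moved outside, so the
  compression needs no larger entourage. This is what gives all blocks of the later construction a
  common \<open>E\<close>.\<close>

lemma block_controlled_compress:
  assumes t: "block_controlled E t" and q: "q \<in> bounded_ops"
    and comm: "\<And>A. A \<in> \<P> \<Longrightarrow> P A o\<^sub>L q = q o\<^sub>L P A"
  shows "block_controlled E (q o\<^sub>L t o\<^sub>L q)"
  unfolding block_controlled_def
proof (intro conjI ballI impI)
  show "q o\<^sub>L t o\<^sub>L q \<in> bounded_ops"
    using t q by (simp add: block_controlled_def bounded_ops_compose)
  fix A A' assume A: "A \<in> \<P>" "A' \<in> \<P>" "A' \<inter> nbhd E A = {}"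
  have "P A' o\<^sub>L (q o\<^sub>L t o\<^sub>L q) o\<^sub>L P A = (P A' o\<^sub>L q) o\<^sub>L t o\<^sub>L (q o\<^sub>L P A)"
    by (simp only: compose_assoc)
  also have "\<dots> = (q o\<^sub>L P A') o\<^sub>L t o\<^sub>L (P A o\<^sub>L q)" by (simp only: comm A)
  also have "\<dots> = q o\<^sub>L (P A' o\<^sub>L t o\<^sub>L P A) o\<^sub>L q" by (simp only: compose_assoc)
  also have "\<dots> = 0" using t A by (simp add: block_controlled_def)
  finally show "P A' o\<^sub>L (q o\<^sub>L t o\<^sub>L q) o\<^sub>L P A = 0" .
qed

section \<open>Finite rank projections compatible with the partition\<close>

lemma homogeneous_proj:
  assumes "b \<in> homogeneous" "A \<in> \<P>"
  shows "blinfun_apply (P A) b = b \<or> blinfun_apply (P A) b = 0"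
proof -
  obtain C where "C \<in> \<P>" "blinfun_apply (P C) b = b" using assms by (auto simp: homogeneous_def)
  then show ?thesis using block_orthogonal[of A C b] assms by (cases "A = C") auto
qed

text \<open>A cell projection either fixes or kills each \<open>b\<close>, so it can be moved from
  one side of |b><b| to the other.\<close>

lemma span_proj_comm:
  assumes "B \<subseteq> homogeneous" "A \<in> \<P>"
  shows "P A o\<^sub>L span_proj B = span_proj B o\<^sub>L P A"
proof -
  have A: "projection (P A)" using assms block_measurable proj by blast
  have "P A o\<^sub>L rank_one b b = rank_one b b o\<^sub>L P A" if "b \<in> B" for b
  proof -
    have "rank_one (blinfun_apply (P A) b) b = rank_one b (blinfun_apply (P A) b)"
      using homogeneous_proj[OF subsetD[OF assms(1) that] assms(2)]
      by (auto intro!: blinfun_eqI)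
    then show ?thesis
      by (simp add: compose_rank_one rank_one_compose_op projectionD[OF A])
  qed
  then have "(\<Sum>b\<in>B. P A o\<^sub>L rank_one b b) = (\<Sum>b\<in>B. rank_one b b o\<^sub>L P A)" by simp
  moreover have "(\<Sum>b\<in>B. P A o\<^sub>L rank_one b b) = P A o\<^sub>L span_proj B"
    unfolding span_proj_def by (induction B rule: infinite_finite_induct) (auto simp: compose_add_right)
  moreover have "(\<Sum>b\<in>B. rank_one b b o\<^sub>L P A) = span_proj B o\<^sub>L P A"
    unfolding span_proj_def by (induction B rule: infinite_finite_induct) (auto simp: compose_add_left)
  ultimately show ?thesis by simp
qed

text \<open>A Gram-Schmidt step. The residual stays in the cell of \<open>x\<close> because
  \<open>span_proj B\<close> commutes with the projection of that cell.\<close>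

lemma homogeneous_orthonormal_extend1:
  assumes B: "orthonormal B" "B \<subseteq> homogeneous" and x: "x \<in> homogeneous"
  obtains B' where "orthonormal B'" "B' \<subseteq> homogeneous" "B \<subseteq> B'" "blinfun_apply (span_proj B') x = x"
proof (cases "blinfun_apply (span_proj B) x = x")
  case True
  then show thesis using that[of B] B by simp
next
  case False
  define y where "y = x - blinfun_apply (span_proj B) x"
  define b where "b = (1 / norm y) *\<^sub>R y"
  have y: "norm y \<noteq> 0" using False by (simp add: y_def)
  have qb: "blinfun_apply (span_proj B) b = 0"
    by (simp add: b_def y_def blinfun.scaleR_right blinfun.diff_right
        projectionD(4)[OF projection_span_proj[OF B(1)]])
  have nb: "norm b = 1" using y by (simp add: b_def)
  obtain A where A: "A \<in> \<P>" "blinfun_apply (P A) x = x" using x by (auto simp: homogeneous_def)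
  have "blinfun_apply (P A) (blinfun_apply (span_proj B) x) = blinfun_apply (span_proj B) x"
    using span_proj_comm[OF B(2) A(1)] A(2) by (metis blinfun_apply_blinfun_compose)
  then have "blinfun_apply (P A) b = b"
    by (simp add: b_def y_def blinfun.scaleR_right blinfun.diff_right A(2))
  then have hom: "b \<in> homogeneous" using A(1) by (auto simp: homogeneous_def)
  have o': "orthonormal (insert b B)" by (rule orthonormal_insert[OF B(1) nb qb])
  have "x = blinfun_apply (span_proj B) x + norm y *\<^sub>R b" using y by (simp add: b_def y_def)
  moreover have "blinfun_apply (span_proj (insert b B)) b = b" by (rule span_proj_mem[OF o']) simp
  moreover have "blinfun_apply (span_proj (insert b B)) (blinfun_apply (span_proj B) x) = blinfun_apply (span_proj B) x"
    using span_proj_compose'[OF o', of B] by (metis blinfun_apply_blinfun_compose subset_insertI)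
  ultimately have "blinfun_apply (span_proj (insert b B)) x = x"
    by (metis blinfun.add_right blinfun.scaleR_right)
  then show thesis using that[of "insert b B"] o' hom B by auto
qed

lemma homogeneous_orthonormal_extend:
  assumes "finite W" "W \<subseteq> homogeneous" and B: "orthonormal B" "B \<subseteq> homogeneous"
  shows "\<exists>B'. orthonormal B' \<and> B' \<subseteq> homogeneous \<and> B \<subseteq> B' \<and> (\<forall>x\<in>W. blinfun_apply (span_proj B') x = x)"
  using assms(1,2)
proof (induction W)
  case empty
  then show ?case using B by blast
next
  case (insert x W)
  then obtain B1 where B1: "orthonormal B1" "B1 \<subseteq> homogeneous" "B \<subseteq> B1"
    "\<forall>x\<in>W. blinfun_apply (span_proj B1) x = x" by auto
  obtain B' where B': "orthonormal B'" "B' \<subseteq> homogeneous" "B1 \<subseteq> B'" "blinfun_apply (span_proj B') x = x"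
    using homogeneous_orthonormal_extend1[OF B1(1,2), of x] insert.prems by auto
  have "blinfun_apply (span_proj B') y = y" if "y \<in> W" for y
    using span_proj_compose'[OF B'(1,3)] B1(4) that by (metis blinfun_apply_blinfun_compose)
  then show ?case using B' B1 by blast
qed

text \<open>The Hilbert space need not be separable, so the projections form a net over finite sets
  of homogeneous vectors. It is eventually exact on each homogeneous vector; finite sums of these
  are dense, and the projections are contractions.\<close>

lemma span_proj_net:
  assumes B: "orthonormal B" "B \<subseteq> homogeneous"
  obtains Bs :: "'h set \<Rightarrow> 'h set"
  where "\<And>W. orthonormal (Bs W)" "\<And>W. Bs W \<subseteq> homogeneous" "\<And>W. B \<subseteq> Bs W"
    "\<And>x. ((\<lambda>W. blinfun_apply (span_proj (Bs W)) x) \<longlongrightarrow> x) (finite_subsets_at_top homogeneous)"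
proof -
  let ?F = "finite_subsets_at_top homogeneous"
  \<comment> \<open>For \<open>W\<close> infinite or not consisting of homogeneous vectors,
    \<open>B\<close> itself serves as a default, so that \<open>Bs\<close> is total.\<close>
  have "\<exists>B'. orthonormal B' \<and> B' \<subseteq> homogeneous \<and> B \<subseteq> B' \<and>
      (finite W \<and> W \<subseteq> homogeneous \<longrightarrow> (\<forall>x\<in>W. blinfun_apply (span_proj B') x = x))" for W
    using homogeneous_orthonormal_extend[OF _ _ B, of W] B by (cases "finite W \<and> W \<subseteq> homogeneous") blast+
  then obtain Bs where Bs: "\<And>W. orthonormal (Bs W)" "\<And>W. Bs W \<subseteq> homogeneous" "\<And>W. B \<subseteq> Bs W"
    and fx: "\<And>W x. finite W \<Longrightarrow> W \<subseteq> homogeneous \<Longrightarrow> x \<in> W \<Longrightarrow> blinfun_apply (span_proj (Bs W)) x = x"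
    by metis
  have hom: "((\<lambda>W. blinfun_apply (span_proj (Bs W)) x) \<longlongrightarrow> x) ?F" if "x \<in> homogeneous" for x
  proof (rule tendsto_eventually)
    show "\<forall>\<^sub>F W in ?F. blinfun_apply (span_proj (Bs W)) x = x"
      unfolding eventually_finite_subsets_at_top
      by (intro exI[of _ "{x}"]) (use that fx in auto)
  qed
  have "((\<lambda>W. blinfun_apply (span_proj (Bs W)) x) \<longlongrightarrow> x) ?F" for x
  proof (rule tendstoI)
    fix e :: real assume e: "e > 0"
    then have "\<forall>\<^sub>F F in finite_subsets_at_top \<P>. dist (\<Sum>A\<in>F. blinfun_apply (P A) x) x < e / 3"
      using block_sum[of x] unfolding has_sum_def by (intro tendstoD) auto
    then obtain F where F: "finite F" "F \<subseteq> \<P>" "dist (\<Sum>A\<in>F. blinfun_apply (P A) x) x < e / 3"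
      unfolding eventually_finite_subsets_at_top by blast
    define y where "y = (\<Sum>A\<in>F. blinfun_apply (P A) x)"
    have "blinfun_apply (P A) x \<in> homogeneous" if "A \<in> F" for A
      using projectionD(4)[OF proj[OF block_measurable]] that F(2) unfolding homogeneous_def by blast
    then have "((\<lambda>W. \<Sum>A\<in>F. blinfun_apply (span_proj (Bs W)) (blinfun_apply (P A) x)) \<longlongrightarrow> y) ?F"
      unfolding y_def by (intro tendsto_sum hom)
    then have "((\<lambda>W. blinfun_apply (span_proj (Bs W)) y) \<longlongrightarrow> y) ?F"
      unfolding y_def by (simp add: blinfun.sum_right)
    then have "\<forall>\<^sub>F W in ?F. dist (blinfun_apply (span_proj (Bs W)) y) y < e / 3"
      using e by (intro tendstoD) auto
    then show "\<forall>\<^sub>F W in ?F. dist (blinfun_apply (span_proj (Bs W)) x) x < e"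
    proof (rule eventually_mono)
      fix W assume W: "dist (blinfun_apply (span_proj (Bs W)) y) y < e / 3"
      have "dist (blinfun_apply (span_proj (Bs W)) x) (blinfun_apply (span_proj (Bs W)) y) \<le> dist x y"
        using norm_projection_apply_le[OF projection_span_proj[OF Bs(1)], of W "x - y"]
        by (simp add: dist_norm blinfun.diff_right)
      then show "dist (blinfun_apply (span_proj (Bs W)) x) x < e"
        using W F(3) dist_triangle[of "blinfun_apply (span_proj (Bs W)) x" x "blinfun_apply (span_proj (Bs W)) y"]
          dist_triangle[of "blinfun_apply (span_proj (Bs W)) y" x y]
        by (simp add: y_def[symmetric] dist_commute)
    qed
  qed
  with Bs show thesis by (rule that)
qed

text \<open>Split q t q x - t x into q t (q x - x) and q t x - t x; uniform contractivity of
  \<open>q\<close> handles the first term.\<close>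

lemma compress_tendsto:
  assumes q: "\<And>W. norm (q W) \<le> 1" "\<And>x. ((\<lambda>W. blinfun_apply (q W) x) \<longlongrightarrow> x) Fl"
  shows "((\<lambda>W. blinfun_apply (q W o\<^sub>L t o\<^sub>L q W) x) \<longlongrightarrow> blinfun_apply t x) Fl"
proof -
  have "((\<lambda>W. blinfun_apply (q W) (blinfun_apply t (blinfun_apply (q W) x - x))) \<longlongrightarrow> 0) Fl"
  proof (rule Lim_null_comparison)
    have "norm (blinfun_apply (q W) v) \<le> norm v" for W v
      using norm_blinfun[of "q W" v] mult_right_mono[OF q(1)[of W], of "norm v"] by simp
    then show "\<forall>\<^sub>F W in Fl. norm (blinfun_apply (q W) (blinfun_apply t (blinfun_apply (q W) x - x)))
        \<le> norm (blinfun_apply t (blinfun_apply (q W) x - x))"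
      by simp
    have "((\<lambda>W. blinfun_apply t (blinfun_apply (q W) x - x)) \<longlongrightarrow> blinfun_apply t (x - x)) Fl"
      by (intro bounded_linear.tendsto[OF blinfun.bounded_linear_right] tendsto_diff q tendsto_const)
    then show "((\<lambda>W. norm (blinfun_apply t (blinfun_apply (q W) x - x))) \<longlongrightarrow> 0) Fl"
      using tendsto_norm_zero by (simp add: blinfun.zero_right)
  qed
  from tendsto_add[OF this q(2)[of "blinfun_apply t x"]]
  show ?thesis by (simp add: blinfun.diff_right)
qed

end

section \<open>Uniformity over operators of bounded propagation\<close>

locale block_module_hom =
  block_module X \<E> \<AA> P E\<^sub>0 \<P> + approximation_hom "cp_ops \<E> \<AA> P" \<phi> G
  for X :: "'x set" and \<E> \<AA> and P :: "'x set \<Rightarrow> ('h::complex_hilbert_space \<Rightarrow>\<^sub>L 'h)" and E\<^sub>0 \<P>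
    and \<phi> :: "('h \<Rightarrow>\<^sub>L 'h) \<Rightarrow> ('k::complex_hilbert_space \<Rightarrow>\<^sub>L 'k)" and G
begin

text \<open>The sets \<open>B\<close> grow, so successive differences span mutually orthogonal
  subspaces, and the bad operators found there are orthogonal blocks controlled by one
  \<open>E\<close>. Their strong sums over index sets stay in the domain of \<phi>, and
  \<open>gliding_hump\<close> applies. The predicate \<open>\<O>\<close> carries whatever property
  of \<open>B\<close> the search for the next block needs.\<close>

lemma no_bad_scheme:
  assumes E: "E \<in> \<E>" and \<delta>: "\<delta> > 0"
    and \<O>: "\<And>B. \<O> B \<Longrightarrow> orthonormal B" "\<O> {}"
    and step: "\<And>n B. \<O> B \<Longrightarrow> \<exists>B' t. \<O> B' \<and> B \<subseteq> B' \<and> block_controlled E t \<and> norm t \<le> 1 \<and>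
      span_proj (B' - B) o\<^sub>L t o\<^sub>L span_proj (B' - B) = t \<and> \<not> G n \<delta> (\<phi> t)"
  shows False
proof -
  define R where "R n p q \<longleftrightarrow> fst p \<subseteq> fst q \<and> block_controlled E (snd q) \<and> norm (snd q) \<le> 1 \<and>
      span_proj (fst q - fst p) o\<^sub>L snd q o\<^sub>L span_proj (fst q - fst p) = snd q \<and> \<not> G n \<delta> (\<phi> (snd q))"
    for n and p q :: "'h set \<times> ('h \<Rightarrow>\<^sub>L 'h)"
  have "\<exists>f. \<forall>n. \<O> (fst (f n)) \<and> R n (f n) (f (Suc n))"
  proof (rule dependent_nat_choice)
    show "\<exists>p :: 'h set \<times> ('h \<Rightarrow>\<^sub>L 'h). \<O> (fst p)"
      by (rule exI[of _ "({}, 0)"]) (simp add: \<O>(2))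
    show "\<exists>q. \<O> (fst q) \<and> R n p q" if p: "\<O> (fst p)" for p n
    proof -
      from step[OF p, of n] obtain B' t where "\<O> B' \<and> fst p \<subseteq> B' \<and> block_controlled E t \<and> norm t \<le> 1 \<and>
        span_proj (B' - fst p) o\<^sub>L t o\<^sub>L span_proj (B' - fst p) = t \<and> \<not> G n \<delta> (\<phi> t)"
        by (elim exE)
      then show ?thesis unfolding R_def by (intro exI[of _ "(B', t)"]) simp
    qed
  qed
  then obtain f where f: "\<forall>n. \<O> (fst (f n)) \<and> R n (f n) (f (Suc n))" by (elim exE)
  define B where "B n = fst (f n)" for n
  \<comment> \<open>Block number \<open>n\<close> is stored in state \<open>Suc n\<close>; the
    operator in state 0 is arbitrary.\<close>
  define t where "t n = snd (f (Suc n))" for n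
  define r where "r n = span_proj (B (Suc n) - B n)" for n
  have B: "orthonormal (B n)" for n using f \<O>(1) by (simp add: B_def)
  have Suc: "B n \<subseteq> B (Suc n)" for n using f by (simp add: B_def R_def)
  have t: "block_controlled E (t n)" "norm (t n) \<le> 1" "r n o\<^sub>L t n o\<^sub>L r n = t n"
    "\<not> G n \<delta> (\<phi> (t n))" for n
    using f by (simp_all add: t_def r_def B_def R_def)
  have mono: "B m \<subseteq> B n" if "m \<le> n" for m n
    using that Suc by (rule lift_Suc_mono_le[rotated])
  have disj: "r m o\<^sub>L r n = 0" if "m \<noteq> n" for m n
    unfolding r_def
  proof (rule span_proj_disjoint)
    let ?k = "Suc (max m n)"
    have "B (Suc m) \<subseteq> B ?k" "B (Suc n) \<subseteq> B ?k" by (intro mono; simp)+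
    then show "orthonormal ((B (Suc m) - B m) \<union> (B (Suc n) - B n))"
      by (intro orthonormal_subset[OF B[of ?k]]) auto
    show "(B (Suc m) - B m) \<inter> (B (Suc n) - B n) = {}"
    proof (cases "m < n")
      case True
      then have "B (Suc m) \<subseteq> B n" by (intro mono) simp
      then show ?thesis by auto
    next
      case False
      with that have "B (Suc n) \<subseteq> B m" by (intro mono) simp
      then show ?thesis by auto
    qed
  qed
  have r: "projection (r n)" for n
    unfolding r_def using orthonormal_subset[OF B[of "Suc n"]] by (intro projection_span_proj) auto
  have t_ops: "t n \<in> bounded_ops" for n using t(1)[of n] by (simp add: block_controlled_def)
  show False
  proof (rule orthogonal_blocks_strong_sums[OF r disj t_ops t(3,2)])
    fix T :: "nat set \<Rightarrow> 'h \<Rightarrow>\<^sub>L 'h"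
    assume T: "\<And>D x. (\<lambda>m. \<Sum>n\<in>D \<inter> {..<m}. blinfun_apply (t n) x) \<longlonglongrightarrow> blinfun_apply (T D) x"
      and T_insert: "\<And>D k. k \<notin> D \<Longrightarrow> T (insert k D) = T D + t k"
      and T_cont: "\<And>D D' x. (\<And>N. D' N \<inter> {..<N} = D \<inter> {..<N}) \<Longrightarrow>
        (\<lambda>N. blinfun_apply (T (D' N)) x) \<longlonglongrightarrow> blinfun_apply (T D) x"
    have "block_controlled E (T D)" for D
    proof (rule block_controlled_LIMSEQ)
      show "block_controlled E (\<Sum>n\<in>D \<inter> {..<m}. t n)" for m by (intro block_controlled_sum t)
      show "(\<lambda>m. blinfun_apply (\<Sum>n\<in>D \<inter> {..<m}. t n) x) \<longlonglongrightarrow> blinfun_apply (T D) x" for x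
        using T by (simp add: blinfun_sum_apply)
    qed
    then have T_S: "T D \<in> cp_ops \<E> \<AA> P" for D by (rule block_controlled_cp_ops[OF E])
    have "\<exists>n. G n \<delta> (\<phi> (t n))"
      by (rule gliding_hump[of T t, OF T_S block_controlled_cp_ops[OF E t(1)] T_insert T_cont \<delta>])
    with t(4) show False by blast
  qed
qed

text \<open>If $|\xi\rangle\langle b|$ is bad for arbitrarily late $b$, then so is
  $|a\rangle\langle b|$ for a previously chosen $a$, because the other factor of
  $|\xi\rangle\langle b| = |\xi\rangle\langle a| \cdot |a\rangle\langle b|$ does not depend
  on $b$.\<close>

lemma uniformly_good_rank_one:
  assumes N: "\<And>a b. a \<in> N \<Longrightarrow> b \<in> N \<Longrightarrow> a + b \<in> N" "\<And>c a. a \<in> N \<Longrightarrow> c *\<^sub>C a \<in> N"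
    and E: "E \<in> \<E>" and NE: "\<And>a b. a \<in> N \<Longrightarrow> b \<in> N \<Longrightarrow> block_controlled E (rank_one a b)"
    and \<xi>: "\<xi> \<in> N" "norm \<xi> = 1"
  shows "uniformly_good {\<eta>\<in>N. norm \<eta> \<le> 1} (rank_one \<xi>)"
proof (rule ccontr)
  assume "\<not> ?thesis"
  then obtain \<epsilon> where \<epsilon>: "\<epsilon> > 0" and bad: "\<And>n. \<exists>\<eta>. \<eta> \<in> N \<and> norm \<eta> \<le> 1 \<and> \<not> G n \<epsilon> (\<phi> (rank_one \<xi> \<eta>))"
    unfolding uniformly_good_def by auto
  have S: "rank_one a b \<in> cp_ops \<E> \<AA> P" if "a \<in> N" "b \<in> N" for a b
    using block_controlled_cp_ops[OF E NE[OF that]] .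
  have N0: "0 \<in> N" using N(2)[OF \<xi>(1), of 0] by simp
  have Nsum: "sum f I \<in> N" if "\<And>i. i \<in> I \<Longrightarrow> f i \<in> N" for f :: "'h \<Rightarrow> 'h" and I
    using that by (induction I rule: infinite_finite_induct) (auto simp: N0 N)
  \<comment> \<open>The part of \<eta> in the span of \<open>B\<close> contributes finitely many
    fixed operators with bounded coefficients, hence is uniformly good. Half of the badness level
    survives on a unit vector orthogonal to \<open>B\<close>.\<close>
  have key: "\<exists>b. b \<in> N \<and> norm b = 1 \<and> blinfun_apply (span_proj B) b = 0 \<and> \<not> G n (\<epsilon> / 2) (\<phi> (rank_one \<xi> b))"
    if B: "orthonormal B" "B \<subseteq> N" for B n
  proof -
    let ?q = "span_proj B" and ?K = "{\<eta>\<in>N. norm \<eta> \<le> 1}"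
    have qN: "blinfun_apply ?q x \<in> N" for x
      unfolding span_proj_apply by (intro Nsum N) (use B in auto)
    have "uniformly_good ?K (\<lambda>\<eta>. \<Sum>b\<in>B. scaleC_op (cnj (cinner b \<eta>)) (rank_one \<xi> b))"
    proof (rule uniformly_good_sum[OF S[OF \<xi>(1) \<xi>(1)]])
      show "finite B" using B by (simp add: orthonormal_def)
      fix b assume b: "b \<in> B"
      then have s: "rank_one \<xi> b \<in> cp_ops \<E> \<AA> P" using B \<xi> by (intro S) auto
      then show "scaleC_op (cnj (cinner b x)) (rank_one \<xi> b) \<in> cp_ops \<E> \<AA> P" for x by (rule S_scaleC)
      have "cmod (cnj (cinner b x)) \<le> 1" if "x \<in> ?K" for x
        using norm_cinner_le[of b x] b B that by (auto simp: orthonormal_def)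
      then show "uniformly_good ?K (\<lambda>\<eta>. scaleC_op (cnj (cinner b \<eta>)) (rank_one \<xi> b))"
        by (rule uniformly_good_scaleC[OF s])
    qed
    then have "uniformly_good ?K (\<lambda>\<eta>. rank_one \<xi> (blinfun_apply ?q \<eta>))"
      by (simp add: span_proj_apply rank_one_sum_right rank_one_scaleC_right)
    moreover have "\<epsilon> / 2 > 0" using \<epsilon> by simp
    ultimately obtain m where m: "\<forall>\<eta>\<in>?K. G m (\<epsilon> / 2) (\<phi> (rank_one \<xi> (blinfun_apply ?q \<eta>)))"
      unfolding uniformly_good_def by blast
    from bad[of "max m n"] obtain \<eta> where \<eta>: "\<eta> \<in> N" "norm \<eta> \<le> 1" "\<not> G (max m n) \<epsilon> (\<phi> (rank_one \<xi> \<eta>))"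
      by (elim exE conjE)
    define y where "y = \<eta> - blinfun_apply ?q \<eta>"
    have q_good: "G (max m n) (\<epsilon> / 2) (\<phi> (rank_one \<xi> (blinfun_apply ?q \<eta>)))"
      by (rule G_mono[OF bspec[OF m, of \<eta>]]) (use \<eta> in auto)
    have y_eq: "\<eta> = blinfun_apply ?q \<eta> + y" by (simp add: y_def)
    have yN: "y \<in> N"
      unfolding y_def using N(1)[OF \<eta>(1) N(2)[OF qN[of \<eta>], of "-1"]] by (simp add: scaleC_minus_one)
    have "\<not> G (max m n) (\<epsilon> / 2) (\<phi> (rank_one \<xi> y))"
    proof
      assume "G (max m n) (\<epsilon> / 2) (\<phi> (rank_one \<xi> y))"
      from G_add[OF q_good this] have "G (max m n) \<epsilon> (\<phi> (rank_one \<xi> (blinfun_apply ?q \<eta> + y)))"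
        by (simp add: rank_one_add_right \<phi>_add S \<xi> qN yN)
      with \<eta>(3) y_eq show False by simp
    qed
    moreover have "y \<noteq> 0"
    proof
      assume "y = 0"
      then have "\<eta> = blinfun_apply ?q \<eta>" using y_eq by simp
      then have "G (max m n) (\<epsilon> / 2) (\<phi> (rank_one \<xi> \<eta>))" using q_good by simp
      then show False using \<eta>(3) G_mono[of "max m n" "\<epsilon> / 2" _ "max m n" \<epsilon>] \<epsilon> by simp
    qed
    moreover have "norm y \<le> 1"
      using norm_projection_apply_le[OF projection_compl[OF projection_span_proj[OF B(1)]], of \<eta>] \<eta>(2)
      by (simp add: y_def blinfun.diff_left)
    \<comment> \<open>Normalising is safe because the norm of \<open>y\<close> is at most 1:
      goodness for \<open>b\<close> would be inherited by \<open>y\<close>.\<close>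
    moreover define b where "b = of_real (1 / norm y) *\<^sub>C y"
    ultimately have y: "y \<noteq> 0" "norm y \<le> 1" "\<not> G (max m n) (\<epsilon> / 2) (\<phi> (rank_one \<xi> y))"
      by simp_all
    have bN: "b \<in> N" unfolding b_def by (rule N(2)[OF yN])
    have "y = of_real (norm y) *\<^sub>C b" using y(1) by (simp add: b_def scaleC_scaleC)
    then have "rank_one \<xi> y = scaleC_op (of_real (norm y)) (rank_one \<xi> b)"
      using rank_one_scaleC_right[of \<xi> "of_real (norm y)" b] by simp
    then have sc: "\<phi> (rank_one \<xi> y) = scaleC_op (of_real (norm y)) (\<phi> (rank_one \<xi> b))"
      by (simp add: \<phi>_scaleC[OF S[OF \<xi>(1) bN]])
    have "\<not> G n (\<epsilon> / 2) (\<phi> (rank_one \<xi> b))"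
    proof
      assume "G n (\<epsilon> / 2) (\<phi> (rank_one \<xi> b))"
      from G_scaleC[OF this, of "of_real (norm y)"] have "G n (norm y * (\<epsilon> / 2)) (\<phi> (rank_one \<xi> y))"
        by (simp add: sc)
      then have "G (max m n) (\<epsilon> / 2) (\<phi> (rank_one \<xi> y))"
      proof (rule G_mono)
        have "norm y * (\<epsilon> / 2) \<le> 1 * (\<epsilon> / 2)" using y(2) \<epsilon> by (intro mult_right_mono) auto
        then show "norm y * (\<epsilon> / 2) \<le> \<epsilon> / 2" by simp
      qed simp
      with y(3) show False ..
    qed
    moreover have "norm b = 1"
      unfolding b_def norm_scaleC norm_of_real using y(1) by simp
    moreover have "blinfun_apply ?q y = 0"
      by (simp add: y_def blinfun.diff_right projectionD(4)[OF projection_span_proj[OF B(1)]])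
    then have "blinfun_apply ?q b = 0"
      unfolding b_def bounded_opsD[OF span_proj_bounded_ops] by simp
    ultimately show ?thesis using bN by blast
  qed
  show False
  proof (rule no_bad_scheme[OF E, of "\<epsilon> / 8" "\<lambda>B. orthonormal B \<and> B \<subseteq> N"])
    fix n B assume B: "orthonormal B \<and> B \<subseteq> N"
    \<comment> \<open>Only a unit vector of \<open>N\<close> orthogonal to \<open>B\<close> is
      wanted here; its badness is discarded.\<close>
    from key[OF conjunct1[OF this] conjunct2[OF this], of 0]
    obtain a where a: "a \<in> N" "norm a = 1" "blinfun_apply (span_proj B) a = 0"
      by (elim exE conjE)
    \<comment> \<open>The bound 1 is required by \<open>G_compose\<close>; with
      \<open>\<epsilon> / 4\<close> the composite error
      \<open>\<delta> + 2 * (\<epsilon> / 8)\<close> is at most \<open>\<epsilon> / 2\<close>, the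
      level excluded by \<open>key\<close>.\<close>
    define \<delta> where "\<delta> = min 1 (\<epsilon> / 4)"
    have "\<delta> > 0" using \<epsilon> by (simp add: \<delta>_def)
    then obtain m where m: "G m \<delta> (\<phi> (rank_one \<xi> a))" using G_\<phi>[OF S[OF \<xi>(1) a(1)]] by blast
    \<comment> \<open>The index \<open>k\<close> depends only on \<open>m\<close>, that is on
      \<open>a\<close>, and on \<open>n\<close>; so \<open>b\<close> can be chosen afterwards to be
      bad for \<open>k\<close>.\<close>
    from G_compose[of m n] obtain k where k: "\<forall>s t \<epsilon> \<delta>. G m \<epsilon> s \<longrightarrow> G n \<delta> t \<longrightarrow> norm s \<le> 1 \<longrightarrow>
        norm t \<le> 1 \<longrightarrow> \<epsilon> \<le> 1 \<longrightarrow> 0 \<le> \<delta> \<longrightarrow> G k (\<epsilon> + 2 * \<delta>) (s o\<^sub>L t)"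
      by (elim exE)
    have o1: "orthonormal (insert a B)" and aB: "a \<notin> B" using orthonormal_insert[OF _ a(2,3)] B by blast+
    have "insert a B \<subseteq> N" using a B by blast
    from key[OF o1 this, of k]
    obtain b where b: "b \<in> N" "norm b = 1" "blinfun_apply (span_proj (insert a B)) b = 0"
      and b_bad: "\<not> G k (\<epsilon> / 2) (\<phi> (rank_one \<xi> b))"
      by (elim exE conjE)
    have o2: "orthonormal (insert b (insert a B))" and bB: "b \<notin> insert a B"
      using orthonormal_insert[OF o1 b(2,3)] by blast+
    have diff: "insert b (insert a B) - B = {a, b}" using aB bB by auto
    have o3: "orthonormal {a, b}" by (rule orthonormal_subset[OF o2]) auto
    have n1: "norm (\<phi> (rank_one \<xi> a)) \<le> 1" "norm (\<phi> (rank_one a b)) \<le> 1"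
      using norm_rank_one_image_le S \<xi> a(1,2) b(1,2) by blast+
    have "\<not> G n (\<epsilon> / 8) (\<phi> (rank_one a b))"
    proof
      assume "G n (\<epsilon> / 8) (\<phi> (rank_one a b))"
      then have "G k (\<delta> + 2 * (\<epsilon> / 8)) (\<phi> (rank_one \<xi> a) o\<^sub>L \<phi> (rank_one a b))"
        using \<epsilon> by (intro k[rule_format, OF m _ n1]) (simp_all add: \<delta>_def)
      moreover have "\<phi> (rank_one \<xi> a) o\<^sub>L \<phi> (rank_one a b) = \<phi> (rank_one \<xi> b)"
        using \<phi>_compose[OF S[OF \<xi>(1) a(1)] S[OF a(1) b(1)]] a(2)
        by (simp add: rank_one_compose cinner_self)
      ultimately have "G k (\<delta> + 2 * (\<epsilon> / 8)) (\<phi> (rank_one \<xi> b))" by simp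
      then have "G k (\<epsilon> / 2) (\<phi> (rank_one \<xi> b))"
        by (rule G_mono) (simp_all add: \<delta>_def min_def)
      with b_bad show False ..
    qed
    moreover have "span_proj {a, b} o\<^sub>L rank_one a b o\<^sub>L span_proj {a, b} = rank_one a b"
      by (simp add: compose_rank_one rank_one_compose_op span_proj_bounded_ops adj_span_proj
          span_proj_mem[OF o3])
    moreover have "norm (rank_one a b) \<le> 1" using norm_rank_one_le[of a b] a(2) b(2) by simp
    ultimately show "\<exists>B' t. (orthonormal B' \<and> B' \<subseteq> N) \<and> B \<subseteq> B' \<and> block_controlled E t \<and> norm t \<le> 1 \<and>
        span_proj (B' - B) o\<^sub>L t o\<^sub>L span_proj (B' - B) = t \<and> \<not> G n (\<epsilon> / 8) (\<phi> t)"
      using o2 a(1) b(1) B NE[OF a(1) b(1)] diff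
      by (intro exI[of _ "insert b (insert a B)"] exI[of _ "rank_one a b"]) auto
  qed (use \<epsilon> in auto)
qed

text \<open>For a cell \<open>A\<close> and symmetric \<open>E\<close>, an operator of propagation
  \<open>E\<close> and its adjoint map the range of \<open>P A\<close> into this space, which serves
  as \<open>N\<close> in \<open>uniformly_good_rank_one\<close>.\<close>

definition nbhd_space :: "('x \<times> 'x) set \<Rightarrow> 'x set \<Rightarrow> 'h set" where
  "nbhd_space E A = {\<eta>. \<forall>C\<in>\<P>. C \<inter> nbhd E A = {} \<longrightarrow> blinfun_apply (P C) \<eta> = 0}"

text \<open>The cells that carry \<open>a\<close> and \<open>b\<close> are all
  \<open>E\<close>-close to the single cell \<open>A\<close>, which is
  \<open>E\<^sub>0\<close>-bounded: reach \<open>A\<close> by \<open>E\<close>, cross it, and leave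
  by the symmetric \<open>E\<close>. The resulting entourage does not depend on
  \<open>A\<close>.\<close>

lemma block_controlled_rank_one_nbhd_space:
  assumes A: "A \<in> \<P>" and E: "sym E" and ab: "a \<in> nbhd_space E A" "b \<in> nbhd_space E A"
  shows "block_controlled (E O E\<^sub>0 O E) (rank_one a b)"
  unfolding block_controlled_def
proof (intro conjI ballI impI)
  fix C C' assume C: "C \<in> \<P>" "C' \<in> \<P>" "C' \<inter> nbhd (E O E\<^sub>0 O E) C = {}"
  have "C' \<inter> nbhd E A = {} \<or> C \<inter> nbhd E A = {}"
  proof (rule ccontr)
    assume "\<not> ?thesis"
    then obtain x y u v where xy: "x \<in> C'" "y \<in> A" "(x, y) \<in> E" and uv: "u \<in> C" "v \<in> A" "(u, v) \<in> E"
      by (auto simp: nbhd_def)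
    have "(y, v) \<in> E\<^sub>0" using block_bounded[OF A] xy uv by blast
    moreover have "(v, u) \<in> E" using uv E by (simp add: symD)
    ultimately have "(x, u) \<in> E O E\<^sub>0 O E" using xy by blast
    with C(3) xy uv show False by (auto simp: nbhd_def)
  qed
  then have "blinfun_apply (P C') a = 0 \<or> blinfun_apply (P C) b = 0"
    using ab C by (auto simp: nbhd_space_def)
  then have "rank_one (blinfun_apply (P C') a) (blinfun_apply (P C) b) = 0"
    by (auto intro: blinfun_eqI)
  moreover have "projection (P C)" "projection (P C')" using C block_measurable proj by blast+
  ultimately show "P C' o\<^sub>L rank_one a b o\<^sub>L P C = 0"
    by (simp add: compose_rank_one rank_one_compose_op projectionD)
qed (rule rank_one_bounded_ops)

text \<open>For a finite set \<open>B\<close> already used, the rows and columns at \<open>B\<close>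
  are uniformly good, so operators that are bad for a late index have a bad corner away from
  \<open>B\<close>. By strong closedness some finite rank compression of this corner is still bad,
  and it is the next block for \<open>no_bad_scheme\<close>.\<close>

lemma uniformly_good_ball:
  assumes E: "E \<in> \<E>" "sym E" "Id_on X \<subseteq> E"
  shows "uniformly_good {t. block_controlled E t \<and> norm t \<le> 1} (\<lambda>t. t)"
proof (rule ccontr)
  let ?K = "{t. block_controlled E t \<and> norm t \<le> 1}"
  let ?E = "E O E\<^sub>0 O E"
  assume "\<not> ?thesis"
  then obtain \<epsilon> where \<epsilon>: "\<epsilon> > 0" and bad: "\<And>n. \<exists>t. block_controlled E t \<and> norm t \<le> 1 \<and> \<not> G n \<epsilon> (\<phi> t)"
    unfolding uniformly_good_def by auto
  have E': "?E \<in> \<E>" using E E0 by (intro entourage_comp)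
  have nonempty: "A \<noteq> {}" "A \<subseteq> X" if "A \<in> \<P>" for A
    using partition that by (auto simp: partition_on_def)
  have rank_one_S: "rank_one a b \<in> cp_ops \<E> \<AA> P" if "A \<in> \<P>" "a \<in> nbhd_space E A" "b \<in> nbhd_space E A" for a b A
    by (rule block_controlled_cp_ops[OF E' block_controlled_rank_one_nbhd_space[OF that(1) E(2) that(2,3)]])
  have unif: "uniformly_good {\<eta> \<in> nbhd_space E A. norm \<eta> \<le> 1} (rank_one b)"
    if "A \<in> \<P>" "b \<in> nbhd_space E A" "norm b = 1" for A b
  proof (rule uniformly_good_rank_one[OF _ _ E'])
    fix c and x y :: 'h assume xy: "x \<in> nbhd_space E A" "y \<in> nbhd_space E A"
    then show "x + y \<in> nbhd_space E A" by (simp add: nbhd_space_def blinfun.add_right)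
  next
    fix c and x :: 'h assume x: "x \<in> nbhd_space E A"
    then show "c *\<^sub>C x \<in> nbhd_space E A"
      by (simp add: nbhd_space_def bounded_opsD[OF proj_bounded_ops[OF block_measurable]])
  qed (use that block_controlled_rank_one_nbhd_space[OF _ E(2)] in auto)
  have homE: "b \<in> nbhd_space E A" if "A \<in> \<P>" "blinfun_apply (P A) b = b" for A b
  proof -
    have "blinfun_apply (P C) b = 0" if C: "C \<in> \<P>" "C \<inter> nbhd E A = {}" for C
    proof -
      have "A \<subseteq> nbhd E A" using nonempty(2)[OF \<open>A \<in> \<P>\<close>] E(3) by (auto simp: nbhd_def)
      then have "C \<noteq> A" using C nonempty(1)[OF \<open>A \<in> \<P>\<close>] by blast
      then show ?thesis using block_orthogonal[of C A b] C \<open>A \<in> \<P>\<close> \<open>blinfun_apply (P A) b = b\<close> by simp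
    qed
    then show ?thesis by (simp add: nbhd_space_def)
  qed
  have imageE: "blinfun_apply t b \<in> nbhd_space E A" "blinfun_apply (adj t) b \<in> nbhd_space E A"
    if "A \<in> \<P>" "blinfun_apply (P A) b = b" "block_controlled E t" for A b t
  proof -
    have t: "t \<in> bounded_ops" using that by (simp add: block_controlled_def)
    have *: "blinfun_apply (P C) (blinfun_apply t b) = 0" "blinfun_apply (P C) (blinfun_apply (adj t) b) = 0"
      if C: "C \<in> \<P>" "C \<inter> nbhd E A = {}" for C
    proof -
      have "P C o\<^sub>L t o\<^sub>L P A = 0"
        using C \<open>A \<in> \<P>\<close> \<open>block_controlled E t\<close> by (simp add: block_controlled_def)
      then have "blinfun_apply (P C o\<^sub>L t o\<^sub>L P A) b = 0" by simp
      then show "blinfun_apply (P C) (blinfun_apply t b) = 0" using \<open>blinfun_apply (P A) b = b\<close> by simp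
      have "P A o\<^sub>L t o\<^sub>L P C = 0"
        using C \<open>A \<in> \<P>\<close> \<open>block_controlled E t\<close> nbhd_sym_disjoint[OF E(2) C(2)] by (simp add: block_controlled_def)
      then have "P C o\<^sub>L adj t o\<^sub>L P A = 0"
        using adj_compress[OF block_measurable[OF \<open>A \<in> \<P>\<close>] block_measurable[OF C(1)] t] by simp
      then have "blinfun_apply (P C o\<^sub>L adj t o\<^sub>L P A) b = 0" by simp
      then show "blinfun_apply (P C) (blinfun_apply (adj t) b) = 0"
        using \<open>blinfun_apply (P A) b = b\<close> by simp
    qed
    then show "blinfun_apply t b \<in> nbhd_space E A" "blinfun_apply (adj t) b \<in> nbhd_space E A"
      by (simp_all add: nbhd_space_def)
  qed
  have key: "\<exists>B' t. (orthonormal B' \<and> B' \<subseteq> homogeneous) \<and> B \<subseteq> B' \<and> block_controlled E t \<and> norm t \<le> 1 \<and>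
        span_proj (B' - B) o\<^sub>L t o\<^sub>L span_proj (B' - B) = t \<and> \<not> G n (\<epsilon> / 2) (\<phi> t)"
    if B: "orthonormal B" "B \<subseteq> homogeneous" for n B
  proof -
    define q where "q = span_proj B"
    define q' where "q' = id_blinfun - q"
    have q: "projection q" unfolding q_def by (rule projection_span_proj[OF B(1)])
    have q': "projection q'" unfolding q'_def by (rule projection_compl[OF q])
    have comm: "P A o\<^sub>L q' = q' o\<^sub>L P A" if "A \<in> \<P>" for A
      unfolding q'_def q_def by (simp add: compose_diff_left compose_diff_right span_proj_comm[OF B(2) that])
    have blk: "block_controlled E (q' o\<^sub>L t o\<^sub>L q')" if "block_controlled E t" for t
      using block_controlled_compress[OF that projectionD(1)[OF q'] comm] .
    have nrm: "norm (q' o\<^sub>L t o\<^sub>L q') \<le> 1" if "norm t \<le> 1" for t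
      using that norm_projection_le[OF q'] by (intro norm_compose_le1)
    \<comment> \<open>In each row and column one factor is the fixed unit vector \<open>b\<close>,
      the other has norm at most 1 and lies near the cell of \<open>b\<close>. Columns are handled
      as adjoints of operators with \<open>b\<close> on the left.\<close>
    have row: "uniformly_good ?K (\<lambda>t. rank_one b (blinfun_apply (adj t) b))"
        "\<And>t. t \<in> ?K \<Longrightarrow> rank_one b (blinfun_apply (adj t) b) \<in> cp_ops \<E> \<AA> P"
      and col: "uniformly_good ?K (\<lambda>t. rank_one (blinfun_apply q' (blinfun_apply t b)) b)"
        "\<And>t. t \<in> ?K \<Longrightarrow> rank_one (blinfun_apply q' (blinfun_apply t b)) b \<in> cp_ops \<E> \<AA> P"
      if b: "b \<in> B" for b
    proof -
      obtain A where A: "A \<in> \<P>" "blinfun_apply (P A) b = b" using B b by (auto simp: homogeneous_def)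
      have bN: "b \<in> nbhd_space E A" by (rule homE[OF A])
      have nb: "norm b = 1" using B b by (simp add: orthonormal_def)
      have adjN: "blinfun_apply (adj t) b \<in> {\<eta> \<in> nbhd_space E A. norm \<eta> \<le> 1}" if "t \<in> ?K" for t
      proof -
        have "norm (adj t) \<le> 1" using that by (simp add: norm_adj block_controlled_def)
        then have "norm (blinfun_apply (adj t) b) \<le> 1" using norm_blinfun[of "adj t" b] nb by simp
        then show ?thesis using imageE(2)[OF A] that by simp
      qed
      have colN: "blinfun_apply q' (blinfun_apply t b) \<in> {\<eta> \<in> nbhd_space E A. norm \<eta> \<le> 1}" if "t \<in> ?K" for t
      proof -
        have "norm (blinfun_apply q' (blinfun_apply t b)) \<le> norm (blinfun_apply t b)"
          by (rule norm_projection_apply_le[OF q'])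
        also have "\<dots> \<le> 1" using norm_blinfun[of t b] nb that by simp
        finally have "norm (blinfun_apply q' (blinfun_apply t b)) \<le> 1" .
        \<comment> \<open>The complement \<open>q'\<close> commutes with the cell projections, so
          applying it does not spread the support.\<close>
        moreover have "blinfun_apply (P C) (blinfun_apply q' (blinfun_apply t b)) = 0"
          if "C \<in> \<P>" "C \<inter> nbhd E A = {}" for C
        proof -
          have "blinfun_apply (P C) (blinfun_apply t b) = 0"
            using imageE(1)[OF A] \<open>t \<in> ?K\<close> that by (simp add: nbhd_space_def)
          then have "blinfun_apply (q' o\<^sub>L P C) (blinfun_apply t b) = 0" by simp
          then show ?thesis unfolding comm[OF that(1), symmetric] by simp
        qed
        ultimately show ?thesis by (simp add: nbhd_space_def)
      qed
      show "uniformly_good ?K (\<lambda>t. rank_one b (blinfun_apply (adj t) b))"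
        by (rule uniformly_good_comp[OF unif[OF A(1) bN nb] adjN]) auto
      show "rank_one b (blinfun_apply (adj t) b) \<in> cp_ops \<E> \<AA> P" if "t \<in> ?K" for t
        using rank_one_S[OF A(1) bN] adjN[OF that] by simp
      have "uniformly_good ?K (\<lambda>t. adj (rank_one b (blinfun_apply q' (blinfun_apply t b))))"
      proof (rule uniformly_good_adj)
        show "uniformly_good ?K (\<lambda>t. rank_one b (blinfun_apply q' (blinfun_apply t b)))"
          by (rule uniformly_good_comp[OF unif[OF A(1) bN nb] colN]) auto
        show "rank_one b (blinfun_apply q' (blinfun_apply t b)) \<in> cp_ops \<E> \<AA> P" if "t \<in> ?K" for t
          using rank_one_S[OF A(1) bN] colN[OF that] by simp
      qed
      then show "uniformly_good ?K (\<lambda>t. rank_one (blinfun_apply q' (blinfun_apply t b)) b)"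
        by (simp add: adj_rank_one)
      show "rank_one (blinfun_apply q' (blinfun_apply t b)) b \<in> cp_ops \<E> \<AA> P" if "t \<in> ?K" for t
        using rank_one_S[OF A(1) _ bN] colN[OF that] by simp
    qed
    have zero_S: "0 \<in> cp_ops \<E> \<AA> P"
      using E(1) by (intro block_controlled_cp_ops[OF E(1)]) (simp add: block_controlled_def bounded_ops_zero)
    have finB: "finite B" using B by (simp add: orthonormal_def)
    have split: "t - (q' o\<^sub>L t o\<^sub>L q') = (\<Sum>b\<in>B. rank_one b (blinfun_apply (adj t) b))
        + (\<Sum>b\<in>B. rank_one (blinfun_apply q' (blinfun_apply t b)) b)" if "t \<in> ?K" for t
    proof -
      have t: "t \<in> bounded_ops" using that by (simp add: block_controlled_def)
      have "q o\<^sub>L t = (\<Sum>b\<in>B. rank_one b b o\<^sub>L t)"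
        unfolding q_def span_proj_def using finB by induction (auto simp: compose_add_left)
      also have "\<dots> = (\<Sum>b\<in>B. rank_one b (blinfun_apply (adj t) b))" by (simp add: rank_one_compose_op[OF t])
      finally have 1: "q o\<^sub>L t = (\<Sum>b\<in>B. rank_one b (blinfun_apply (adj t) b))" .
      have "(q' o\<^sub>L t) o\<^sub>L q = (\<Sum>b\<in>B. (q' o\<^sub>L t) o\<^sub>L rank_one b b)"
        unfolding q_def span_proj_def using finB by induction (auto simp: compose_add_right)
      also have "\<dots> = (\<Sum>b\<in>B. rank_one (blinfun_apply q' (blinfun_apply t b)) b)"
        by (simp add: compose_rank_one[OF bounded_ops_compose[OF projectionD(1)[OF q'] t]])
      finally have 2: "(q' o\<^sub>L t) o\<^sub>L q = (\<Sum>b\<in>B. rank_one (blinfun_apply q' (blinfun_apply t b)) b)" .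
      have "t - (q' o\<^sub>L t o\<^sub>L q') = (q o\<^sub>L t) + ((q' o\<^sub>L t) o\<^sub>L q)"
        by (rule blinfun_eqI)
          (simp add: q'_def blinfun.add_left blinfun.diff_left blinfun.diff_right)
      then show ?thesis unfolding 1 2 .
    qed
    have "uniformly_good ?K (\<lambda>t. (\<Sum>b\<in>B. rank_one b (blinfun_apply (adj t) b))
        + (\<Sum>b\<in>B. rank_one (blinfun_apply q' (blinfun_apply t b)) b))"
    proof (rule uniformly_good_add)
      show "uniformly_good ?K (\<lambda>t. \<Sum>b\<in>B. rank_one b (blinfun_apply (adj t) b))"
        by (rule uniformly_good_sum[OF zero_S finB row])
      show "uniformly_good ?K (\<lambda>t. \<Sum>b\<in>B. rank_one (blinfun_apply q' (blinfun_apply t b)) b)"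
        by (rule uniformly_good_sum[OF zero_S finB col])
      show "(\<Sum>b\<in>B. rank_one b (blinfun_apply (adj t) b)) \<in> cp_ops \<E> \<AA> P" if "t \<in> ?K" for t
        by (rule S_sum[OF zero_S row(2)[OF _ that]])
      show "(\<Sum>b\<in>B. rank_one (blinfun_apply q' (blinfun_apply t b)) b) \<in> cp_ops \<E> \<AA> P" if "t \<in> ?K" for t
        by (rule S_sum[OF zero_S col(2)[OF _ that]])
    qed
    then have "uniformly_good ?K (\<lambda>t. t - (q' o\<^sub>L t o\<^sub>L q'))"
      by (rule uniformly_good_cong[rotated]) (rule split)
    moreover have "\<epsilon> / 2 > 0" using \<epsilon> by simp
    ultimately obtain m where m: "\<forall>t\<in>?K. G m (\<epsilon> / 2) (\<phi> (t - (q' o\<^sub>L t o\<^sub>L q')))"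
      unfolding uniformly_good_def by blast
    \<comment> \<open>Index \<open>m\<close> absorbs the rows and columns at the cost of
      \<open>\<epsilon> / 2\<close>; index \<open>n\<close> is the one that the scheme asks
      for.\<close>
    from bad[of "max m n"] obtain t where t: "block_controlled E t" "norm t \<le> 1" "\<not> G (max m n) \<epsilon> (\<phi> t)"
      by (elim exE conjE)
    define t2 where "t2 = q' o\<^sub>L t o\<^sub>L q'"
    have t2: "block_controlled E t2" "norm t2 \<le> 1" unfolding t2_def by (rule blk[OF t(1)], rule nrm[OF t(2)])
    have t2_bad: "\<not> G n (\<epsilon> / 2) (\<phi> t2)"
    proof
      assume "G n (\<epsilon> / 2) (\<phi> t2)"
      then have 1: "G (max m n) (\<epsilon> / 2) (\<phi> t2)" by (rule G_mono) auto
      have 2: "G (max m n) (\<epsilon> / 2) (\<phi> (t - t2))"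
        unfolding t2_def by (rule G_mono[OF bspec[OF m]]) (use t in auto)
      have "block_controlled E (t - t2)"
        using t(1) t2(1) by (simp add: block_controlled_def bounded_ops_diff compose_diff_left compose_diff_right)
      then have "\<phi> ((t - t2) + t2) = \<phi> (t - t2) + \<phi> t2"
        by (intro \<phi>_add block_controlled_cp_ops[OF E(1)] t2(1))
      then have "G (max m n) \<epsilon> (\<phi> t)" using G_add[OF 2 1] by simp
      with t(3) show False ..
    qed
    obtain Bs where Bs: "\<And>W. orthonormal (Bs W)" "\<And>W. Bs W \<subseteq> homogeneous" "\<And>W. B \<subseteq> Bs W"
      and net: "\<And>x. ((\<lambda>W. blinfun_apply (span_proj (Bs W)) x) \<longlongrightarrow> x) (finite_subsets_at_top homogeneous)"
      using span_proj_net[OF B] by metis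
    let ?c = "\<lambda>W. span_proj (Bs W) o\<^sub>L t2 o\<^sub>L span_proj (Bs W)"
    have c: "block_controlled E (?c W)" for W
      by (rule block_controlled_compress[OF t2(1) span_proj_bounded_ops span_proj_comm[OF Bs(2)]])
    have c_norm: "norm (?c W) \<le> 1" for W
      by (intro norm_compose_le1 norm_projection_le projection_span_proj Bs t2)
    have "\<exists>W. \<not> G n (\<epsilon> / 2) (\<phi> (?c W))"
    proof (rule ccontr)
      assume "\<not> ?thesis"
      then have good: "G n (\<epsilon> / 2) (\<phi> (?c W))" for W by simp
      have "((\<lambda>W. blinfun_apply (?c W) x) \<longlongrightarrow> blinfun_apply t2 x) (finite_subsets_at_top homogeneous)" for x
        by (rule compress_tendsto[OF norm_projection_le[OF projection_span_proj[OF Bs(1)]] net])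
      then have "((\<lambda>W. blinfun_apply (\<phi> (?c W)) y) \<longlongrightarrow> blinfun_apply (\<phi> t2) y) (finite_subsets_at_top homogeneous)" for y
        by (intro \<phi>_tendsto block_controlled_cp_ops[OF E(1)] c t2(1))
      then have "G n (\<epsilon> / 2) (\<phi> t2)"
        by (rule G_tendsto[OF finite_subsets_at_top_neq_bot _ good])
      with t2_bad show False ..
    qed
    then obtain W where W: "\<not> G n (\<epsilon> / 2) (\<phi> (?c W))" by (elim exE)
    let ?r = "span_proj (Bs W - B)"
    \<comment> \<open>Since \<open>B\<close> is contained in \<open>Bs W\<close>, multiplying by
      \<open>q'\<close> removes exactly the span of \<open>B\<close>. The compression thus lives on
      the new vectors only, as the scheme demands.\<close>
    have r_eq: "?r = span_proj (Bs W) - q" unfolding q_def by (rule span_proj_Diff[OF Bs(1,3)])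
    have left: "span_proj (Bs W) o\<^sub>L q' = ?r" and right: "q' o\<^sub>L span_proj (Bs W) = ?r"
      unfolding q'_def r_eq
      by (simp_all add: compose_diff_left compose_diff_right q_def span_proj_compose'[OF Bs(1,3)]
          span_proj_compose[OF Bs(1,3)])
    have "?c W = (span_proj (Bs W) o\<^sub>L q') o\<^sub>L t o\<^sub>L (q' o\<^sub>L span_proj (Bs W))"
      unfolding t2_def by (simp only: compose_assoc)
    then have c_eq: "?c W = ?r o\<^sub>L t o\<^sub>L ?r" by (simp only: left right)
    have rr: "?r o\<^sub>L ?r = ?r"
      by (rule span_proj_compose[OF orthonormal_subset[OF Bs(1)[of W]]]) auto
    have "?r o\<^sub>L ?c W o\<^sub>L ?r = (?r o\<^sub>L ?r) o\<^sub>L t o\<^sub>L (?r o\<^sub>L ?r)"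
      unfolding c_eq by (simp only: compose_assoc)
    then have "?r o\<^sub>L ?c W o\<^sub>L ?r = ?c W" unfolding rr c_eq .
    then show ?thesis
      using Bs(1-3)[of W] c[of W] c_norm[of W] W
      by (intro exI[of _ "Bs W"] exI[of _ "?c W"]) blast
  qed
  show False
    by (rule no_bad_scheme[OF E(1), of "\<epsilon> / 2" "\<lambda>B. orthonormal B \<and> B \<subseteq> homogeneous"])
      (use \<epsilon> key in auto)
qed

text \<open>Rescaling to the unit ball turns uniform goodness into a bound relative to the norm of
  \<open>t\<close>.\<close>

lemma uniformly_good_controlled:
  assumes E: "E \<in> \<E>" and \<epsilon>: "\<epsilon> > 0"
  shows "\<exists>n. \<forall>t. controlled_propagation \<AA> P E t \<longrightarrow> G n (\<epsilon> * norm t) (\<phi> t)"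
proof -
  let ?E = "E \<union> E\<inverse> \<union> Id_on X"
  have "?E \<in> \<E>" "sym ?E" "Id_on X \<subseteq> ?E"
    using E by (auto intro!: entourage_Un entourage_converse entourage_diag simp: sym_def)
  from uniformly_good_ball[OF this] \<epsilon>
  obtain n where n: "\<And>t. block_controlled ?E t \<Longrightarrow> norm t \<le> 1 \<Longrightarrow> G n \<epsilon> (\<phi> t)"
    unfolding uniformly_good_def by blast
  have "G n (\<epsilon> * norm t) (\<phi> t)" if t: "controlled_propagation \<AA> P E t" for t
  proof -
    \<comment> \<open>For \<open>t = 0\<close> the quotient is 0 by the convention on division, so
      \<open>u = 0\<close> and no separate case arises.\<close>
    define u where "u = scaleC_op (of_real (1 / norm t)) t"
    have "controlled_propagation \<AA> P ?E u"
      unfolding u_def by (rule controlled_propagation_mono[OF controlled_propagation_scaleC[OF t]]) auto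
    then have "block_controlled ?E u" by (rule controlled_imp_block_controlled)
    moreover have "norm u \<le> 1" unfolding u_def scaleC_op_of_real by simp
    ultimately have "G n \<epsilon> (\<phi> u)" by (rule n)
    from G_scaleC[OF this, of "of_real (norm t)"]
    have "G n (\<epsilon> * norm t) (scaleC_op (of_real (norm t)) (\<phi> u))" by (simp add: mult.commute)
    moreover have "scaleC_op (of_real (norm t)) (\<phi> u) = \<phi> (scaleC_op (of_real (norm t)) u)"
    proof (rule \<phi>_scaleC[symmetric])
      show "u \<in> cp_ops \<E> \<AA> P"
        unfolding u_def cp_ops_def using controlled_propagation_scaleC[OF t] E by blast
    qed
    moreover have "scaleC_op (of_real (norm t)) u = t"
      unfolding u_def scaleC_op_of_real by simp
    ultimately show ?thesis by simp
  qed
  then show ?thesis by blast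
qed

end

section \<open>Application to Roe-like algebras\<close>

text \<open>The strong operator topology is pulled back from the product topology, so pointwise
  convergence is convergence in it. The index type of the filter is arbitrary, which serves nets and
  sequences alike.\<close>

lemma strongly_continuous_tendsto:
  fixes \<phi> :: "('h::complex_hilbert_space \<Rightarrow>\<^sub>L 'h) \<Rightarrow> ('k::complex_hilbert_space \<Rightarrow>\<^sub>L 'k)"
  assumes \<phi>: "strongly_continuous S T \<phi>" and u: "\<And>\<alpha>. u \<alpha> \<in> S" and s: "s \<in> S"
    and lim: "\<And>x. ((\<lambda>\<alpha>. blinfun_apply (u \<alpha>) x) \<longlongrightarrow> blinfun_apply s x) Fl"
  shows "((\<lambda>\<alpha>. blinfun_apply (\<phi> (u \<alpha>)) y) \<longlongrightarrow> blinfun_apply (\<phi> s) y) Fl"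
proof -
  have "limitin (subtopology strong_operator_topology S) u s Fl"
    unfolding limitin_subtopology
  proof (intro conjI)
    show "limitin strong_operator_topology u s Fl"
      unfolding limitin_def
    proof (intro conjI allI impI)
      show "s \<in> topspace strong_operator_topology" by (simp add: strong_operator_topology_topspace)
      fix U :: "('h \<Rightarrow>\<^sub>L 'h) set" assume U: "openin strong_operator_topology U \<and> s \<in> U"
      then obtain V where V: "open V" "U = blinfun_apply -` V"
        unfolding strong_operator_topology_def openin_pullback_topology by auto
      have "((\<lambda>\<alpha>. blinfun_apply (u \<alpha>)) \<longlongrightarrow> blinfun_apply s) Fl"
        unfolding tendsto_fun_iff using lim by blast
      from topological_tendstoD[OF this V(1)] U V(2) show "\<forall>\<^sub>F \<alpha> in Fl. u \<alpha> \<in> U" by simp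
    qed
  qed (use u s in auto)
  moreover have "continuous_map (subtopology strong_operator_topology S) euclidean
      ((\<lambda>f. blinfun_apply f y) \<circ> \<phi>)"
  proof (rule continuous_map_compose)
    show "continuous_map (subtopology strong_operator_topology S) strong_operator_topology \<phi>"
      using \<phi> unfolding strongly_continuous_def by (simp add: continuous_map_in_subtopology)
  qed (rule strong_operator_topology_continuous_evaluation)
  ultimately have "limitin euclidean (((\<lambda>f. blinfun_apply f y) \<circ> \<phi>) \<circ> u) (((\<lambda>f. blinfun_apply f y) \<circ> \<phi>) s) Fl"
    by (rule continuous_map_limit[rotated])
  then show ?thesis by (simp add: comp_def)
qed

context coarse_module
begin

lemma cp_ops_add:
  assumes "s \<in> cp_ops \<E> \<AA> P" "t \<in> cp_ops \<E> \<AA> P" shows "s + t \<in> cp_ops \<E> \<AA> P"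
proof -
  obtain E E' where E: "E \<in> \<E>" "controlled_propagation \<AA> P E s"
    and E': "E' \<in> \<E>" "controlled_propagation \<AA> P E' t"
    using assms unfolding cp_ops_def by blast
  have "controlled_propagation \<AA> P (E \<union> E') (s + t)"
    by (intro controlled_propagation_add controlled_propagation_mono[OF E(2)]
        controlled_propagation_mono[OF E'(2)]) auto
  then show ?thesis unfolding cp_ops_def using entourage_Un[OF E(1) E'(1)] by blast
qed

lemma cp_ops_scaleC: "s \<in> cp_ops \<E> \<AA> P \<Longrightarrow> scaleC_op c s \<in> cp_ops \<E> \<AA> P"
  unfolding cp_ops_def using controlled_propagation_scaleC by blast

lemma cp_ops_bounded_ops: "cp_ops \<E> \<AA> P \<subseteq> bounded_ops"
  by (auto simp: cp_ops_def controlled_propagation_def)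

text \<open>The closure is taken among all bounded real linear maps, so complex linearity of
  \<open>t\<close> has to be recovered from closedness of \<open>bounded_ops\<close>.\<close>

lemma closure_cp_ops_approximable:
  assumes "t \<in> closure (cp_ops \<E> \<AA> P)" "\<epsilon> > 0"
  obtains E where "E \<in> \<E>" "approximable \<AA> P \<epsilon> E t"
proof -
  have "t \<in> bounded_ops"
    using closure_minimal[OF cp_ops_bounded_ops bounded_ops_closed] assms(1) by blast
  moreover obtain s where "s \<in> cp_ops \<E> \<AA> P" "dist s t < \<epsilon>"
    using assms unfolding closure_approachable by blast
  ultimately show thesis
    using that unfolding cp_ops_def approximable_def
    by (auto simp: dist_norm norm_minus_commute intro: less_imp_le)
qed

end

text \<open>A common interface for both kinds of goodness, so that the two halves of the theorem
  come from one instantiation of the abstract argument.\<close>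

fun propagation_good ::
  "roe_kind \<Rightarrow> 'y set set \<Rightarrow> ('y set \<Rightarrow> ('k::complex_hilbert_space \<Rightarrow>\<^sub>L 'k)) \<Rightarrow> real \<Rightarrow>
    ('y \<times> 'y) set \<Rightarrow> ('k \<Rightarrow>\<^sub>L 'k) \<Rightarrow> bool" where
  "propagation_good CP \<BB> Q \<epsilon> F s = approximable \<BB> Q \<epsilon> F s"
| "propagation_good QL \<BB> Q \<epsilon> F s = quasi_local \<BB> Q \<epsilon> F s"

context coarse_module
begin

lemma propagation_good_tendsto:
  assumes "Fl \<noteq> bot" "\<And>x. ((\<lambda>\<alpha>. blinfun_apply (u \<alpha>) x) \<longlongrightarrow> blinfun_apply s x) Fl"
    and "\<And>\<alpha>. propagation_good R \<AA> P \<epsilon> E (u \<alpha>)"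
  shows "propagation_good R \<AA> P \<epsilon> E s"
  using assms(3) approximable_tendsto[OF assms(1,2)] quasi_local_tendsto[OF assms(1,2)]
  by (cases R) simp_all

lemma propagation_good_mono:
  "propagation_good R \<AA> P \<epsilon> E s \<Longrightarrow> E \<subseteq> E' \<Longrightarrow> \<epsilon> \<le> \<delta> \<Longrightarrow> propagation_good R \<AA> P \<delta> E' s"
  using approximable_mono quasi_local_mono by (cases R) simp_all

lemma propagation_good_compose:
  assumes W: "\<And>A. A \<subseteq> X \<Longrightarrow> \<exists>A'\<in>\<AA>. A \<subseteq> A' \<and> A' \<subseteq> nbhd W A"
    and E: "E \<subseteq> X \<times> X" and sub: "E' O W O E \<subseteq> E''"
    and s: "propagation_good R \<AA> P \<epsilon> E' s" and t: "propagation_good R \<AA> P \<delta> E t"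
    and norms: "norm s \<le> 1" "norm t \<le> 1" "\<epsilon> \<le> 1" and \<delta>: "0 \<le> \<delta>"
  shows "propagation_good R \<AA> P (\<epsilon> + 2 * \<delta>) E'' (s o\<^sub>L t)"
proof (cases R)
  case CP
  then show ?thesis using s t approximable_compose[OF W E sub _ _ norms] by simp
next
  case QL
  then have "quasi_local \<AA> P (\<epsilon> + \<delta>) E'' (s o\<^sub>L t)"
    using s t by (intro quasi_local_compose[OF W E sub _ _ norms(1,2)]) simp_all
  \<comment> \<open>The sum is weakened to the constant of the approximable case, so that one axiom
    covers both kinds.\<close>
  then show ?thesis using quasi_local_mono[OF _ order_refl] QL \<delta> by simp
qed

lemma roe_algebra_good:
  assumes "t \<in> roe_algebra R \<E> \<AA> P" "\<epsilon> > 0"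
  obtains E where "E \<in> \<E>" "propagation_good R \<AA> P \<epsilon> E t"
proof (cases R)
  case CP
  then show thesis using assms that closure_cp_ops_approximable[of t \<epsilon>] by auto
next
  case QL
  then have "\<forall>\<epsilon>>0. \<exists>E\<in>\<E>. quasi_local \<AA> P \<epsilon> E t"
    using assms(1) by (simp add: ql_ops_def)
  then obtain E where "E \<in> \<E>" "quasi_local \<AA> P \<epsilon> E t" using assms(2) by blast
  with QL show thesis by (intro that) simp_all
qed

lemma propagation_good_bounded_ops: "propagation_good R \<AA> P \<epsilon> E t \<Longrightarrow> t \<in> bounded_ops"
  by (cases R) (auto simp: approximable_def quasi_local_def)

end

text \<open>The abstract index \<open>n\<close> is read as the cofinal entourage \<open>F n\<close>;
  membership of \<open>\<phi> s\<close> in the target algebra gives goodness for some index.\<close>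

lemma star_hom_uniformly_good:
  fixes P :: "'x set \<Rightarrow> ('h::complex_hilbert_space \<Rightarrow>\<^sub>L 'h)"
    and Q :: "'y set \<Rightarrow> ('k::complex_hilbert_space \<Rightarrow>\<^sub>L 'k)"
  assumes hom: "star_hom (cp_ops \<E> \<AA> P) (roe_algebra R \<F> \<BB> Q) \<phi>"
    and disc: "discrete_module X \<E> \<AA> P"
    and adm: "admissible_module Y \<F> \<BB> Q"
    and count: "countably_generated Y \<F>"
    and cont: "strongly_continuous (cp_ops \<E> \<AA> P) (roe_algebra R \<F> \<BB> Q) \<phi>"
    and E: "E \<in> \<E>" and \<epsilon>: "\<epsilon> > 0"
  shows "\<exists>F\<in>\<F>. \<forall>t. controlled_propagation \<AA> P E t \<longrightarrow> propagation_good R \<BB> Q (\<epsilon> * norm t) F (\<phi> t)"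
proof -
  from disc obtain E0 \<P> where dm: "coarse_module X \<E> \<AA> P" "gauge_of X \<E> E0" "partition_on X \<P>"
    "\<forall>A\<in>\<P>. A \<in> \<AA> \<and> rel_bounded E0 A" "\<forall>v. ((\<lambda>A. blinfun_apply (P A) v) has_sum v) \<P>"
    unfolding discrete_module_def by (elim exE conjE)
  from adm obtain W where Q: "coarse_module Y \<F> \<BB> Q" and W: "gauge_of Y \<F> W"
    "\<forall>A\<subseteq>Y. \<exists>A'\<in>\<BB>. A \<subseteq> A' \<and> A' \<subseteq> nbhd W A"
    unfolding admissible_module_def by (elim exE conjE)
  interpret Y: coarse_module Y \<F> \<BB> Q by (rule Q)
  interpret X: block_module X \<E> \<AA> P E0 \<P>
    by (intro block_module.intro block_module_axioms.intro dm(1,3))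
      (use dm(2,4,5) in \<open>auto simp: gauge_of_def rel_bounded_def\<close>)
  show ?thesis
  proof (rule countably_generated_cofinal[OF count])
    fix F :: "nat \<Rightarrow> ('y \<times> 'y) set"
    assume F: "\<And>n. F n \<in> \<F>" "\<And>n. sym (F n)" "mono F"
      and cofinal: "\<And>E. E \<in> \<F> \<Longrightarrow> \<exists>n. E \<subseteq> F n"
    have good: "\<exists>n. propagation_good R \<BB> Q \<epsilon> (F n) (\<phi> s)" if s: "s \<in> cp_ops \<E> \<AA> P" and "\<epsilon> > 0" for s \<epsilon>
    proof -
      have "\<phi> s \<in> roe_algebra R \<F> \<BB> Q" using hom s unfolding star_hom_def by blast
      then obtain E where "E \<in> \<F>" "propagation_good R \<BB> Q \<epsilon> E (\<phi> s)"
        using Y.roe_algebra_good \<open>\<epsilon> > 0\<close> by blast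
      then show ?thesis using cofinal Y.propagation_good_mono by blast
    qed
    interpret block_module_hom X \<E> \<AA> P E0 \<P> \<phi> "\<lambda>n \<epsilon> s. propagation_good R \<BB> Q \<epsilon> (F n) s"
    proof
      fix s t assume s: "s \<in> cp_ops \<E> \<AA> P"
      show "\<phi> s \<in> bounded_ops" using good[OF s, of 1] Y.propagation_good_bounded_ops by auto
      show "scaleC_op c s \<in> cp_ops \<E> \<AA> P" for c by (rule X.cp_ops_scaleC[OF s])
      show "\<phi> (scaleC_op c s) = scaleC_op c (\<phi> s)" for c using hom s unfolding star_hom_def by blast
      show "\<phi> (adj s) = adj (\<phi> s)" using hom s unfolding star_hom_def by blast
      show "\<exists>n. propagation_good R \<BB> Q \<epsilon> (F n) (\<phi> s)" if "0 < \<epsilon>" for \<epsilon> by (rule good[OF s that])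
      assume t: "t \<in> cp_ops \<E> \<AA> P"
      show "s + t \<in> cp_ops \<E> \<AA> P" by (rule X.cp_ops_add[OF s t])
      show "\<phi> (s + t) = \<phi> s + \<phi> t" using hom s t unfolding star_hom_def by blast
      show "\<phi> (s o\<^sub>L t) = \<phi> s o\<^sub>L \<phi> t" using hom s t unfolding star_hom_def by blast
    next
      fix m n :: nat and \<epsilon> \<delta> :: real and a
      assume "propagation_good R \<BB> Q \<epsilon> (F m) a" "m \<le> n" "\<epsilon> \<le> \<delta>"
      then show "propagation_good R \<BB> Q \<delta> (F n) a"
        using Y.propagation_good_mono monoD[OF F(3)] by blast
    next
      fix n :: nat and \<epsilon> \<delta> :: real and a b
      assume "propagation_good R \<BB> Q \<epsilon> (F n) a" "propagation_good R \<BB> Q \<delta> (F n) b"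
      then show "propagation_good R \<BB> Q (\<epsilon> + \<delta>) (F n) (a + b)"
        by (cases R) (simp_all add: Y.approximable_add Y.quasi_local_add)
    next
      fix n :: nat and \<epsilon> :: real and a c
      assume a: "propagation_good R \<BB> Q \<epsilon> (F n) a"
      then show "propagation_good R \<BB> Q (cmod c * \<epsilon>) (F n) (scaleC_op c a)"
        by (cases R) (simp_all add: Y.approximable_scaleC Y.quasi_local_scaleC)
      from a show "propagation_good R \<BB> Q \<epsilon> (F n) (adj a)"
        by (cases R) (simp_all add: Y.approximable_adj Y.quasi_local_adj F)
    next
      fix m n
      have "W \<in> \<F>" using W(1) by (simp add: gauge_of_def)
      \<comment> \<open>The index of a product has to absorb both entourages and the admissibility
        gauge between them.\<close>
      then have "F m O W O F n \<in> \<F>" by (intro Y.entourage_comp F)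
      then obtain k where k: "F m O W O F n \<subseteq> F k" using cofinal by blast
      have "propagation_good R \<BB> Q (\<epsilon> + 2 * \<delta>) (F k) (s o\<^sub>L t)"
        if "propagation_good R \<BB> Q \<epsilon> (F m) s" "propagation_good R \<BB> Q \<delta> (F n) t"
          "norm s \<le> 1" "norm t \<le> 1" "\<epsilon> \<le> 1" "0 \<le> \<delta>" for s t \<epsilon> \<delta>
        by (rule Y.propagation_good_compose[OF _ Y.entourage_subset[OF F(1)] k that]) (use W(2) in blast)
      then show "\<exists>k. \<forall>s t \<epsilon> \<delta>. propagation_good R \<BB> Q \<epsilon> (F m) s \<longrightarrow> propagation_good R \<BB> Q \<delta> (F n) t \<longrightarrow>
          norm s \<le> 1 \<longrightarrow> norm t \<le> 1 \<longrightarrow> \<epsilon> \<le> 1 \<longrightarrow> 0 \<le> \<delta> \<longrightarrow>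
          propagation_good R \<BB> Q (\<epsilon> + 2 * \<delta>) (F k) (s o\<^sub>L t)"
        by blast
    next
      fix n \<epsilon> s and u :: "nat \<Rightarrow> 'k \<Rightarrow>\<^sub>L 'k"
      assume "\<And>x. (\<lambda>k. blinfun_apply (u k) x) \<longlonglongrightarrow> blinfun_apply s x"
        "\<And>k. propagation_good R \<BB> Q \<epsilon> (F n) (u k)"
      then show "propagation_good R \<BB> Q \<epsilon> (F n) s"
        by (rule Y.propagation_good_tendsto[OF sequentially_bot])
    \<comment> \<open>What remains is continuity of \<phi> for both index types and closedness of
      goodness along nets.\<close>
    qed (rule strongly_continuous_tendsto[OF cont] Y.propagation_good_tendsto; assumption)+
    from uniformly_good_controlled[OF E \<epsilon>] F(1) show ?thesis by blast
  qed
qed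

theorem theorem1p5:
  fixes X :: "'x set" and \<E> :: "('x \<times> 'x) set set" and \<AA> :: "'x set set"
    and P :: "'x set \<Rightarrow> ('h::complex_hilbert_space \<Rightarrow>\<^sub>L 'h)"
    and Y :: "'y set" and \<F> :: "('y \<times> 'y) set set" and \<BB> :: "'y set set"
    and Q :: "'y set \<Rightarrow> ('k::complex_hilbert_space \<Rightarrow>\<^sub>L 'k)"
    and R :: roe_kind
    and \<phi> :: "('h \<Rightarrow>\<^sub>L 'h) \<Rightarrow> ('k \<Rightarrow>\<^sub>L 'k)"
  assumes "coarse_module X \<E> \<AA> P"
    and "coarse_module Y \<F> \<BB> Q"
    and "star_hom (cp_ops \<E> \<AA> P) (roe_algebra R \<F> \<BB> Q) \<phi>"
    and "discrete_module X \<E> \<AA> P"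
    and "admissible_module Y \<F> \<BB> Q"
    and "countably_generated Y \<F>"
    and "strongly_continuous (cp_ops \<E> \<AA> P) (roe_algebra R \<F> \<BB> Q) \<phi>"
  shows "(R = CP \<longrightarrow> approximately_controlled \<E> \<AA> P \<F> \<BB> Q \<phi>) \<and>
         (R = QL \<longrightarrow> quasi_controlled \<E> \<AA> P \<F> \<BB> Q \<phi>)"
proof (intro conjI impI)
  assume "R = CP"
  with star_hom_uniformly_good[OF assms(3-7)]
  show "approximately_controlled \<E> \<AA> P \<F> \<BB> Q \<phi>"
    unfolding approximately_controlled_def by (metis propagation_good.simps(1))
next
  assume "R = QL"
  with star_hom_uniformly_good[OF assms(3-7)]
  show "quasi_controlled \<E> \<AA> P \<F> \<BB> Q \<phi>"
    unfolding quasi_controlled_def by (metis propagation_good.simps(2))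
qed

end
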